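(* Let $k\ge 1$ be an integer and let $M$ be a smooth $n$-dimensional manifold whose formal loop space is endowed with a homogeneous local Poisson bracket of degree $k$, given in each chart with coordinates $u^1,\dots,u^n$ by $$\{u^i(x),u^j(y)\}=\sum_{s=0}^k P_s^{ij}\,\delta^{(s)}(x-y)=g^{ij}(u)\,\delta^{(k)}(x-y)+\sum_{s=0}^{k-1}h_{(s)l}^{ij}(u)\,u^{l,k-s}\,\delta^{(s)}(x-y)+\cdots,$$ where the dots denote terms of degree two or more in the variables $u^{i,s}$, $s\ge1$. Assume that the $(2,0)$-tensor $g=(g^{ij})$ is nondegenerate. Let $\nabla^{(0)},\dots,\nabla^{(k-1)}$ be the standard connections on $TM$, with Christoffel symbols $$\Gamma_{(s)ij}^{l}=-\binom{k}{s}^{-1}g_{ii'}h_{(s)j}^{i'l},\qquad s=0,\dots,k-1,$$ and for $s=0,\dots,k-1$ define the connection on $TM$ $$\nabla^{[s]}=\sum_{t=0}^{s}c_s^t\,\nabla^{(t)},\qquad c_s^t=(-1)^t\binom{k+s-t}{k}\binom{k}{t}$$ (this is a connection since $\sum_{t=0}^s c_s^t=1$). Then the connections $\nabla^{[0]},\dots,\nabla^{[k-1]}$ are flat, i.e. each has vanishing curvature.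
   Context: Summation over repeated indices $1,\dots,n$ is understood. On a chart $U$ with coordinates $u^1,\dots,u^n$, $\mathcal{A}$ denotes the algebra of differential polynomials: formal power series in the variables $u^{i,s}$ ($1\le i\le n$, $s\ge1$) with coefficients smooth functions of $u^1,\dots,u^n$. Put $u^{i,0}=u^i$. The standard degree assigns degree $s$ to $u^{i,s}$, and $\mathcal{A}_d$ is the homogeneous component of standard degree $d$. The total derivative is $\partial_x=\sum_{s\ge0}u^{i,s+1}\frac{\partial}{\partial u^{i,s}}$. A homogeneous local bracket of degree $k$ is given on each chart by coefficients $P_s^{ij}\in\mathcal{A}_{k-s}$, $0\le s\le k$, written formally as $\{u^i(x),u^j(y)\}=\sum_{s=0}^kP_s^{ij}\delta^{(s)}(x-y)$. Under coordinate changes $\tilde u^i=\tilde u^i(u)$ the coefficients transform as $$\tilde P_s^{ij}=\sum_{t\ge0}\binom{s+t}{s}\frac{\partial\tilde u^i}{\partial u^{i'}}P_{s+t}^{i'j'}\,\partial_x^t\Big(\frac{\partial\tilde u^j}{\partial u^{j'}}\Big).$$ It is a Poisson bracket if it is skew-symmetric and satisfies the Jacobi identity. Equivalently, the bracket $$\{F,G\}=\int\frac{\delta F}{\delta u^i}\sum_{s}P_s^{ij}\,\partial_x^s\Big(\frac{\delta G}{\delta u^j}\Big)$$ on local functionals $\mathcal{A}/\partial_x\mathcal{A}$ is a Lie bracket, where $\int:\mathcal{A}\to\mathcal{A}/\partial_x\mathcal{A}$ is the projection and $\frac{\delta}{\delta u^i}=\sum_{s\ge0}(-\partial_x)^s\frac{\partial}{\partial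 u^{i,s}}$. The coefficients $g^{ij}$ define a $(2,0)$-tensor with $g^{ji}=(-1)^{k+1}g^{ij}$, and $(g_{ij})$ denotes the inverse matrix of $(g^{ij})$. The functions $\Gamma_{(s)ij}^l$ transform as Christoffel symbols. They define a connection on $TM$ by the convention $\nabla_{\partial_i}\partial_j=\Gamma_{ij}^l\partial_l$, where the first lower index is the direction of differentiation. *)

theory Defs
  imports "HOL-Analysis.Analysis" "HOL-Library.Multiset"
begin

section \<open>Smooth functions and smooth manifolds\<close>

definition partial :: "'n::finite \<Rightarrow> (real^'n \<Rightarrow> real) \<Rightarrow> real^'n \<Rightarrow> real" where
  "partial i f u = frechet_derivative f (at u) (axis i 1)"

text \<open>On an open set, differentiability of all iterated partial derivatives forces their
  continuity, so this is the usual class of infinitely differentiable functions.\<close>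

definition smooth_fun_on :: "(real^'n::finite) set \<Rightarrow> (real^'n \<Rightarrow> real) \<Rightarrow> bool" where
  "smooth_fun_on U f \<longleftrightarrow> (\<forall>is. \<forall>u\<in>U. foldr partial is f differentiable (at u))"

definition smooth_map_on :: "(real^'n::finite) set \<Rightarrow> (real^'n \<Rightarrow> real^'n) \<Rightarrow> bool" where
  "smooth_map_on U f \<longleftrightarrow> (\<forall>i. smooth_fun_on U (\<lambda>u. f u $ i))"

type_synonym ('m, 'n) chart = "'m set \<times> ('m \<Rightarrow> real^'n)"

definition chart_image :: "('m, 'n::finite) chart \<Rightarrow> (real^'n) set" where
  "chart_image c = snd c ` fst c"

definition overlap :: "('m, 'n::finite) chart \<Rightarrow> ('m, 'n) chart \<Rightarrow> (real^'n) set" where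
  "overlap c d = snd c ` (fst c \<inter> fst d)"

definition transition :: "('m, 'n::finite) chart \<Rightarrow> ('m, 'n) chart \<Rightarrow> real^'n \<Rightarrow> real^'n" where
  "transition c d = snd d \<circ> inv_into (fst c) (snd c)"

definition smooth_manifold :: "'m topology \<Rightarrow> ('m, 'n::finite) chart set \<Rightarrow> bool" where
  "smooth_manifold M A \<longleftrightarrow>
     Hausdorff_space M \<and> second_countable M \<and>
     (\<Union>c\<in>A. fst c) = topspace M \<and>
     (\<forall>c\<in>A. openin M (fst c) \<and> open (chart_image c) \<and>
        homeomorphic_map (subtopology M (fst c)) (top_of_set (chart_image c)) (snd c)) \<and>
     (\<forall>c\<in>A. \<forall>d\<in>A. smooth_map_on (overlap c d) (transition c d))"


section \<open>Formal power series in the jet variables\<close>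

text \<open>The pair \<open>(i, s)\<close> stands for the variable \<open>u\<^sup>i\<^sup>,\<^sup>s\<close>, a finite multiset of pairs for a
  monomial. An element of the following type assigns to each monomial a coefficient, which is a
  function of \<open>u\<close>. The restriction to \<open>s \<ge> 1\<close> and the smoothness of the coefficients
  on the given coordinate domain are imposed in \<open>diff_poly\<close> below.\<close>

typedef ('n::finite) jet_series = "UNIV :: (('n \<times> nat) multiset \<Rightarrow> real^'n \<Rightarrow> real) set"
  morphisms jcoeff Jet_Series
  by simp

lemma jcoeff_Jet_Series [simp]: "jcoeff (Jet_Series f) = f"
  by (simp add: Jet_Series_inverse)

lemma jet_series_eqI: "(\<And>m u. jcoeff f m u = jcoeff g m u) \<Longrightarrow> f = g"
  by (metis ext jcoeff_inject)

definition msplits :: "'a multiset \<Rightarrow> ('a multiset \<times> 'a multiset) set" where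
  "msplits m = {(a, b). a + b = m}"

lemma in_msplits [simp]: "(a, b) \<in> msplits m \<longleftrightarrow> a + b = m"
  by (simp add: msplits_def)

lemma finite_msplits [simp]: "finite (msplits m)"
proof (induction m)
  case empty
  have "msplits {#} = {({#}, {#} :: 'a multiset)}"
    by (auto simp: msplits_def)
  then show ?case by simp
next
  case (add x m)
  have "msplits (add_mset x m) \<subseteq>
      (\<lambda>(a, b). (add_mset x a, b)) ` msplits m \<union> (\<lambda>(a, b). (a, add_mset x b)) ` msplits m"
  proof
    fix p assume "p \<in> msplits (add_mset x m)"
    then obtain a b where p: "p = (a, b)" "a + b = add_mset x m"
      by (auto simp: msplits_def)
    then have "x \<in># a \<or> x \<in># b"
      by (metis union_iff union_single_eq_member)
    then show "p \<in> (\<lambda>(a, b). (add_mset x a, b)) ` msplits m \<union>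
        (\<lambda>(a, b). (a, add_mset x b)) ` msplits m"
    proof
      assume "x \<in># a"
      then obtain a' where "a = add_mset x a'" by (meson multi_member_split)
      with p show ?thesis by (force simp: msplits_def image_iff)
    next
      assume "x \<in># b"
      then obtain b' where "b = add_mset x b'" by (meson multi_member_split)
      with p show ?thesis by (force simp: msplits_def image_iff)
    qed
  qed
  then show ?case
    using add finite_subset by blast
qed

lemma msplits_empty: "msplits {#} = {({#}, {#})}"
  by (auto simp: msplits_def)

instantiation jet_series :: (finite) comm_ring_1
begin

definition "0 = Jet_Series (\<lambda>m u. 0)"
definition "1 = Jet_Series (\<lambda>m u. if m = {#} then 1 else 0)"
definition "f + g = Jet_Series (\<lambda>m u. jcoeff f m u + jcoeff g m u)"
definition "f - g = Jet_Series (\<lambda>m u. jcoeff f m u - jcoeff g m u)"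
definition "- f = Jet_Series (\<lambda>m u. - jcoeff f m u)"
definition "f * g = Jet_Series (\<lambda>m u. \<Sum>(a, b)\<in>msplits m. jcoeff f a u * jcoeff g b u)"

instance
proof
  fix f g h :: "'a jet_series"
  show "f * g = g * f"
    unfolding times_jet_series_def
    by (rule jet_series_eqI, simp)
      (rule sum.reindex_bij_witness[of _ prod.swap prod.swap], auto simp: add.commute)
  show "f * g * h = f * (g * h)"
  proof (rule jet_series_eqI)
    fix m u
    have "jcoeff (f * g * h) m u =
        (\<Sum>(p, c)\<in>msplits m. \<Sum>(a, b)\<in>msplits p. jcoeff f a u * jcoeff g b u * jcoeff h c u)"
      by (simp add: times_jet_series_def sum_distrib_right case_prod_unfold)
    also have "\<dots> = (\<Sum>((p, c), (a, b))\<in>(SIGMA x:msplits m. msplits (fst x)).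
        jcoeff f a u * jcoeff g b u * jcoeff h c u)"
      by (subst sum.Sigma[symmetric]) (auto simp: case_prod_unfold)
    also have "\<dots> = (\<Sum>((a, q), (b, c))\<in>(SIGMA x:msplits m. msplits (snd x)).
        jcoeff f a u * (jcoeff g b u * jcoeff h c u))"
      by (rule sum.reindex_bij_witness[of _
            "\<lambda>((a, q), (b, c)). ((a + b, c), (a, b))" "\<lambda>((p, c), (a, b)). ((a, b + c), (b, c))"])
        (auto simp: add.assoc mult.assoc)
    also have "\<dots> =
        (\<Sum>(a, q)\<in>msplits m. \<Sum>(b, c)\<in>msplits q. jcoeff f a u * (jcoeff g b u * jcoeff h c u))"
      by (subst sum.Sigma[symmetric]) (auto simp: case_prod_unfold)
    also have "\<dots> = jcoeff (f * (g * h)) m u"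
      by (simp add: times_jet_series_def sum_distrib_left case_prod_unfold)
    finally show "jcoeff (f * g * h) m u = jcoeff (f * (g * h)) m u" .
  qed
  show "1 * f = f"
  proof (rule jet_series_eqI)
    fix m u
    have "jcoeff (1 * f) m u = (\<Sum>(a, b)\<in>msplits m. (if a = {#} then 1 else 0) * jcoeff f b u)"
      by (simp add: times_jet_series_def one_jet_series_def)
    also have "\<dots> = (\<Sum>(a, b)\<in>{({#} :: ('a \<times> nat) multiset, m)}. (if a = {#} then 1 else 0) * jcoeff f b u)"
      by (rule sum.mono_neutral_right) (auto split: if_splits)
    finally show "jcoeff (1 * f) m u = jcoeff f m u" by simp
  qed
  show "(f + g) * h = f * h + g * h"
    by (rule jet_series_eqI)
      (simp add: times_jet_series_def plus_jet_series_def case_prod_unfold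
        distrib_right sum.distrib)
  show "(0 :: 'a jet_series) \<noteq> 1"
  proof
    assume "(0 :: 'a jet_series) = 1"
    then have "jcoeff (0 :: 'a jet_series) {#} 0 = jcoeff (1 :: 'a jet_series) {#} 0" by simp
    then show False by (simp add: zero_jet_series_def one_jet_series_def)
  qed
qed (rule jet_series_eqI, simp add: plus_jet_series_def minus_jet_series_def
      uminus_jet_series_def zero_jet_series_def)+

end

definition coord_fun :: "(real^'n::finite \<Rightarrow> real) \<Rightarrow> 'n jet_series" where
  "coord_fun a = Jet_Series (\<lambda>m. if m = {#} then a else (\<lambda>_. 0))"

definition sdeg :: "('n \<times> nat) multiset \<Rightarrow> nat" where
  "sdeg m = \<Sum>\<^sub># (image_mset snd m)"

text \<open>Two series agree over \<open>U\<close> when their coefficients do; values of the coefficients outside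
  the coordinate domain \<open>U\<close> are irrelevant throughout.\<close>

definition eq_over :: "(real^'n::finite) set \<Rightarrow> 'n jet_series \<Rightarrow> 'n jet_series \<Rightarrow> bool" where
  "eq_over U f g \<longleftrightarrow> (\<forall>m. \<forall>u\<in>U. jcoeff f m u = jcoeff g m u)"

text \<open>The algebra \<open>\<A>\<close> over the coordinate domain \<open>U\<close>, and its component of degree \<open>d\<close>.\<close>

definition diff_poly :: "(real^'n::finite) set \<Rightarrow> 'n jet_series set" where
  "diff_poly U = {f. (\<forall>m. smooth_fun_on U (jcoeff f m)) \<and>
     (\<forall>m i. (i, 0) \<in># m \<longrightarrow> (\<forall>u\<in>U. jcoeff f m u = 0))}"

definition diff_poly_deg :: "(real^'n::finite) set \<Rightarrow> nat \<Rightarrow> 'n jet_series set" where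
  "diff_poly_deg U d = {f \<in> diff_poly U. \<forall>m. sdeg m \<noteq> d \<longrightarrow> (\<forall>u\<in>U. jcoeff f m u = 0)}"

text \<open>\<open>jet_partial i s\<close> is \<open>\<partial>/\<partial>u\<^sup>i\<^sup>,\<^sup>s\<close>. It acts on the coefficients if \<open>s = 0\<close> and on the
  monomials otherwise.\<close>

definition jet_partial :: "'n::finite \<Rightarrow> nat \<Rightarrow> 'n jet_series \<Rightarrow> 'n jet_series" where
  "jet_partial i s f = Jet_Series (\<lambda>m u.
     if s = 0 then partial i (jcoeff f m) u
     else of_nat (count m (i, s) + 1) * jcoeff f (add_mset (i, s) m) u)"

text \<open>In \<open>\<partial>\<^sub>x f = \<Sum> u\<^sup>i\<^sup>,\<^sup>s\<^sup>+\<^sup>1 \<partial>f/\<partial>u\<^sup>i\<^sup>,\<^sup>s\<close>, only the finitely many \<open>(i, s)\<close> for which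
  \<open>u\<^sup>i\<^sup>,\<^sup>s\<^sup>+\<^sup>1\<close> divides the monomial \<open>m\<close> contribute to the coefficient of \<open>m\<close>.\<close>

definition Dx :: "'n::finite jet_series \<Rightarrow> 'n jet_series" where
  "Dx f = Jet_Series (\<lambda>m u.
     \<Sum>(i, s) | (i, Suc s) \<in># m. jcoeff (jet_partial i s f) (m - {#(i, Suc s)#}) u)"

text \<open>The coefficient of \<open>m\<close> in \<open>\<partial>\<^sub>x\<^sup>s g\<close> vanishes for \<open>s > sdeg m\<close>, whatever \<open>g\<close> is, so the
  infinite sum \<open>\<Sum>\<^sub>s (-\<partial>\<^sub>x)\<^sup>s \<partial>f/\<partial>u\<^sup>i\<^sup>,\<^sup>s\<close> can be truncated in each coefficient.\<close>

definition var_deriv :: "'n::finite \<Rightarrow> 'n jet_series \<Rightarrow> 'n jet_series" where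
  "var_deriv i f = Jet_Series (\<lambda>m u.
     \<Sum>s\<le>sdeg m. (-1) ^ s * jcoeff ((Dx ^^ s) (jet_partial i s f)) m u)"

text \<open>Expresses a series in the coordinates \<open>\<tau>(u)\<close> in terms of the coordinates \<open>u\<close>,
  replacing the \<open>s\<close>-th jet variable of index \<open>i\<close> by \<open>\<partial>\<^sub>x\<^sup>s \<tau>\<^sup>i\<close>.  This is homogeneous of
  degree \<open>s\<close>, hence only monomials \<open>p\<close> of the same degree as \<open>m\<close> contribute to the
  coefficient of \<open>m\<close>.\<close>

definition jet_pullback ::
    "(real^'n::finite \<Rightarrow> real^'n) \<Rightarrow> 'n jet_series \<Rightarrow> 'n jet_series" where
  "jet_pullback \<tau> f = Jet_Series (\<lambda>m u.
     \<Sum>p | sdeg p = sdeg m \<and> (\<forall>i. (i, 0) \<notin># p).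
       jcoeff f p (\<tau> u) *
       jcoeff (\<Prod>(i, s)\<in>#p. (Dx ^^ s) (coord_fun (\<lambda>v. \<tau> v $ i))) m u)"


section \<open>Homogeneous local Poisson brackets\<close>

text \<open>A local bracket assigns to each chart \<open>c\<close> the coefficients \<open>P c s i j\<close>, where \<open>s\<close> is the order
  of the derivative of the delta function.\<close>

type_synonym ('m, 'n) bracket_coeffs = "('m, 'n) chart \<Rightarrow> nat \<Rightarrow> 'n \<Rightarrow> 'n \<Rightarrow> 'n jet_series"

definition homogeneous_bracket ::
    "('m, 'n::finite) chart set \<Rightarrow> nat \<Rightarrow> ('m, 'n) bracket_coeffs \<Rightarrow> bool" where
  "homogeneous_bracket A k P \<longleftrightarrow>
     (\<forall>c\<in>A. \<forall>s\<le>k. \<forall>i j. P c s i j \<in> diff_poly_deg (chart_image c) (k - s)) \<and>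
     (\<forall>c\<in>A. \<forall>d\<in>A. \<forall>s\<le>k. \<forall>i j.
        let \<tau> = transition c d in
        eq_over (overlap c d)
          (jet_pullback \<tau> (P d s i j))
          (\<Sum>i'\<in>UNIV. \<Sum>j'\<in>UNIV. \<Sum>t\<le>k - s. of_nat ((s + t) choose s) *
             coord_fun (partial i' (\<lambda>v. \<tau> v $ i)) * P c (s + t) i' j' *
             (Dx ^^ t) (coord_fun (partial j' (\<lambda>v. \<tau> v $ j)))))"

text \<open>Local functionals over \<open>U\<close> are represented by their densities in \<open>diff_poly U\<close>, and two
  densities define the same functional iff their difference is null in the following sense.\<close>

definition null_functional :: "(real^'n::finite) set \<Rightarrow> 'n jet_series \<Rightarrow> bool" where
  "null_functional U f \<longleftrightarrow> (\<exists>h\<in>diff_poly U. eq_over U f (Dx h))"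

text \<open>Variational derivatives of null functionals vanish, so this density depends only on the
  classes of \<open>F\<close> and \<open>G\<close>.\<close>

definition functional_bracket :: "nat \<Rightarrow> (nat \<Rightarrow> 'n \<Rightarrow> 'n \<Rightarrow> 'n jet_series) \<Rightarrow>
    'n::finite jet_series \<Rightarrow> 'n jet_series \<Rightarrow> 'n jet_series" where
  "functional_bracket k Q F G =
     (\<Sum>i\<in>UNIV. \<Sum>j\<in>UNIV. var_deriv i F * (\<Sum>s\<le>k. Q s i j * (Dx ^^ s) (var_deriv j G)))"

definition poisson_over ::
    "(real^'n::finite) set \<Rightarrow> nat \<Rightarrow> (nat \<Rightarrow> 'n \<Rightarrow> 'n \<Rightarrow> 'n jet_series) \<Rightarrow> bool" where
  "poisson_over U k Q \<longleftrightarrow>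
     (let br = functional_bracket k Q in
      (\<forall>F\<in>diff_poly U. \<forall>G\<in>diff_poly U. null_functional U (br F G + br G F)) \<and>
      (\<forall>F\<in>diff_poly U. \<forall>G\<in>diff_poly U. \<forall>H\<in>diff_poly U.
         null_functional U (br (br F G) H + br (br G H) F + br (br H F) G)))"

definition homogeneous_poisson_bracket ::
    "('m, 'n::finite) chart set \<Rightarrow> nat \<Rightarrow> ('m, 'n) bracket_coeffs \<Rightarrow> bool" where
  "homogeneous_poisson_bracket A k P \<longleftrightarrow>
     homogeneous_bracket A k P \<and> (\<forall>c\<in>A. poisson_over (chart_image c) k (P c))"

text \<open>The leading coefficients \<open>g\<^sup>i\<^sup>j\<close> as a matrix, and the coefficient \<open>h\<^sub>(\<^sub>s\<^sub>)\<^sub>l\<^sup>i\<^sup>j\<close> of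
  \<open>u\<^sup>l\<^sup>,\<^sup>k\<^sup>-\<^sup>s\<close> in \<open>P\<^sub>s\<^sup>i\<^sup>j\<close>, where \<open>s < k\<close>.\<close>

definition lead_matrix ::
    "nat \<Rightarrow> ('m, 'n::finite) bracket_coeffs \<Rightarrow> ('m, 'n) chart \<Rightarrow> real^'n \<Rightarrow> real^'n^'n" where
  "lead_matrix k P c u = (\<chi> i j. jcoeff (P c k i j) {#} u)"

definition lin_coeff :: "nat \<Rightarrow> ('m, 'n::finite) bracket_coeffs \<Rightarrow> nat \<Rightarrow> ('m, 'n) chart \<Rightarrow>
    'n \<Rightarrow> 'n \<Rightarrow> 'n \<Rightarrow> real^'n \<Rightarrow> real" where
  "lin_coeff k P s c i j l u = jcoeff (P c s i j) {#(l, k - s)#} u"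

definition nondegenerate ::
    "('m, 'n::finite) chart set \<Rightarrow> nat \<Rightarrow> ('m, 'n) bracket_coeffs \<Rightarrow> bool" where
  "nondegenerate A k P \<longleftrightarrow> (\<forall>c\<in>A. \<forall>u\<in>chart_image c. invertible (lead_matrix k P c u))"


section \<open>Connections on the tangent bundle\<close>

text \<open>A vector field is represented in a chart by its vector of components, and a connection by
  its covariant derivative \<open>(X, Y) \<mapsto> \<nabla>\<^sub>X Y\<close> in each chart. Christoffel symbols are written
  \<open>\<Gamma> i j l\<close> for lower indices \<open>i\<close>, \<open>j\<close> and upper index \<open>l\<close>, where \<open>i\<close> is the direction of
  differentiation.\<close>

type_synonym 'n vfield = "real^'n \<Rightarrow> real^'n"
type_synonym 'n christoffel = "'n \<Rightarrow> 'n \<Rightarrow> 'n \<Rightarrow> real^'n \<Rightarrow> real"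
type_synonym ('m, 'n) conn = "('m, 'n) chart \<Rightarrow> 'n vfield \<Rightarrow> 'n vfield \<Rightarrow> 'n vfield"

definition cov_deriv ::
    "'n::finite christoffel \<Rightarrow> 'n vfield \<Rightarrow> 'n vfield \<Rightarrow> 'n vfield" where
  "cov_deriv \<Gamma> X Y u = (\<chi> l. (\<Sum>i\<in>UNIV. X u $ i * partial i (\<lambda>v. Y v $ l) u) +
     (\<Sum>i\<in>UNIV. \<Sum>j\<in>UNIV. \<Gamma> i j l u * X u $ i * Y u $ j))"

definition christoffel_family ::
    "('m, 'n::finite) chart set \<Rightarrow> (('m, 'n) chart \<Rightarrow> 'n christoffel) \<Rightarrow> bool" where
  "christoffel_family A \<Gamma> \<longleftrightarrow>
     (\<forall>c\<in>A. \<forall>i j l. smooth_fun_on (chart_image c) (\<Gamma> c i j l)) \<and>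
     (\<forall>c\<in>A. \<forall>d\<in>A. \<forall>u\<in>overlap c d. \<forall>i j l.
        let \<tau> = (\<lambda>a v. transition c d v $ a) in
        (\<Sum>a\<in>UNIV. \<Sum>b\<in>UNIV.
           \<Gamma> d a b l (transition c d u) * partial i (\<tau> a) u * partial j (\<tau> b) u) =
        (\<Sum>p\<in>UNIV. partial p (\<tau> l) u * \<Gamma> c i j p u) - partial i (partial j (\<tau> l)) u)"

definition is_connection ::
    "('m, 'n::finite) chart set \<Rightarrow> ('m, 'n) conn \<Rightarrow> bool" where
  "is_connection A D \<longleftrightarrow> (\<exists>\<Gamma>. christoffel_family A \<Gamma> \<and>
     (\<forall>c\<in>A. \<forall>X Y. smooth_map_on (chart_image c) X \<longrightarrow> smooth_map_on (chart_image c) Y \<longrightarrow>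
        (\<forall>u\<in>chart_image c. D c X Y u = cov_deriv (\<Gamma> c) X Y u)))"

definition lie_bracket :: "'n::finite vfield \<Rightarrow> 'n vfield \<Rightarrow> 'n vfield" where
  "lie_bracket X Y u = (\<chi> l. \<Sum>i\<in>UNIV.
     X u $ i * partial i (\<lambda>v. Y v $ l) u - Y u $ i * partial i (\<lambda>v. X v $ l) u)"

definition curvature :: "('n::finite vfield \<Rightarrow> 'n vfield \<Rightarrow> 'n vfield) \<Rightarrow>
    'n vfield \<Rightarrow> 'n vfield \<Rightarrow> 'n vfield \<Rightarrow> 'n vfield" where
  "curvature D X Y Z u = D X (D Y Z) u - D Y (D X Z) u - D (lie_bracket X Y) Z u"

definition flat_connection ::
    "('m, 'n::finite) chart set \<Rightarrow> ('m, 'n) conn \<Rightarrow> bool" where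
  "flat_connection A D \<longleftrightarrow> is_connection A D \<and>
     (\<forall>c\<in>A. \<forall>X Y Z. smooth_map_on (chart_image c) X \<longrightarrow> smooth_map_on (chart_image c) Y \<longrightarrow>
        smooth_map_on (chart_image c) Z \<longrightarrow>
        (\<forall>u\<in>chart_image c. curvature (D c) X Y Z u = 0))"

definition std_christoffel :: "nat \<Rightarrow> ('m, 'n::finite) bracket_coeffs \<Rightarrow> nat \<Rightarrow>
    ('m, 'n) chart \<Rightarrow> 'n christoffel" where
  "std_christoffel k P s c i j l u = - (1 / real (k choose s)) *
     (\<Sum>i'\<in>UNIV. matrix_inv (lead_matrix k P c u) $ i $ i' * lin_coeff k P s c i' l j u)"

definition std_connection ::
    "nat \<Rightarrow> ('m, 'n::finite) bracket_coeffs \<Rightarrow> nat \<Rightarrow> ('m, 'n) conn" where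
  "std_connection k P s c = cov_deriv (std_christoffel k P s c)"

definition comb_coeff :: "nat \<Rightarrow> nat \<Rightarrow> nat \<Rightarrow> real" where
  "comb_coeff k s t = (-1) ^ t * real ((k + s - t) choose k) * real (k choose t)"

definition comb_connection ::
    "nat \<Rightarrow> ('m, 'n::finite) bracket_coeffs \<Rightarrow> nat \<Rightarrow> ('m, 'n) conn" where
  "comb_connection k P s c X Y u =
     (\<Sum>t\<le>s. comb_coeff k s t *\<^sub>R std_connection k P t c X Y u)"

end

theory Submission
  imports Defs
begin

text \<open>Along the constant loops, the covectors \<open>x\<^sup>s \<xi>\<close> with \<open>0 \<le> s \<le> k\<close> and \<open>\<xi>\<close> a one-form on \<open>M\<close> form a graded
  Lie algebroid under the bracket which the Poisson structure induces on one-forms on the loop space;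
  this bracket lowers the degree in \<open>x\<close> by \<open>k\<close>, and the anchor is \<open>g \<partial>\<^sub>x\<^sup>k\<close>. Hence the part of degree \<open>k\<close> is a
  subalgebroid, identified with \<open>TM\<close> by the anchor, and it acts on the part of degree \<open>s < k\<close>, where
  the anchor vanishes. This action is a flat \<open>TM\<close>-connection on \<open>T\<^sup>*M\<close>, and it is dual to \<open>\<nabla>\<^sup>[\<^sup>s\<^sup>]\<close>.

  Densities do not depend on \<open>x\<close> explicitly. The Jacobi identity is therefore first evaluated on small
  perturbations of a constant loop by exponentials \<open>exp(\<lambda>x)\<close>, for quadratic densities whose variational
  derivatives select one of the frequencies and annihilate all other partial sums of them, so that the
  second variations of the densities drop out. The result is polynomial in the frequencies, and the exponentials can be replaced
  by powers of \<open>x\<close>.\<close>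

section \<open>Calculus of partial derivatives\<close>

text \<open>The obstacle is that the coefficients of the bracket of degree two in the jets are
  unknown, yet they enter the Jacobi identity once it is differentiated along the loop. They always
  occur multiplied by g and by \<partial>^k of one of the three covectors. On x^k, x^k, x^s with s <
  k this derivative is constant: 0, or 1 after normalization. A constant leaves only those
  coefficients that put no derivative on it, and these are plain u-derivatives of the linear ones.
  So the identity closes up on the h_(t).

  The numbers c_s^t come from one computation: after integration by parts h_(t) contributes
  (-1)^(k-t) \<partial>^(k-t) (x^k/k! \<partial>^t (x^s/s!)), which is (-1)^(k-t) binom(k+s-t, k)
  x^s/s! for t \<le> s and 0 for t > s; contraction with the inverse of g turns h_(t) into
  -binom(k,t) times a Christoffel symbol.

  Null functionals are detected only at total frequency 0; a variation of the loop takes up the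
  missing frequency, so that those of the three covectors remain free. Densities linear in u have
  constant variational derivatives and cannot carry a frequency, hence the quadratic ones.\<close>

lemma partial_eqI: "(f has_derivative f') (at u) \<Longrightarrow> partial i f u = f' (axis i 1)"
  unfolding partial_def by (metis frechet_derivative_at)

lemma has_derivative_cong_open:
  assumes "open U" "u \<in> U" "\<And>v. v \<in> U \<Longrightarrow> f v = g v"
  shows "(f has_derivative f') (at u) \<longleftrightarrow> (g has_derivative f') (at u)"
  using has_derivative_transform_within_open[OF _ assms(1,2), of f f' UNIV g]
    has_derivative_transform_within_open[OF _ assms(1,2), of g f' UNIV f] assms(3)
  by auto

lemma partial_cong:
  assumes "open U" "u \<in> U" "\<And>v. v \<in> U \<Longrightarrow> f v = g v"
  shows "partial i f u = partial i g u"
  unfolding partial_def frechet_derivative_def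
  using has_derivative_cong_open[OF assms] by simp

lemma differentiable_cong_open:
  assumes "open U" "u \<in> U" "\<And>v. v \<in> U \<Longrightarrow> f v = g v"
  shows "f differentiable (at u) \<longleftrightarrow> g differentiable (at u)"
  unfolding differentiable_def using has_derivative_cong_open[OF assms] by simp

lemma partial_const [simp]: "partial i (\<lambda>u. c) u = 0"
  by (rule partial_eqI[THEN trans]) (auto intro: derivative_intros)

lemma partial_component: "partial i (\<lambda>u. u $ j) u = (if i = j then 1 else 0)"
  by (rule partial_eqI[THEN trans], rule bounded_linear_imp_has_derivative,
      rule bounded_linear_vec_nth) (simp add: axis_def)

lemma partial_add:
  assumes "f differentiable (at u)" "g differentiable (at u)"
  shows "partial i (\<lambda>v. f v + g v) u = partial i f u + partial i g u"
  using has_derivative_add[OF assms[unfolded frechet_derivative_works]]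
  by (subst partial_eqI, assumption) (simp add: partial_def)

lemma partial_diff:
  assumes "f differentiable (at u)" "g differentiable (at u)"
  shows "partial i (\<lambda>v. f v - g v) u = partial i f u - partial i g u"
  using has_derivative_diff[OF assms[unfolded frechet_derivative_works]]
  by (subst partial_eqI, assumption) (simp add: partial_def)

lemma partial_mult:
  assumes "f differentiable (at u)" "g differentiable (at u)"
  shows "partial i (\<lambda>v. f v * g v) u = f u * partial i g u + partial i f u * g u"
  using has_derivative_mult[OF assms[unfolded frechet_derivative_works]]
  by (subst partial_eqI, assumption) (simp add: partial_def)

lemma partial_cmult:
  assumes "f differentiable (at u)"
  shows "partial i (\<lambda>v. c * f v) u = c * partial i f u"
  using partial_mult[OF differentiable_const assms, of i c] by simp

lemma partial_sum:
  assumes "\<And>a. a \<in> A \<Longrightarrow> f a differentiable (at u)"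
  shows "partial i (\<lambda>v. \<Sum>a\<in>A. f a v) u = (\<Sum>a\<in>A. partial i (f a) u)"
proof -
  have "((\<lambda>v. \<Sum>a\<in>A. f a v) has_derivative (\<lambda>h. \<Sum>a\<in>A. frechet_derivative (f a) (at u) h)) (at u)"
    by (rule has_derivative_sum) (use assms frechet_derivative_works in blast)
  then show ?thesis
    by (subst partial_eqI, assumption) (simp add: partial_def)
qed

section \<open>Symmetry of second partial derivatives\<close>

lemma partial_line_derivative:
  assumes "f differentiable (at (w + s *\<^sub>R axis i 1))"
  shows "((\<lambda>s. f (w + s *\<^sub>R axis i 1)) has_real_derivative partial i f (w + s *\<^sub>R axis i 1)) (at s)"
proof -
  let ?D = "frechet_derivative f (at (w + s *\<^sub>R axis i 1))"
  have D: "(f has_derivative ?D) (at (w + s *\<^sub>R axis i 1))"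
    using assms frechet_derivative_works by blast
  have "((\<lambda>s. f (w + s *\<^sub>R axis i 1)) has_derivative (\<lambda>h. ?D (h *\<^sub>R axis i 1))) (at s)"
    by (rule has_derivative_compose[where g = f and f = "\<lambda>s. w + s *\<^sub>R axis i 1", OF _ D])
      (auto intro!: derivative_eq_intros)
  moreover have "?D (h *\<^sub>R axis i 1) = partial i f (w + s *\<^sub>R axis i 1) * h" for h
    using linear_frechet_derivative[OF assms] by (simp add: partial_def linear_scale)
  ultimately show ?thesis
    by (simp add: has_field_derivative_def)
qed

text \<open>Young's argument: the mean value theorem in direction i turns the second difference into
  a difference of values of \<open>partial i f\<close>, which differentiability of
  \<open>partial i f\<close> at the single point u linearizes. Only differentiability enters, as in
  \<open>smooth_fun_on\<close>.\<close>

lemma second_difference_tendsto: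
  fixes f :: "real^'n::finite \<Rightarrow> real"
  assumes U: "open U" "u \<in> U" and f: "\<And>v. v \<in> U \<Longrightarrow> f differentiable (at v)"
    and g: "partial i f differentiable (at u)"
  shows "((\<lambda>h. (f (u + h *\<^sub>R axis i 1 + h *\<^sub>R axis j 1) - f (u + h *\<^sub>R axis i 1)
      - f (u + h *\<^sub>R axis j 1) + f u) / h\<^sup>2) \<longlongrightarrow> partial j (partial i f) u) (at_right 0)"
    (is "(?q \<longlongrightarrow> ?l) _")
proof (rule tendstoI)
  fix e :: real assume e: "e > 0"
  let ?g = "partial i f" and ?i = "axis i 1 :: real^'n" and ?j = "axis j 1 :: real^'n"
  let ?g' = "frechet_derivative ?g (at u)"
  have lin: "linear ?g'" using g by (rule linear_frechet_derivative)
  have "(?g has_derivative ?g') (at u)"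
    using g frechet_derivative_works by blast
  then obtain d where d: "d > 0"
    "\<And>y. norm (y - u) < d \<Longrightarrow> \<bar>?g y - ?g u - ?g' (y - u)\<bar> \<le> e/4 * norm (y - u)"
    unfolding has_derivative_at_alt using e by (metis divide_pos_pos real_norm_def zero_less_numeral)
  obtain r where r: "r > 0" "ball u r \<subseteq> U" using U openE by blast
  \<comment> \<open>All points used below lie within 2 * h of u, so half the radius keeps them in
    both balls. The linearization errors e/4 * 2h and e/4 * h then add up to less than e *
    h.\<close>
  define m where "m = min d r / 2"
  have m: "m > 0" using d r by (simp add: m_def)
  have "dist (?q h) ?l < e" if h: "0 < h" "h < m" for h
  proof -
    have nrm: "norm (s *\<^sub>R ?i + t *\<^sub>R ?j) \<le> s + t" if "0 \<le> s" "0 \<le> t" for s t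
      using norm_triangle_ineq[of "s *\<^sub>R ?i" "t *\<^sub>R ?j"] that by (simp add: norm_axis_1)
    have inU: "u + s *\<^sub>R ?i + t *\<^sub>R ?j \<in> U" if "0 \<le> s" "s \<le> h" "0 \<le> t" "t \<le> h" for s t
    proof -
      have "dist u (u + s *\<^sub>R ?i + t *\<^sub>R ?j) = norm (s *\<^sub>R ?i + t *\<^sub>R ?j)"
        by (metis add.assoc dist_add_cancel dist_norm norm_minus_commute add_0_right diff_zero)
      with nrm[of s t] that h r show ?thesis by (auto simp: m_def)
    qed
    have inU0: "u + s *\<^sub>R ?i \<in> U" if "0 \<le> s" "s \<le> h" for s
      using inU[of s 0] that h by simp
    \<comment> \<open>The increment in direction j, as a function of the position along i; its
      increment from 0 to h is the second difference.\<close>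
    let ?\<phi> = "\<lambda>s. f (u + h *\<^sub>R ?j + s *\<^sub>R ?i) - f (u + s *\<^sub>R ?i)"
    have "\<exists>z>0. z < h \<and> ?\<phi> h - ?\<phi> 0 = (h - 0) *
        (?g (u + h *\<^sub>R ?j + z *\<^sub>R ?i) - ?g (u + z *\<^sub>R ?i))"
    proof (rule MVT2[OF h(1)])
      fix x assume x: "0 \<le> x" "x \<le> h"
      have "u + h *\<^sub>R ?j + x *\<^sub>R ?i \<in> U"
        using inU[of x h] x h by (simp add: algebra_simps)
      then show "DERIV ?\<phi> x :> ?g (u + h *\<^sub>R ?j + x *\<^sub>R ?i) - ?g (u + x *\<^sub>R ?i)"
        using inU0[OF x] by (intro DERIV_diff partial_line_derivative f)
    qed
    then obtain z where z: "0 < z" "z < h" and eq: "?\<phi> h - ?\<phi> 0 = h *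
        (?g (u + h *\<^sub>R ?j + z *\<^sub>R ?i) - ?g (u + z *\<^sub>R ?i))" by auto
    let ?y1 = "u + h *\<^sub>R ?j + z *\<^sub>R ?i" and ?y2 = "u + z *\<^sub>R ?i"
    have n1: "norm (?y1 - u) \<le> 2 * h" using nrm[of z h] z h by (simp add: algebra_simps)
    have n2: "norm (?y2 - u) \<le> h" using z h by (simp add: norm_axis_1)
    have b1: "\<bar>?g ?y1 - ?g u - ?g' (?y1 - u)\<bar> \<le> e/4 * (2 * h)"
      using d(2)[of ?y1] n1 h e by (smt (verit) m_def mult_left_mono divide_pos_pos field_sum_of_halves min_less_iff_conj)
    have b2: "\<bar>?g ?y2 - ?g u - ?g' (?y2 - u)\<bar> \<le> e/4 * h"
      using d(2)[of ?y2] n2 h e by (smt (verit) m_def mult_left_mono divide_pos_pos field_sum_of_halves min_less_iff_conj)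
    have "?g' (?y1 - u) - ?g' (?y2 - u) = ?g' (h *\<^sub>R ?j)"
      by (simp add: linear_diff[OF lin, symmetric])
    also have "\<dots> = h * ?l"
      using lin by (simp add: linear_scale partial_def)
    finally have "\<bar>(?g ?y1 - ?g ?y2) - h * ?l\<bar> \<le> e * 3/4 * h"
      using b1 b2 by linarith
    then have "\<bar>((?g ?y1 - ?g ?y2) - h * ?l) / h\<bar> \<le> e * 3/4"
      using h by (simp add: divide_le_eq)
    moreover have "?q h - ?l = ((?g ?y1 - ?g ?y2) - h * ?l) / h"
    proof -
      have *: "f (u + h *\<^sub>R ?i + h *\<^sub>R ?j) - f (u + h *\<^sub>R ?i) - f (u + h *\<^sub>R ?j) + f u = h * (?g ?y1 - ?g ?y2)"
        using eq by (simp add: algebra_simps)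
      show ?thesis unfolding * using h by (simp add: diff_divide_distrib power2_eq_square)
    qed
    ultimately have "\<bar>?q h - ?l\<bar> \<le> e * 3/4" by metis
    then show ?thesis unfolding dist_real_def using e by linarith
  qed
  then show "\<forall>\<^sub>F h in at_right 0. dist (?q h) ?l < e"
    unfolding eventually_at_right_field using m by blast
qed

text \<open>The second difference is symmetric in i and j, so both iterated derivatives are its
  limit.\<close>

lemma partial_commute:
  assumes "open U" "u \<in> U" "\<And>v. v \<in> U \<Longrightarrow> f differentiable (at v)"
    and "partial i f differentiable (at u)" "partial j f differentiable (at u)"
  shows "partial i (partial j f) u = partial j (partial i f) u"
proof (rule tendsto_unique[OF trivial_limit_at_right_real])
  show "((\<lambda>h. (f (u + h *\<^sub>R axis i 1 + h *\<^sub>R axis j 1) - f (u + h *\<^sub>R axis i 1)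
      - f (u + h *\<^sub>R axis j 1) + f u) / h\<^sup>2) \<longlongrightarrow> partial j (partial i f) u) (at_right 0)"
    by (rule second_difference_tendsto) (use assms in auto)
  have "((\<lambda>h. (f (u + h *\<^sub>R axis j 1 + h *\<^sub>R axis i 1) - f (u + h *\<^sub>R axis j 1)
      - f (u + h *\<^sub>R axis i 1) + f u) / h\<^sup>2) \<longlongrightarrow> partial i (partial j f) u) (at_right 0)"
    by (rule second_difference_tendsto) (use assms in auto)
  then show "((\<lambda>h. (f (u + h *\<^sub>R axis i 1 + h *\<^sub>R axis j 1) - f (u + h *\<^sub>R axis i 1)
      - f (u + h *\<^sub>R axis j 1) + f u) / h\<^sup>2) \<longlongrightarrow> partial i (partial j f) u) (at_right 0)"
    by (simp add: algebra_simps)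
qed

text \<open>A finite stage of \<open>smooth_fun_on\<close>, which allows closure properties to be
  proved by induction on the order. As \<open>foldr\<close> applies the last index first, the
  recursion peels off the innermost derivative.\<close>

definition diff_upto :: "nat \<Rightarrow> (real^'n::finite) set \<Rightarrow> (real^'n \<Rightarrow> real) \<Rightarrow> bool" where
  "diff_upto n U f \<longleftrightarrow> (\<forall>is. length is \<le> n \<longrightarrow> (\<forall>u\<in>U. foldr partial is f differentiable (at u)))"

lemma smooth_fun_on_diff_upto: "smooth_fun_on U f \<longleftrightarrow> (\<forall>n. diff_upto n U f)"
  unfolding smooth_fun_on_def diff_upto_def by blast

lemma diff_upto_0: "diff_upto 0 U f \<longleftrightarrow> (\<forall>u\<in>U. f differentiable (at u))"
  by (simp add: diff_upto_def)

lemma diff_upto_Suc: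
  fixes f :: "real^'n::finite \<Rightarrow> real"
  shows "diff_upto (Suc n) U f \<longleftrightarrow> (\<forall>u\<in>U. f differentiable (at u)) \<and> (\<forall>i. diff_upto n U (partial i f))"
proof safe
  assume f: "diff_upto (Suc n) U f"
  show "f differentiable (at u)" if "u \<in> U" for u
    using f[unfolded diff_upto_def, rule_format, of "[]" u] that by simp
  show "diff_upto n U (partial i f)" for i
    unfolding diff_upto_def
  proof (intro allI impI ballI)
    fix "is" :: "'n list" and u assume "length is \<le> n" "u \<in> U"
    then show "foldr partial is (partial i f) differentiable (at u)"
      using f[unfolded diff_upto_def, rule_format, of "is @ [i]" u] by simp
  qed
next
  assume f: "\<forall>u\<in>U. f differentiable (at u)" "\<forall>i. diff_upto n U (partial i f)"
  show "diff_upto (Suc n) U f"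
    unfolding diff_upto_def
  proof (intro allI impI ballI)
    fix "is" :: "'n list" and u assume "length is \<le> Suc n" "u \<in> U"
    then show "foldr partial is f differentiable (at u)"
      using f by (cases "is" rule: rev_cases) (auto simp: diff_upto_def)
  qed
qed

lemma diff_upto_Suc_le: "diff_upto (Suc n) U f \<Longrightarrow> diff_upto n U f"
  by (simp add: diff_upto_def)

lemma diff_upto_differentiable: "diff_upto n U f \<Longrightarrow> u \<in> U \<Longrightarrow> f differentiable (at u)"
  by (cases n) (auto simp: diff_upto_0 diff_upto_Suc)

lemma diff_upto_cong:
  assumes "open U" "\<And>v. v \<in> U \<Longrightarrow> f v = g v"
  shows "diff_upto n U f \<longleftrightarrow> diff_upto n U g"
  using assms(2)
proof (induction n arbitrary: f g)
  case 0
  have "f differentiable (at u) \<longleftrightarrow> g differentiable (at u)" if "u \<in> U" for u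
    using differentiable_cong_open[OF assms(1) that] 0 by blast
  then show ?case by (simp add: diff_upto_0)
next
  case (Suc n)
  have "diff_upto n U (partial i f) \<longleftrightarrow> diff_upto n U (partial i g)" for i
    by (rule Suc.IH) (use partial_cong[OF assms(1)] Suc.prems in blast)
  moreover have "f differentiable (at u) \<longleftrightarrow> g differentiable (at u)" if "u \<in> U" for u
    using differentiable_cong_open[OF assms(1) that] Suc.prems by blast
  ultimately show ?case by (simp add: diff_upto_Suc)
qed

lemma diff_upto_const:
  fixes U :: "(real^'n::finite) set"
  shows "diff_upto n U (\<lambda>u. c)"
proof (induction n arbitrary: c)
  case (Suc n)
  have "partial i (\<lambda>u. c) = (\<lambda>u. 0)" for i :: 'n by (rule ext) simp
  then show ?case using Suc by (simp add: diff_upto_Suc)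
qed (simp add: diff_upto_0)

lemma diff_upto_add:
  assumes "open U" "diff_upto n U f" "diff_upto n U g"
  shows "diff_upto n U (\<lambda>u. f u + g u)"
  using assms(2,3)
proof (induction n arbitrary: f g)
  case 0
  then show ?case by (auto simp: diff_upto_0)
next
  case (Suc n)
  have *: "diff_upto n U (\<lambda>u. partial i f u + partial i g u)" for i
    using Suc by (intro Suc.IH) (auto simp: diff_upto_Suc)
  have "diff_upto n U (partial i (\<lambda>u. f u + g u))" for i
    by (rule iffD1[OF diff_upto_cong[OF assms(1)] *[of i]])
      (use Suc.prems in \<open>auto simp: diff_upto_Suc partial_add\<close>)
  then show ?case using Suc.prems by (auto simp: diff_upto_Suc)
qed

lemma diff_upto_mult:
  assumes "open U" "diff_upto n U f" "diff_upto n U g"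
  shows "diff_upto n U (\<lambda>u. f u * g u)"
  using assms(2,3)
proof (induction n arbitrary: f g)
  case 0
  then show ?case by (auto simp: diff_upto_0)
next
  case (Suc n)
  have *: "diff_upto n U (\<lambda>u. f u * partial i g u + partial i f u * g u)" for i
    using Suc.prems[THEN diff_upto_Suc_le] Suc.prems
    by (intro diff_upto_add[OF assms(1)] Suc.IH) (simp_all add: diff_upto_Suc[of n])
  have "diff_upto n U (partial i (\<lambda>u. f u * g u))" for i
    by (rule iffD1[OF diff_upto_cong[OF assms(1)] *[of i]])
      (use Suc.prems in \<open>auto simp: diff_upto_Suc partial_mult\<close>)
  then show ?case using Suc.prems by (auto simp: diff_upto_Suc)
qed

text \<open>Written with products only, so that the induction in \<open>diff_upto_inverse\<close>
  can combine \<open>diff_upto_mult\<close> with its own hypothesis for the inverse.\<close>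

lemma partial_inverse:
  assumes "f differentiable (at u)" "f u \<noteq> 0"
  shows "partial i (\<lambda>v. inverse (f v)) u = - 1 * partial i f u * (inverse (f u) * inverse (f u))"
proof -
  have "((\<lambda>v. inverse (f v)) has_derivative
      (\<lambda>h. - (inverse (f u) * frechet_derivative f (at u) h * inverse (f u)))) (at u)"
    using Deriv.has_derivative_inverse[where f = f and x = u and S = UNIV, OF assms(2)] assms(1)
      frechet_derivative_works by blast
  then show ?thesis by (subst partial_eqI, assumption) (simp add: partial_def)
qed

lemma diff_upto_inverse:
  assumes "open U" "diff_upto n U f" "\<And>u. u \<in> U \<Longrightarrow> f u \<noteq> 0"
  shows "diff_upto n U (\<lambda>u. inverse (f u))"
  using assms(2)
proof (induction n)
  case 0
  then show ?case using assms(3) by (auto simp: diff_upto_0)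
next
  case (Suc n)
  have *: "diff_upto n U (\<lambda>u. - 1 * partial i f u * (inverse (f u) * inverse (f u)))" for i
    using Suc.IH[OF diff_upto_Suc_le[OF Suc.prems]] Suc.prems
    by (intro diff_upto_mult[OF assms(1)] diff_upto_const) (auto simp: diff_upto_Suc[of n])
  have "diff_upto n U (partial i (\<lambda>u. inverse (f u)))" for i
    by (rule iffD1[OF diff_upto_cong[OF assms(1)] *[of i]])
      (use Suc.prems assms(3) in \<open>auto simp: diff_upto_Suc partial_inverse\<close>)
  then show ?case using Suc.prems assms(3) by (auto simp: diff_upto_Suc)
qed

context
  fixes U :: "(real^'n::finite) set"
  assumes U: "open U"
begin

lemma smooth_const [intro]: "smooth_fun_on U (\<lambda>u. c)"
  by (simp add: smooth_fun_on_diff_upto diff_upto_const)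

lemma smooth_add: "smooth_fun_on U f \<Longrightarrow> smooth_fun_on U g \<Longrightarrow> smooth_fun_on U (\<lambda>u. f u + g u)"
  by (simp add: smooth_fun_on_diff_upto diff_upto_add[OF U])

lemma smooth_mult: "smooth_fun_on U f \<Longrightarrow> smooth_fun_on U g \<Longrightarrow> smooth_fun_on U (\<lambda>u. f u * g u)"
  by (simp add: smooth_fun_on_diff_upto diff_upto_mult[OF U])

lemma smooth_cong: "(\<And>v. v \<in> U \<Longrightarrow> f v = g v) \<Longrightarrow> smooth_fun_on U f \<longleftrightarrow> smooth_fun_on U g"
  using diff_upto_cong[OF U] by (metis smooth_fun_on_diff_upto)

lemma smooth_inverse:
  "smooth_fun_on U f \<Longrightarrow> (\<And>u. u \<in> U \<Longrightarrow> f u \<noteq> 0) \<Longrightarrow> smooth_fun_on U (\<lambda>u. inverse (f u))"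
  by (simp add: smooth_fun_on_diff_upto diff_upto_inverse[OF U])

lemma smooth_uminus: "smooth_fun_on U f \<Longrightarrow> smooth_fun_on U (\<lambda>u. - f u)"
  using smooth_mult[OF smooth_const[of "-1"]] by simp

lemma smooth_diff: "smooth_fun_on U f \<Longrightarrow> smooth_fun_on U g \<Longrightarrow> smooth_fun_on U (\<lambda>u. f u - g u)"
  using smooth_add[OF _ smooth_uminus] by simp

lemma smooth_sum:
  "(\<And>a. a \<in> A \<Longrightarrow> smooth_fun_on U (f a)) \<Longrightarrow> smooth_fun_on U (\<lambda>u. \<Sum>a\<in>A. f a u)"
  by (induction A rule: infinite_finite_induct) (auto intro: smooth_add)

lemma smooth_prod:
  "(\<And>a. a \<in> A \<Longrightarrow> smooth_fun_on U (f a)) \<Longrightarrow> smooth_fun_on U (\<lambda>u. \<Prod>a\<in>A. f a u)"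
  by (induction A rule: infinite_finite_induct) (auto intro: smooth_mult)

lemma smooth_component: "smooth_fun_on U (\<lambda>u. u $ i)"
proof -
  have "diff_upto (Suc n) U (\<lambda>u. u $ i)" for n
  proof -
    have "partial j (\<lambda>u. u $ i) = (\<lambda>u. if j = i then 1 else 0)" for j
      by (rule ext) (simp add: partial_component)
    moreover have "(\<lambda>u. u $ i) differentiable (at u)" for u :: "real^'n"
      by (rule bounded_linear_imp_differentiable) (rule bounded_linear_vec_nth)
    ultimately show ?thesis by (simp add: diff_upto_Suc diff_upto_const)
  qed
  then show ?thesis using diff_upto_Suc_le smooth_fun_on_diff_upto by blast
qed

end

lemma smooth_partial: "smooth_fun_on U f \<Longrightarrow> smooth_fun_on U (partial i f)"
  by (metis diff_upto_Suc smooth_fun_on_diff_upto)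

lemma smooth_differentiable: "smooth_fun_on U f \<Longrightarrow> u \<in> U \<Longrightarrow> f differentiable (at u)"
  using diff_upto_differentiable smooth_fun_on_diff_upto by blast

lemma smooth_partial_commute:
  assumes "open U" "smooth_fun_on U f" "u \<in> U"
  shows "partial i (partial j f) u = partial j (partial i f) u"
  by (rule partial_commute[OF assms(1,3)])
    (use assms smooth_differentiable smooth_partial in blast)+

section \<open>Jet calculus\<close>

lemma jcoeff_zero [simp]: "jcoeff 0 m u = 0"
  by (simp add: zero_jet_series_def)

lemma jcoeff_one: "jcoeff 1 m u = (if m = {#} then 1 else 0)"
  by (simp add: one_jet_series_def)

lemma jcoeff_add [simp]: "jcoeff (f + g) m u = jcoeff f m u + jcoeff g m u"
  by (simp add: plus_jet_series_def)

lemma jcoeff_mult: "jcoeff (f * g) m u = (\<Sum>(a, b)\<in>msplits m. jcoeff f a u * jcoeff g b u)"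
  by (simp add: times_jet_series_def)

lemma jcoeff_sum [simp]: "jcoeff (sum f A) m u = (\<Sum>a\<in>A. jcoeff (f a) m u)"
  by (induction A rule: infinite_finite_induct) auto

lemma jcoeff_mult_empty: "jcoeff (f * g) {#} u = jcoeff f {#} u * jcoeff g {#} u"
  by (simp add: jcoeff_mult msplits_empty)

lemma sdeg_empty [simp]: "sdeg {#} = 0"
  by (simp add: sdeg_def)

lemma sdeg_add_mset [simp]: "sdeg (add_mset x m) = snd x + sdeg m"
  by (simp add: sdeg_def)

lemma sdeg_plus [simp]: "sdeg (a + b) = sdeg a + sdeg b"
  by (simp add: sdeg_def)

lemma coord_fun_times: "jcoeff (coord_fun a * f) m u = a u * jcoeff f m u"
proof -
  have "jcoeff (coord_fun a * f) m u
      = (\<Sum>(p, q)\<in>msplits m. jcoeff (coord_fun a) p u * jcoeff f q u)"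
    by (rule jcoeff_mult)
  also have "\<dots> = (\<Sum>(p, q)\<in>{({#}, m)}. jcoeff (coord_fun a) p u * jcoeff f q u)"
    by (rule sum.mono_neutral_right) (auto simp: coord_fun_def split: if_splits)
  finally show ?thesis by (simp add: coord_fun_def)
qed

text \<open>The set \<open>D\<close> bounds the standard degrees of the monomials that occur.\<close>

definition jets_on :: "(real^'n::finite) set \<Rightarrow> nat set \<Rightarrow> 'n jet_series set" where
  "jets_on U D = {f. (\<forall>m. smooth_fun_on U (jcoeff f m)) \<and>
     (\<forall>m. sdeg m \<notin> D \<longrightarrow> (\<forall>u\<in>U. jcoeff f m u = 0))}"

lemma jets_onD:
  assumes "f \<in> jets_on U D"
  shows "smooth_fun_on U (jcoeff f m)" "sdeg m \<notin> D \<Longrightarrow> u \<in> U \<Longrightarrow> jcoeff f m u = 0"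
  using assms by (auto simp: jets_on_def)

lemma jets_on_mono: "f \<in> jets_on U D \<Longrightarrow> D \<subseteq> D' \<Longrightarrow> f \<in> jets_on U D'"
  by (auto simp: jets_on_def)

lemma diff_poly_jets_on: "f \<in> diff_poly U \<Longrightarrow> f \<in> jets_on U UNIV"
  by (auto simp: jets_on_def diff_poly_def)

lemma diff_poly_deg_jets_on: "f \<in> diff_poly_deg U d \<Longrightarrow> f \<in> jets_on U {d}"
  by (auto simp: jets_on_def diff_poly_def diff_poly_deg_def)

lemma eq_over_refl [simp]: "eq_over U f f"
  by (simp add: eq_over_def)

lemma eq_over_sym: "eq_over U f g \<Longrightarrow> eq_over U g f"
  by (simp add: eq_over_def)

lemma eq_over_trans [trans]: "eq_over U f g \<Longrightarrow> eq_over U g h \<Longrightarrow> eq_over U f h"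
  by (simp add: eq_over_def)

lemma jcoeff_jet_partial_0 [simp]: "jcoeff (jet_partial i 0 f) m u = partial i (jcoeff f m) u"
  by (simp add: jet_partial_def)

lemma jcoeff_jet_partial_pos:
  "s > 0 \<Longrightarrow> jcoeff (jet_partial i s f) m u = (real (count m (i, s)) + 1) * jcoeff f (add_mset (i, s) m) u"
  by (simp add: jet_partial_def)

lemma jet_partial_pos_fun:
  "s > 0 \<Longrightarrow> jcoeff (jet_partial i s f) m = (\<lambda>u. (real (count m (i, s)) + 1) * jcoeff f (add_mset (i, s) m) u)"
  by (rule ext) (simp add: jcoeff_jet_partial_pos)

lemma jet_partial_0_fun: "jcoeff (jet_partial i 0 f) m = partial i (jcoeff f m)"
  by (rule ext) simp

lemma jcoeff_Dx: "jcoeff (Dx f) m u =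
    (\<Sum>(i, s) | (i, Suc s) \<in># m. jcoeff (jet_partial i s f) (m - {#(i, Suc s)#}) u)"
  by (simp add: Dx_def)

lemma finite_Dx_index: "finite {(i, s). (i, Suc s) \<in># m}"
proof -
  have "{(i, s). (i, Suc s) \<in># m} = (\<lambda>(i, s). (i, Suc s)) -` set_mset m" by auto
  then show ?thesis by (simp add: finite_vimageI inj_on_def)
qed

text \<open>The monomial form of differentiating the left factor of a product: splits whose left
  part lacks x carry the weight 0, and the others arise uniquely by adding x to the left part of a
  split of m.\<close>

lemma msplits_count_left:
  "(\<Sum>(a, b)\<in>msplits (add_mset x m). real (count a x) * F a b)
    = (\<Sum>(a, b)\<in>msplits m. (real (count a x) + 1) * F (add_mset x a) b)"
proof -
  let ?S = "(\<lambda>(a, b). (add_mset x a, b)) ` msplits m"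
  have "(\<Sum>(a, b)\<in>msplits (add_mset x m). real (count a x) * F a b) = (\<Sum>(a, b)\<in>?S. real (count a x) * F a b)"
  proof (rule sum.mono_neutral_right, simp, force, clarify)
    fix a b assume ab: "(a, b) \<in> msplits (add_mset x m)" "(a, b) \<notin> ?S"
    have "x \<notin># a"
    proof
      assume "x \<in># a"
      then obtain a' where a': "a = add_mset x a'" by (meson multi_member_split)
      then have "(a', b) \<in> msplits m" using ab(1) by simp
      then have "(a, b) \<in> ?S" using a' by (intro image_eqI[of _ _ "(a', b)"]) simp_all
      then show False using ab(2) by simp
    qed
    then show "real (count a x) * F a b = 0" by (simp add: not_in_iff)
  qed
  also have "\<dots> = (\<Sum>(a, b)\<in>msplits m. (real (count a x) + 1) * F (add_mset x a) b)"
    by (subst sum.reindex) (auto simp: inj_on_def case_prod_unfold add.commute)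
  finally show ?thesis .
qed

section \<open>Stability of the series under the operations, the Leibniz rule, and the commutator
  with the total derivative\<close>

context
  fixes U :: "(real^'n::finite) set"
  assumes U: "open U"
begin

lemma jets_on_zero [simp]: "0 \<in> jets_on U D"
proof -
  have "jcoeff 0 m = (\<lambda>u. 0)" for m :: "('n \<times> nat) multiset" by (rule ext) simp
  then show ?thesis by (auto simp: jets_on_def smooth_const[OF U])
qed

lemma jets_on_add: "f \<in> jets_on U D \<Longrightarrow> g \<in> jets_on U D \<Longrightarrow> f + g \<in> jets_on U D"
proof -
  have "jcoeff (f + g) m = (\<lambda>u. jcoeff f m u + jcoeff g m u)" for m by (rule ext) simp
  then show "f \<in> jets_on U D \<Longrightarrow> g \<in> jets_on U D \<Longrightarrow> f + g \<in> jets_on U D"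
    by (auto simp: jets_on_def smooth_add[OF U])
qed

lemma jets_on_sum: "(\<And>a. a \<in> A \<Longrightarrow> f a \<in> jets_on U D) \<Longrightarrow> sum f A \<in> jets_on U D"
  by (induction A rule: infinite_finite_induct) (auto intro: jets_on_add)

lemma jets_on_mult:
  assumes f: "f \<in> jets_on U D" and g: "g \<in> jets_on U E"
    and DE: "\<And>d e. d \<in> D \<Longrightarrow> e \<in> E \<Longrightarrow> d + e \<in> C"
  shows "f * g \<in> jets_on U C"
proof -
  have "jcoeff (f * g) m = (\<lambda>u. \<Sum>p\<in>msplits m. jcoeff f (fst p) u * jcoeff g (snd p) u)" for m
    by (rule ext) (simp add: jcoeff_mult case_prod_unfold)
  then have "smooth_fun_on U (jcoeff (f * g) m)" for m
    using jets_onD(1)[OF f] jets_onD(1)[OF g] by (auto intro!: smooth_sum smooth_mult U)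
  moreover have "jcoeff (f * g) m u = 0" if m: "sdeg m \<notin> C" and u: "u \<in> U" for m u
    unfolding jcoeff_mult
  proof (rule sum.neutral, clarify)
    fix a b assume "(a, b) \<in> msplits m"
    then have "m = a + b" by simp
    then have "sdeg a \<notin> D \<or> sdeg b \<notin> E" using m DE by auto
    then show "jcoeff f a u * jcoeff g b u = 0"
      using jets_onD(2)[OF f _ u] jets_onD(2)[OF g _ u] by auto
  qed
  ultimately show ?thesis by (simp add: jets_on_def)
qed

lemma jets_on_jet_partial:
  assumes f: "f \<in> jets_on U D" and E: "\<And>d. d + s \<in> D \<Longrightarrow> d \<in> E"
  shows "jet_partial i s f \<in> jets_on U E"
proof (cases "s = 0")
  case True
  have "partial i (jcoeff f m) u = 0" if "sdeg m \<notin> E" "u \<in> U" for m u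
    using partial_cong[OF U that(2), of "jcoeff f m" "\<lambda>_. 0"] jets_onD(2)[OF f] that E True by auto
  then show ?thesis
    using True jets_onD(1)[OF f] by (auto simp: jets_on_def jet_partial_0_fun intro!: smooth_partial)
next
  case False
  have "jcoeff f (add_mset (i, s) m) u = 0" if "sdeg m \<notin> E" "u \<in> U" for m u
    by (rule jets_onD(2)[OF f]) (use that E[of "sdeg m"] in \<open>auto simp: add.commute\<close>)
  then show ?thesis
    using False jets_onD(1)[OF f]
    by (auto simp: jets_on_def jet_partial_pos_fun intro!: smooth_mult smooth_const U)
qed

lemma jets_on_Dx:
  assumes f: "f \<in> jets_on U D" and E: "\<And>d. d \<in> D \<Longrightarrow> Suc d \<in> E"
  shows "Dx f \<in> jets_on U E"
proof -
  have "jcoeff (Dx f) m = (\<lambda>u. \<Sum>p\<in>{(i, s). (i, Suc s) \<in># m}.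
      jcoeff (jet_partial (fst p) (snd p) f) (m - {#(fst p, Suc (snd p))#}) u)" for m
    by (rule ext) (simp add: jcoeff_Dx case_prod_unfold)
  moreover have "smooth_fun_on U (jcoeff (jet_partial i s f) m)" for i s m
    using jets_onD(1)[OF jets_on_jet_partial[OF f]] by (metis UNIV_I)
  ultimately have "smooth_fun_on U (jcoeff (Dx f) m)" for m
    by (auto intro!: smooth_sum U)
  moreover have "jcoeff (Dx f) m u = 0" if m: "sdeg m \<notin> E" and u: "u \<in> U" for m u
    unfolding jcoeff_Dx
  proof (rule sum.neutral, clarify)
    fix i s assume "(i, Suc s) \<in># m"
    then obtain m' where m': "m = add_mset (i, Suc s) m'" by (meson multi_member_split)
    have "jet_partial i s f \<in> jets_on U {d. d + s \<in> D}"
      by (rule jets_on_jet_partial[OF f]) auto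
    moreover have "sdeg m' \<notin> {d. d + s \<in> D}" using m m' E by (auto simp: add.commute)
    ultimately show "jcoeff (jet_partial i s f) (m - {#(i, Suc s)#}) u = 0"
      using jets_onD(2) u m' by fastforce
  qed
  ultimately show ?thesis by (simp add: jets_on_def)
qed

lemma jets_on_Dx_pow:
  assumes f: "f \<in> jets_on U D"
  shows "(Dx ^^ n) f \<in> jets_on U ((\<lambda>d. d + n) ` D)"
proof (induction n)
  case 0
  then show ?case using f by simp
next
  case (Suc n)
  show ?case unfolding funpow.simps o_def by (rule jets_on_Dx[OF Suc]) auto
qed

lemma jet_partial_cong:
  assumes "eq_over U f g"
  shows "eq_over U (jet_partial i s f) (jet_partial i s g)"
  unfolding eq_over_def
proof (intro allI ballI)
  fix m u assume u: "u \<in> U"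
  show "jcoeff (jet_partial i s f) m u = jcoeff (jet_partial i s g) m u"
    using assms u partial_cong[OF U u, of "jcoeff f m" "jcoeff g m" i]
    by (cases "s = 0") (auto simp: eq_over_def jcoeff_jet_partial_pos)
qed

lemma Dx_cong: "eq_over U f g \<Longrightarrow> eq_over U (Dx f) (Dx g)"
  using jet_partial_cong[of f g] unfolding eq_over_def jcoeff_Dx
  by (auto intro!: sum.cong)

lemma jet_partial_commute:
  assumes f: "f \<in> jets_on U D"
  shows "eq_over U (jet_partial i s (jet_partial j t f)) (jet_partial j t (jet_partial i s f))"
  unfolding eq_over_def
proof (intro allI ballI)
  fix m u assume u: "u \<in> U"
  have d: "jcoeff f p differentiable (at u)" for p
    using jets_onD(1)[OF f] u by (rule smooth_differentiable)
  consider "s = 0" "t = 0" | "s = 0" "t > 0" | "s > 0" "t = 0" | "s > 0" "t > 0" by auto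
  then show "jcoeff (jet_partial i s (jet_partial j t f)) m u = jcoeff (jet_partial j t (jet_partial i s f)) m u"
  proof cases
    case 1
    then show ?thesis
      using smooth_partial_commute[OF U jets_onD(1)[OF f] u] by (simp add: jet_partial_0_fun)
  next
    case 2
    then show ?thesis by (simp add: jet_partial_pos_fun jet_partial_0_fun partial_cmult[OF d])
  next
    case 3
    then show ?thesis by (simp add: jet_partial_pos_fun jet_partial_0_fun partial_cmult[OF d])
  next
    case 4
    then show ?thesis by (simp add: jcoeff_jet_partial_pos add_mset_commute)
  qed
qed

text \<open>For s > 0 the multiplicity of the variable in a product monomial is the sum of its
  multiplicities in the two factors; these two summands are the two terms of the Leibniz
  rule.\<close>

lemma jet_partial_mult:
  assumes f: "f \<in> jets_on U D" and g: "g \<in> jets_on U E"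
  shows "eq_over U (jet_partial i s (f * g)) (jet_partial i s f * g + f * jet_partial i s g)"
  unfolding eq_over_def
proof (intro allI ballI)
  fix m u assume u: "u \<in> U"
  have df: "jcoeff f p differentiable (at u)" and dg: "jcoeff g p differentiable (at u)" for p
    using jets_onD(1)[OF f] jets_onD(1)[OF g] u by (auto intro: smooth_differentiable)
  show "jcoeff (jet_partial i s (f * g)) m u = jcoeff (jet_partial i s f * g + f * jet_partial i s g) m u"
  proof (cases "s = 0")
    case True
    have "jcoeff (f * g) m = (\<lambda>u. \<Sum>p\<in>msplits m. jcoeff f (fst p) u * jcoeff g (snd p) u)"
      by (rule ext) (simp add: jcoeff_mult case_prod_unfold)
    then have "partial i (jcoeff (f * g) m) u
        = (\<Sum>p\<in>msplits m. partial i (\<lambda>u. jcoeff f (fst p) u * jcoeff g (snd p) u) u)"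
      using df dg by (simp add: partial_sum)
    also have "\<dots> = (\<Sum>p\<in>msplits m. jcoeff f (fst p) u * partial i (jcoeff g (snd p)) u
        + partial i (jcoeff f (fst p)) u * jcoeff g (snd p) u)"
      by (rule sum.cong) (auto intro!: partial_mult df dg)
    finally show ?thesis
      using True by (simp add: jcoeff_mult case_prod_unfold sum.distrib)
  next
    case False
    let ?x = "(i, s)"
    let ?M = "msplits (add_mset ?x m)"
    have *: "(\<Sum>(a, b)\<in>?M. real (count a ?x) * (jcoeff f a u * jcoeff g b u))
        = (\<Sum>(a, b)\<in>msplits m. (real (count a ?x) + 1) * (jcoeff f (add_mset ?x a) u * jcoeff g b u))"
      by (rule msplits_count_left)
    have "(\<Sum>(a, b)\<in>?M. real (count b ?x) * (jcoeff f a u * jcoeff g b u))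
        = (\<Sum>(b, a)\<in>?M. real (count b ?x) * (jcoeff f a u * jcoeff g b u))"
      by (rule sum.reindex_bij_witness[of _ prod.swap prod.swap]) (auto simp: add.commute)
    also have "\<dots> = (\<Sum>(b, a)\<in>msplits m. (real (count b ?x) + 1) * (jcoeff f a u * jcoeff g (add_mset ?x b) u))"
      by (rule msplits_count_left)
    also have "\<dots> = (\<Sum>(a, b)\<in>msplits m. (real (count b ?x) + 1) * (jcoeff f a u * jcoeff g (add_mset ?x b) u))"
      by (rule sum.reindex_bij_witness[of _ prod.swap prod.swap]) (auto simp: add.commute)
    finally have **: "(\<Sum>(a, b)\<in>?M. real (count b ?x) * (jcoeff f a u * jcoeff g b u))
        = (\<Sum>(a, b)\<in>msplits m. (real (count b ?x) + 1) * (jcoeff f a u * jcoeff g (add_mset ?x b) u))" .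
    have "jcoeff (jet_partial i s (f * g)) m u
        = (\<Sum>(a, b)\<in>?M. (real (count m ?x) + 1) * (jcoeff f a u * jcoeff g b u))"
      using False by (simp add: jcoeff_jet_partial_pos jcoeff_mult sum_distrib_left case_prod_unfold)
    also have "\<dots> = (\<Sum>(a, b)\<in>?M. real (count a ?x) * (jcoeff f a u * jcoeff g b u)
        + real (count b ?x) * (jcoeff f a u * jcoeff g b u))"
    proof (rule sum.cong, simp, clarify)
      fix a b assume "(a, b) \<in> ?M"
      then have "count (a + b) ?x = count m ?x + 1" by simp
      then have "real (count m ?x) + 1 = real (count a ?x) + real (count b ?x)" by simp
      then show "(real (count m ?x) + 1) * (jcoeff f a u * jcoeff g b u) =
          real (count a ?x) * (jcoeff f a u * jcoeff g b u) + real (count b ?x) * (jcoeff f a u * jcoeff g b u)"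
        by (simp add: distrib_right)
    qed
    also have "\<dots> = jcoeff (jet_partial i s f * g + f * jet_partial i s g) m u"
      using * ** False unfolding jcoeff_add jcoeff_mult
      by (simp add: case_prod_unfold sum.distrib jcoeff_jet_partial_pos mult_ac)
    finally show ?thesis .
  qed
qed

text \<open>The commutator of \<partial>/\<partial>u^{j,t} with \<partial>_x is
  \<partial>/\<partial>u^{j,t-1}. On coefficients, multiplying m by u^{j,t} brings the index (j,
  t-1) into the sum defining \<open>Dx\<close>, with a multiplicity one larger than on the other
  side; the surplus is the commutator.\<close>

lemma jet_partial_Dx:
  assumes f: "f \<in> jets_on U D"
  shows "eq_over U (jet_partial j t (Dx f))
    (Dx (jet_partial j t f) + (if t = 0 then 0 else jet_partial j (t - 1) f))"
  unfolding eq_over_def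
proof (intro allI ballI)
  fix m u assume u: "u \<in> U"
  have comm: "jcoeff (jet_partial j t (jet_partial i s f)) m' u = jcoeff (jet_partial i s (jet_partial j t f)) m' u"
    for i s m'
    using jet_partial_commute[OF f] u by (simp add: eq_over_def)
  have sm: "jcoeff (jet_partial i s f) m' differentiable (at u)" for i s m'
    using jets_onD(1)[OF jets_on_jet_partial[OF f]] u by (metis UNIV_I smooth_differentiable)
  let ?I = "\<lambda>m. {(i, s). (i, Suc s) \<in># m}"
  let ?x = "(j, t)"
  show "jcoeff (jet_partial j t (Dx f)) m u =
      jcoeff (Dx (jet_partial j t f) + (if t = 0 then 0 else jet_partial j (t - 1) f)) m u"
  proof (cases t)
    case 0
    have "jcoeff (Dx f) m = (\<lambda>u. \<Sum>p\<in>?I m.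
        jcoeff (jet_partial (fst p) (snd p) f) (m - {#(fst p, Suc (snd p))#}) u)"
      by (rule ext) (simp add: jcoeff_Dx case_prod_unfold)
    then have "partial j (jcoeff (Dx f) m) u = (\<Sum>p\<in>?I m.
        partial j (jcoeff (jet_partial (fst p) (snd p) f) (m - {#(fst p, Suc (snd p))#})) u)"
      using sm by (simp add: partial_sum)
    moreover have "partial j (jcoeff (jet_partial i s f) m') u = jcoeff (jet_partial i s (jet_partial j 0 f)) m' u"
      for i s m' using comm[of i s m'] 0 by simp
    ultimately show ?thesis
      using 0 by (simp add: jcoeff_Dx case_prod_unfold)
  next
    case (Suc r)
    have I: "?I (add_mset ?x m) = insert (j, r) (?I m)"
      using Suc by auto
    let ?G = "\<lambda>(i, s). jcoeff (jet_partial i s (jet_partial j t f)) (m - {#(i, Suc s)#}) u"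
    let ?F = "\<lambda>(i, s). (real (count m ?x) + 1) * jcoeff (jet_partial i s f) (add_mset ?x m - {#(i, Suc s)#}) u"
    have main: "?F (i, s) = ?G (i, s)" if "(i, s) \<in> ?I m - {(j, r)}" for i s
    proof -
      have ne: "(i, Suc s) \<noteq> ?x" and mem: "(i, Suc s) \<in># m" using that Suc by auto
      have "add_mset ?x m - {#(i, Suc s)#} = add_mset ?x (m - {#(i, Suc s)#})"
        using ne by (metis add_mset_diff_bothsides diff_union_swap)
      moreover have "count (m - {#(i, Suc s)#}) ?x = count m ?x"
        unfolding count_diff count_single using ne by (simp only: if_False diff_zero)
      ultimately show ?thesis
        using comm[of i s "m - {#(i, Suc s)#}"] Suc by (simp add: jcoeff_jet_partial_pos)
    qed
    have Fx: "?F (j, r) = (real (count m ?x) + 1) * jcoeff (jet_partial j r f) m u"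
      using Suc by simp
    have Gx: "?G (j, r) = real (count m ?x) * jcoeff (jet_partial j r f) m u" if "(j, r) \<in> ?I m"
    proof -
      have "?x \<in># m" using that Suc by simp
      then obtain m' where "m = add_mset ?x m'" by (meson multi_member_split)
      then show ?thesis
        using Suc comm[of j r m'] by (simp add: jcoeff_jet_partial_pos add.commute)
    qed
    have sum': "sum ?F (?I m - {(j, r)}) = sum ?G (?I m - {(j, r)})"
      by (rule sum.cong[OF refl]) (use main in blast)
    have G: "sum ?G (?I m) = sum ?G (?I m - {(j, r)}) + real (count m ?x) * jcoeff (jet_partial j r f) m u"
    proof (cases "(j, r) \<in> ?I m")
      case True
      then show ?thesis using sum.remove[OF finite_Dx_index True, of ?G] Gx by simp
    next
      case False
      then have "count m ?x = 0" using Suc by (simp add: not_in_iff)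
      then show ?thesis using False by simp
    qed
    have "jcoeff (jet_partial j t (Dx f)) m u = sum ?F (?I (add_mset ?x m))"
      using Suc by (simp add: jcoeff_jet_partial_pos jcoeff_Dx sum_distrib_left case_prod_unfold)
    also have "\<dots> = sum ?F (insert (j, r) (?I m))" unfolding I ..
    also have "\<dots> = ?F (j, r) + sum ?F (?I m - {(j, r)})"
      by (rule sum.insert_remove[OF finite_Dx_index])
    also have "\<dots> = sum ?G (?I m) + jcoeff (jet_partial j r f) m u"
      unfolding Fx sum' G by (simp add: algebra_simps)
    finally show ?thesis using Suc by (simp add: jcoeff_Dx)
  qed
qed

end

section \<open>Polarization of a series at a point\<close>

definition jscale :: "real \<Rightarrow> 'n::finite jet_series \<Rightarrow> 'n jet_series" where
  "jscale c f = Jet_Series (\<lambda>m u. c * jcoeff f m u)"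

lemma jcoeff_jscale [simp]: "jcoeff (jscale c f) m u = c * jcoeff f m u"
  by (simp add: jscale_def)

lemma jcoeff_jscale_fun: "jcoeff (jscale c f) m = (\<lambda>u. c * jcoeff f m u)"
  by (rule ext) simp

text \<open>The pair \<open>(p, \<lambda>)\<close> stands for the jet direction \<open>u\<^sup>i\<^sup>,\<^sup>s \<mapsto> \<delta>\<^sub>i\<^sub>p \<lambda>\<^sup>s\<close>, that is, for the variation
  \<open>e\<^sub>p exp(\<lambda>x)\<close> of the loop. The cut-off \<open>N\<close> makes the sum finite; it has no effect on series whose
  degree is bounded by \<open>N\<close>.\<close>

definition jet_dir :: "nat \<Rightarrow> 'n::finite \<times> real \<Rightarrow> 'n jet_series \<Rightarrow> 'n jet_series" where
  "jet_dir N x f = (\<Sum>s\<le>N. jscale (snd x ^ s) (jet_partial (fst x) s f))"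

text \<open>The iterated derivative at the constant loop u along the listed directions, that is, the
  multilinear Taylor coefficient on exponential variations with the common exponential factor
  removed.\<close>

fun polar :: "nat \<Rightarrow> real^'n::finite \<Rightarrow> ('n \<times> real) list \<Rightarrow> 'n jet_series \<Rightarrow> real" where
  "polar N u [] f = jcoeff f {#} u"
| "polar N u (x # xs) f = polar N u xs (jet_dir N x f)"

fun splits :: "'a list \<Rightarrow> ('a list \<times> 'a list) list" where
  "splits [] = [([], [])]"
| "splits (x # xs) = map (\<lambda>(a, b). (x # a, b)) (splits xs) @ map (\<lambda>(a, b). (a, x # b)) (splits xs)"

abbreviation weight :: "('a \<times> real) list \<Rightarrow> real" where
  "weight xs \<equiv> \<Sum>x\<leftarrow>xs. snd x"

context
  fixes U :: "(real^'n::finite) set"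
  assumes U: "open U"
begin

lemma jets_on_cong: "f \<in> jets_on U D \<Longrightarrow> eq_over U f g \<Longrightarrow> g \<in> jets_on U D"
  (is "_ \<Longrightarrow> _ \<Longrightarrow> ?thesis")
proof -
  assume f: "f \<in> jets_on U D" and e: "eq_over U f g"
  have "smooth_fun_on U (jcoeff g m)" for m
    using smooth_cong[OF U, of "jcoeff f m" "jcoeff g m"] jets_onD(1)[OF f] e by (simp add: eq_over_def)
  moreover have "jcoeff g m v = 0" if "sdeg m \<notin> D" "v \<in> U" for m v
    using jets_onD(2)[OF f that] e that by (simp add: eq_over_def)
  ultimately show ?thesis by (simp add: jets_on_def)
qed

lemma jets_on_jscale: "f \<in> jets_on U D \<Longrightarrow> jscale c f \<in> jets_on U D"
  by (auto simp: jets_on_def jcoeff_jscale_fun intro!: smooth_mult smooth_const U)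

lemma jets_on_UNIV: "f \<in> jets_on U D \<Longrightarrow> f \<in> jets_on U UNIV"
  by (rule jets_on_mono) auto

lemma jets_on_jet_partial_UNIV: "f \<in> jets_on U UNIV \<Longrightarrow> jet_partial i s f \<in> jets_on U UNIV"
  by (rule jets_on_jet_partial[OF U]) auto

lemma jets_on_jet_dir:
  assumes "f \<in> jets_on U D" and "\<And>d s. d + s \<in> D \<Longrightarrow> d \<in> E"
  shows "jet_dir N x f \<in> jets_on U E"
  unfolding jet_dir_def
  by (intro jets_on_sum[OF U] jets_on_jscale jets_on_jet_partial[OF U assms(1)]) (rule assms(2))

lemma jet_partial_add:
  assumes "f \<in> jets_on U D" "g \<in> jets_on U E"
  shows "eq_over U (jet_partial i s (f + g)) (jet_partial i s f + jet_partial i s g)"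
proof -
  have "jcoeff (f + g) m = (\<lambda>u. jcoeff f m u + jcoeff g m u)" for m by (rule ext) simp
  then show ?thesis
    using assms[THEN jets_onD(1)]
    by (cases "s = 0") (auto simp: eq_over_def jcoeff_jet_partial_pos distrib_left
        intro!: partial_add smooth_differentiable)
qed

lemma jet_partial_jscale:
  assumes "f \<in> jets_on U D"
  shows "eq_over U (jet_partial i s (jscale c f)) (jscale c (jet_partial i s f))"
  using assms[THEN jets_onD(1)]
  by (cases "s = 0") (auto simp: eq_over_def jcoeff_jet_partial_pos jcoeff_jscale_fun mult.left_commute
      intro!: partial_cmult smooth_differentiable)

lemma Dx_add:
  assumes "f \<in> jets_on U D" "g \<in> jets_on U E"
  shows "eq_over U (Dx (f + g)) (Dx f + Dx g)"
  using jet_partial_add[OF assms]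
  by (simp add: eq_over_def jcoeff_Dx case_prod_unfold flip: sum.distrib)

lemma Dx_jscale:
  assumes "f \<in> jets_on U D"
  shows "eq_over U (Dx (jscale c f)) (jscale c (Dx f))"
  using jet_partial_jscale[OF assms]
  by (simp add: eq_over_def jcoeff_Dx case_prod_unfold sum_distrib_left)

lemma Dx_zero: "eq_over U (Dx 0) 0"
proof -
  have "jscale 0 0 = (0 :: 'n jet_series)" by (rule jet_series_eqI) simp
  moreover have "jscale 0 (Dx 0) = (0 :: 'n jet_series)" by (rule jet_series_eqI) simp
  ultimately show ?thesis using Dx_jscale[of 0 UNIV 0] U by simp
qed

lemma eq_over_add: "eq_over U f f' \<Longrightarrow> eq_over U g g' \<Longrightarrow> eq_over U (f + g) (f' + g')"
  by (simp add: eq_over_def)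

lemma eq_over_sum: "(\<And>a. a \<in> A \<Longrightarrow> eq_over U (f a) (g a)) \<Longrightarrow> eq_over U (sum f A) (sum g A)"
  by (simp add: eq_over_def)

lemma eq_over_jscale: "eq_over U f g \<Longrightarrow> eq_over U (jscale c f) (jscale c g)"
  by (simp add: eq_over_def)

lemma Dx_sum:
  assumes "\<And>a. a \<in> A \<Longrightarrow> f a \<in> jets_on U UNIV"
  shows "eq_over U (Dx (sum f A)) (\<Sum>a\<in>A. Dx (f a))"
  using assms
proof (induction A rule: infinite_finite_induct)
  case (insert a A)
  have "eq_over U (Dx (f a + sum f A)) (Dx (f a) + Dx (sum f A))"
    by (rule Dx_add[of _ UNIV _ UNIV]) (use insert.prems in \<open>auto intro: jets_on_sum[OF U]\<close>)
  also have "eq_over U \<dots> (Dx (f a) + (\<Sum>a\<in>A. Dx (f a)))"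
    using insert by (intro eq_over_add) auto
  finally show ?case using insert by simp
qed (auto simp: Dx_zero)

lemma jet_dir_cong: "eq_over U f g \<Longrightarrow> eq_over U (jet_dir N x f) (jet_dir N x g)"
  unfolding jet_dir_def by (intro eq_over_sum eq_over_jscale jet_partial_cong[OF U])

lemma jet_dir_add:
  assumes "f \<in> jets_on U D" "g \<in> jets_on U E"
  shows "eq_over U (jet_dir N x (f + g)) (jet_dir N x f + jet_dir N x g)"
  using jet_partial_add[OF assms]
  by (simp add: eq_over_def jet_dir_def distrib_left flip: sum.distrib)

lemma jet_dir_jscale:
  assumes "f \<in> jets_on U D"
  shows "eq_over U (jet_dir N x (jscale c f)) (jscale c (jet_dir N x f))"
  using jet_partial_jscale[OF assms]
  by (simp add: eq_over_def jet_dir_def sum_distrib_left mult.left_commute)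

lemma jet_dir_mult:
  assumes "f \<in> jets_on U D" "g \<in> jets_on U E"
  shows "eq_over U (jet_dir N x (f * g)) (jet_dir N x f * g + f * jet_dir N x g)"
proof -
  have "jcoeff (jet_dir N x f * g + f * jet_dir N x g) m v =
      (\<Sum>s\<le>N. snd x ^ s * jcoeff (jet_partial (fst x) s f * g + f * jet_partial (fst x) s g) m v)" for m v
  proof -
    have "jcoeff (jet_dir N x f * g) m v = (\<Sum>s\<le>N. snd x ^ s * jcoeff (jet_partial (fst x) s f * g) m v)"
      unfolding jcoeff_mult jet_dir_def
      by (simp add: sum_distrib_left sum_distrib_right case_prod_unfold mult.assoc) (rule sum.swap)
    moreover have "jcoeff (f * jet_dir N x g) m v = (\<Sum>s\<le>N. snd x ^ s * jcoeff (f * jet_partial (fst x) s g) m v)"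
      unfolding jcoeff_mult jet_dir_def
      by (simp add: sum_distrib_left sum_distrib_right case_prod_unfold mult.left_commute) (rule sum.swap)
    ultimately show ?thesis by (simp add: distrib_left sum.distrib)
  qed
  then show ?thesis
    using jet_partial_mult[OF U assms] by (simp add: eq_over_def jet_dir_def)
qed

text \<open>By \<open>jet_partial_Dx\<close>, the commutator lowers the order s by one, and
  reindexing the sum over \<lambda>^s costs one factor \<lambda>. In function terms, \<partial>_x
  also acts on the factor exp(\<lambda>x) of the variation.\<close>

lemma jet_dir_Dx:
  assumes f: "f \<in> jets_on U {..d}" and d: "d < N"
  shows "eq_over U (jet_dir N x (Dx f)) (Dx (jet_dir N x f) + jscale (snd x) (jet_dir N x f))"
proof -
  let ?p = "fst x" and ?l = "snd x"
  note jp = jets_on_jet_partial_UNIV[OF jets_on_UNIV[OF f]]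
  have 1: "eq_over U (Dx (jet_dir N x f)) (\<Sum>s\<le>N. jscale (?l ^ s) (Dx (jet_partial ?p s f)))"
  proof -
    have "eq_over U (Dx (jet_dir N x f)) (\<Sum>s\<le>N. Dx (jscale (?l ^ s) (jet_partial ?p s f)))"
      unfolding jet_dir_def by (rule Dx_sum) (intro jets_on_jscale jp)
    also have "eq_over U \<dots> (\<Sum>s\<le>N. jscale (?l ^ s) (Dx (jet_partial ?p s f)))"
      by (intro eq_over_sum Dx_jscale[OF jp])
    finally show ?thesis .
  qed
  have 2: "eq_over U (jet_dir N x (Dx f)) (\<Sum>s\<le>N. jscale (?l ^ s)
      (Dx (jet_partial ?p s f) + (if s = 0 then 0 else jet_partial ?p (s - 1) f)))"
    unfolding jet_dir_def by (intro eq_over_sum eq_over_jscale jet_partial_Dx[OF U f])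
  have N: "jcoeff (jet_partial ?p N f) m v = 0" if "v \<in> U" for m v
  proof -
    have "jet_partial ?p N f \<in> jets_on U {}"
      by (rule jets_on_jet_partial[OF U f]) (use d in auto)
    then show ?thesis using that jets_onD(2) by fastforce
  qed
  obtain n where n: "N = Suc n" using d by (cases N) auto
  have "(\<Sum>s\<le>N. ?l ^ s * jcoeff (if s = 0 then 0 else jet_partial ?p (s - 1) f) m v)
      = ?l * (\<Sum>s\<le>N. ?l ^ s * jcoeff (jet_partial ?p s f) m v)" if "v \<in> U" for m v
  proof -
    have "(\<Sum>s\<le>N. ?l ^ s * jcoeff (if s = 0 then 0 else jet_partial ?p (s - 1) f) m v)
        = (\<Sum>s\<le>n. ?l ^ Suc s * jcoeff (jet_partial ?p s f) m v)"
      unfolding n by (subst sum.atMost_Suc_shift) simp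
    also have "\<dots> = ?l * (\<Sum>s\<le>N. ?l ^ s * jcoeff (jet_partial ?p s f) m v)"
      unfolding n sum.atMost_Suc using N[OF that] n by (simp add: sum_distrib_left mult.assoc)
    finally show ?thesis .
  qed
  then show ?thesis
    using 1 2 by (simp add: eq_over_def jet_dir_def distrib_left sum.distrib)
qed

context
  fixes u :: "real^'n"
  assumes u: "u \<in> U"
begin

lemma polar_cong: "eq_over U f g \<Longrightarrow> polar N u xs f = polar N u xs g"
proof (induction xs arbitrary: f g)
  case Nil
  then show ?case using u by (simp add: eq_over_def)
next
  case (Cons x xs)
  show ?case using Cons.IH[OF jet_dir_cong[OF Cons.prems]] by simp
qed

lemma polar_add:
  "f \<in> jets_on U UNIV \<Longrightarrow> g \<in> jets_on U UNIV \<Longrightarrow> polar N u xs (f + g) = polar N u xs f + polar N u xs g"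
proof (induction xs arbitrary: f g)
  case (Cons x xs)
  then show ?case
    using polar_cong[OF jet_dir_add[OF Cons.prems]] jets_on_jet_dir[OF Cons.prems(1)]
      jets_on_jet_dir[OF Cons.prems(2)] by simp
qed simp

lemma polar_jscale:
  "f \<in> jets_on U UNIV \<Longrightarrow> polar N u xs (jscale c f) = c * polar N u xs f"
proof (induction xs arbitrary: f)
  case (Cons x xs)
  then show ?case
    using polar_cong[OF jet_dir_jscale[OF Cons.prems]] jets_on_jet_dir[OF Cons.prems(1)] by simp
qed simp

lemma polar_zero: "polar N u xs 0 = 0"
proof -
  have "jscale 0 0 = (0 :: 'n jet_series)" by (rule jet_series_eqI) simp
  then show ?thesis using polar_jscale[of 0 N xs 0] jets_on_zero[OF U] by simp
qed

lemma polar_sum: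
  "(\<And>a. a \<in> A \<Longrightarrow> f a \<in> jets_on U UNIV) \<Longrightarrow> polar N u xs (sum f A) = (\<Sum>a\<in>A. polar N u xs (f a))"
  by (induction A rule: infinite_finite_induct) (auto simp: polar_zero polar_add jets_on_sum[OF U])

lemma polar_mult:
  "f \<in> jets_on U UNIV \<Longrightarrow> g \<in> jets_on U UNIV \<Longrightarrow>
    polar N u xs (f * g) = (\<Sum>(a, b)\<leftarrow>splits xs. polar N u a f * polar N u b g)"
proof (induction xs arbitrary: f g)
  case Nil
  then show ?case by (simp add: jcoeff_mult_empty)
next
  case (Cons x xs)
  have f': "jet_dir N x f \<in> jets_on U UNIV" and g': "jet_dir N x g \<in> jets_on U UNIV"
    using Cons.prems by (auto intro: jets_on_jet_dir)
  have m: "a * b \<in> jets_on U UNIV" if "a \<in> jets_on U UNIV" "b \<in> jets_on U UNIV" for a b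
    by (rule jets_on_mult[OF U that]) auto
  show ?case
    using polar_cong[OF jet_dir_mult[OF Cons.prems]] Cons.IH[OF f' Cons.prems(2)]
      Cons.IH[OF Cons.prems(1) g'] Cons.prems f' g' m
    by (simp add: polar_add o_def case_prod_unfold)
qed

text \<open>On exponential variations \<partial>_x multiplies by the total frequency, and without
  variations it gives 0 on a constant loop. The strict bound on d makes the cut-off harmless also
  for \<open>Dx f\<close>, whose degree is one higher.\<close>

lemma polar_Dx:
  "f \<in> jets_on U {..d} \<Longrightarrow> d < N \<Longrightarrow> polar N u xs (Dx f) = weight xs * polar N u xs f"
proof (induction xs arbitrary: f)
  case Nil
  then show ?case by (simp add: jcoeff_Dx)
next
  case (Cons x xs)
  have f': "jet_dir N x f \<in> jets_on U {..d}"
    by (rule jets_on_jet_dir[OF Cons.prems(1)]) auto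
  have "Dx (jet_dir N x f) \<in> jets_on U UNIV"
    by (rule jets_on_Dx[OF U f']) auto
  then show ?case
    using polar_cong[OF jet_dir_Dx[OF Cons.prems]] Cons.IH[OF f' Cons.prems(2)]
      jets_on_UNIV[OF f'] jets_on_jscale
    by (simp add: polar_add polar_jscale algebra_simps)
qed

lemma polar_Dx_pow:
  assumes "f \<in> jets_on U {..d}" "d + n \<le> N"
  shows "polar N u xs ((Dx ^^ n) f) = weight xs ^ n * polar N u xs f"
  using assms(2)
proof (induction n)
  case (Suc n)
  have "(Dx ^^ n) f \<in> jets_on U {..d + n}"
    by (rule jets_on_mono[OF jets_on_Dx_pow[OF U assms(1)]]) auto
  then show ?case using Suc by (simp add: polar_Dx)
qed simp

text \<open>Replaces a truncation depending on the monomial by a uniform one: terms with s > sdeg m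
  vanish since \<partial>_x^s produces degree at least s, and terms with s > d vanish since f has no
  variable of that order.\<close>

lemma var_deriv_eq:
  assumes f: "f \<in> jets_on U {..d}" and d: "d \<le> N"
  shows "eq_over U (var_deriv p f) (\<Sum>s\<le>N. jscale ((-1) ^ s) ((Dx ^^ s) (jet_partial p s f)))"
  unfolding eq_over_def
proof (intro allI ballI)
  fix m v assume v: "v \<in> U"
  let ?t = "\<lambda>s. (-1) ^ s * jcoeff ((Dx ^^ s) (jet_partial p s f)) m v"
  have z: "?t s = 0" if "s > sdeg m \<or> s > d" for s
  proof -
    have "jet_partial p s f \<in> jets_on U {e. e + s \<le> d}"
      by (rule jets_on_jet_partial[OF U f]) auto
    then have "(Dx ^^ s) (jet_partial p s f) \<in> jets_on U ((\<lambda>e. e + s) ` {e. e + s \<le> d})"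
      by (rule jets_on_Dx_pow[OF U])
    moreover have "sdeg m \<notin> (\<lambda>e. e + s) ` {e. e + s \<le> d}" using that by auto
    ultimately show ?thesis using jets_onD(2) v by fastforce
  qed
  have "sum ?t {..sdeg m} = sum ?t {..max N (sdeg m)}"
    using z by (intro sum.mono_neutral_left) auto
  also have "\<dots> = sum ?t {..N}"
    using z d by (intro sum.mono_neutral_right) auto
  finally show "jcoeff (var_deriv p f) m v
      = jcoeff (\<Sum>s\<le>N. jscale ((-1) ^ s) ((Dx ^^ s) (jet_partial p s f))) m v"
    by (simp add: var_deriv_def)
qed

lemma jets_on_var_deriv:
  assumes f: "f \<in> jets_on U {..d}"
  shows "var_deriv p f \<in> jets_on U {..d}"
proof (rule jets_on_cong[OF _ eq_over_sym[OF var_deriv_eq[OF f order_refl]]],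
    intro jets_on_sum[OF U] jets_on_jscale)
  fix s
  have "jet_partial p s f \<in> jets_on U {e. e + s \<le> d}"
    by (rule jets_on_jet_partial[OF U f]) auto
  then have "(Dx ^^ s) (jet_partial p s f) \<in> jets_on U ((\<lambda>e. e + s) ` {e. e + s \<le> d})"
    by (rule jets_on_Dx_pow[OF U])
  then show "(Dx ^^ s) (jet_partial p s f) \<in> jets_on U {..d}"
    by (rule jets_on_mono) auto
qed

lemma polar_jet_dir_sum:
  assumes "f \<in> jets_on U UNIV"
  shows "polar N u ((p, l) # xs) f = (\<Sum>s\<le>N. l ^ s * polar N u xs (jet_partial p s f))"
  using jets_on_jet_partial_UNIV[OF assms]
  by (simp add: jet_dir_def polar_sum polar_jscale jets_on_jscale)

text \<open>Integration by parts at the level of symbols: -\<partial>_x acts as minus the total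
  frequency, so the sum over s is the derivative along one more exponential direction, the one that
  closes the total frequency to 0.\<close>

lemma polar_var_deriv:
  assumes f: "f \<in> jets_on U {..d}" and d: "d < N"
  shows "polar N u xs (var_deriv p f) = polar N u ((p, - weight xs) # xs) f"
proof -
  have jp: "jet_partial p s f \<in> jets_on U {..d - s}" for s
    by (rule jets_on_jet_partial[OF U f]) auto
  have D: "(Dx ^^ s) (jet_partial p s f) \<in> jets_on U UNIV" for s
    by (rule jets_on_UNIV[OF jets_on_Dx_pow[OF U jp]])
  have "polar N u xs (var_deriv p f)
      = (\<Sum>s\<le>N. (-1) ^ s * polar N u xs ((Dx ^^ s) (jet_partial p s f)))"
    using polar_cong[OF var_deriv_eq[OF f, of N]] d D
    by (simp add: polar_sum polar_jscale jets_on_jscale)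
  also have "\<dots> = (\<Sum>s\<le>N. (- weight xs) ^ s * polar N u xs (jet_partial p s f))"
  proof (rule sum.cong[OF refl])
    fix s assume "s \<in> {..N}"
    then have "d - s + s \<le> N" using d by auto
    then show "(-1) ^ s * polar N u xs ((Dx ^^ s) (jet_partial p s f))
        = (- weight xs) ^ s * polar N u xs (jet_partial p s f)"
      using polar_Dx_pow[OF jp] by (simp add: power_minus[of "weight xs"])
  qed
  finally show ?thesis using polar_jet_dir_sum[OF jets_on_UNIV[OF f]] by simp
qed

text \<open>A total derivative is multiplied by the total frequency, which is 0 here. The primitive
  h may have unbounded degree, whereas \<open>polar_Dx\<close> needs a bound, so h is truncated
  first.\<close>

lemma polar_null_functional:
  assumes null: "null_functional U f" and f: "f \<in> jets_on U {..d}" and d: "d < N"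
    and w: "weight xs = 0"
  shows "polar N u xs f = 0"
proof -
  obtain h where h: "h \<in> diff_poly U" and fh: "eq_over U f (Dx h)"
    using null by (auto simp: null_functional_def)
  note hj = diff_poly_jets_on[OF h]
  \<comment> \<open>As \<partial>_x raises the degree by exactly one, \<open>Dx h'\<close> agrees
    with \<open>Dx h\<close>, hence with f, up to degree d + 1; in higher degrees both f and
    \<open>Dx h'\<close> vanish.\<close>
  define h' where "h' = Jet_Series (\<lambda>m. if sdeg m \<le> d then jcoeff h m else (\<lambda>_. 0))"
  have h': "h' \<in> jets_on U {..d}"
    using jets_onD(1)[OF hj] by (auto simp: jets_on_def h'_def smooth_const[OF U])
  have part: "jcoeff (jet_partial i s h') m v = jcoeff (jet_partial i s h) m v" if "sdeg m + s \<le> d" for i s m v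
    using that by (cases "s = 0") (auto simp: jcoeff_jet_partial_pos h'_def)
  have "eq_over U f (Dx h')"
    unfolding eq_over_def
  proof (intro allI ballI)
    fix m v assume v: "v \<in> U"
    show "jcoeff f m v = jcoeff (Dx h') m v"
    proof (cases "sdeg m \<le> Suc d")
      case True
      have "jcoeff (Dx h') m v = jcoeff (Dx h) m v"
        unfolding jcoeff_Dx
      proof (rule sum.cong[OF refl], clarify)
        fix i s assume "(i, Suc s) \<in># m"
        then obtain m' where "m = add_mset (i, Suc s) m'" by (meson multi_member_split)
        then show "jcoeff (jet_partial i s h') (m - {#(i, Suc s)#}) v = jcoeff (jet_partial i s h) (m - {#(i, Suc s)#}) v"
          using True by (intro part) simp
      qed
      then show ?thesis using fh v by (simp add: eq_over_def)
    next
      case False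
      have "Dx h' \<in> jets_on U {..Suc d}" by (rule jets_on_Dx[OF U h']) auto
      then show ?thesis
        using False v jets_onD(2)[OF f, of m v] jets_onD(2)[of "Dx h'" U "{..Suc d}" m v] by simp
    qed
  qed
  then show ?thesis using polar_cong polar_Dx[OF h' d] w by (metis mult_zero_left)
qed

end

end

section \<open>Quadratic test functionals\<close>

text \<open>The linear series p(\<partial>_x^2) u^j. The sum starts at 1 because
  \<open>diff_poly\<close> admits no monomial containing a variable of order 0; the factor of order
  0 in \<open>test_density\<close> is a coefficient function instead.\<close>

definition even_symbol :: "'n::finite \<Rightarrow> real poly \<Rightarrow> 'n jet_series" where
  "even_symbol j p = Jet_Series (\<lambda>m v. \<Sum>n\<in>{1..degree p}. if m = {#(j, 2 * n)#} then coeff p n else 0)"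

text \<open>The density \<open>(u\<^sup>j - u\<^sub>0\<^sup>j) p(\<partial>\<^sub>x\<^sup>2) u\<^sup>j\<close>, where \<open>p\<close> has no constant term. Its variational derivative is
  \<open>2 p(\<partial>\<^sub>x\<^sup>2) u\<^sup>j\<close>, so that \<open>p\<close> can be chosen to select the frequency of a single exponential.\<close>

definition test_density :: "real^'n::finite \<Rightarrow> 'n \<Rightarrow> real poly \<Rightarrow> 'n jet_series" where
  "test_density u j p = coord_fun (\<lambda>v. v $ j - u $ j) * even_symbol j p"

text \<open>The variational derivative of a quadratic density is a self-adjoint operator applied to
  u, so with a single component its symbol is even. A frequency can therefore be separated from
  others only through its square.\<close>

lemma frequency_selector:
  assumes "finite Z" "l \<noteq> 0" "\<And>z. z \<in> Z \<Longrightarrow> z\<^sup>2 \<noteq> l\<^sup>2"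
  obtains p :: "real poly" where "coeff p 0 = 0" "2 * poly p (l\<^sup>2) = 1" "\<And>z. z \<in> Z \<Longrightarrow> poly p (z\<^sup>2) = 0"
proof -
  \<comment> \<open>The factor x removes the constant term, hence also the response at frequency 0;
    the final normalization absorbs the factor 2 of the variational derivative.\<close>
  define q where "q = [:0, 1:] * (\<Prod>z\<in>Z. [:- (z\<^sup>2), 1:])"
  have q: "poly q x = x * (\<Prod>z\<in>Z. x - z\<^sup>2)" for x
    by (simp add: q_def poly_prod)
  have nz: "poly q (l\<^sup>2) \<noteq> 0"
    unfolding q using assms by (auto simp: prod_zero_iff) (metis power2_eq_iff)
  show thesis
  proof (rule that[of "smult (1 / (2 * poly q (l\<^sup>2))) q"])
    show "coeff (smult (1 / (2 * poly q (l\<^sup>2))) q) 0 = 0" by (simp add: q_def)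
    show "2 * poly (smult (1 / (2 * poly q (l\<^sup>2))) q) (l\<^sup>2) = 1" using nz by simp
    show "poly (smult (1 / (2 * poly q (l\<^sup>2))) q) (z\<^sup>2) = 0" if "z \<in> Z" for z
      using that assms(1) by (auto simp: q prod_zero_iff)
  qed
qed

fun picks :: "'a list \<Rightarrow> ('a \<times> 'a list) list" where
  "picks [] = []"
| "picks (x # xs) = (x, xs) # map (\<lambda>(y, ys). (y, x # ys)) (picks xs)"

text \<open>\<open>response i v\<close> is the linear functional that sees a single direction \<open>(i, \<lambda>)\<close>, with value \<open>v \<lambda>\<close>.\<close>

abbreviation response :: "'n \<Rightarrow> (real \<Rightarrow> real) \<Rightarrow> 'n \<Rightarrow> ('n \<times> real) list \<Rightarrow> real" where
  "response i v p xs \<equiv> (case xs of [x] \<Rightarrow> if p = i \<and> fst x = i then v (snd x) else 0 | _ \<Rightarrow> 0)"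

abbreviation even_response :: "real poly \<Rightarrow> real \<Rightarrow> real" where
  "even_response p \<equiv> (\<lambda>x. 2 * poly p (x\<^sup>2))"

text \<open>A covector linear in the loop absorbs exactly one direction y. Its frequency becomes the
  argument of the operator symbol K, while the remaining directions zs differentiate the
  coefficients of the operator.\<close>

abbreviation pick_one :: "(('n \<times> real) list \<Rightarrow> real \<Rightarrow> 'n \<Rightarrow> 'n \<Rightarrow> real) \<Rightarrow> 'n \<Rightarrow> (real \<Rightarrow> real) \<Rightarrow>
    'n \<Rightarrow> 'n \<Rightarrow> ('n \<times> real) list \<Rightarrow> real" where
  "pick_one K j w a b ys \<equiv> (\<Sum>(y, zs)\<leftarrow>picks ys. (if fst y = j then w (snd y) else 0) * K zs (snd y) a b)"

abbreviation pick_pair :: "(('n \<times> real) list \<Rightarrow> real \<Rightarrow> 'n \<Rightarrow> 'n \<Rightarrow> real) \<Rightarrow> 'n \<Rightarrow> (real \<Rightarrow> real) \<Rightarrow>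
    'n \<Rightarrow> (real \<Rightarrow> real) \<Rightarrow> ('n \<times> real) list \<Rightarrow> real" where
  "pick_pair K i v j w xs \<equiv>
    (\<Sum>(x, ys)\<leftarrow>picks xs. (if fst x = i then v (snd x) else 0) * pick_one K j w i j ys)"

lemma splits_Nil_left: "(\<Sum>(a, b)\<leftarrow>splits xs. if a = [] then G b else 0) = (G xs :: real)"
proof (induction xs arbitrary: G)
  case (Cons x xs)
  show ?case using Cons[of "\<lambda>b. G (x # b)"] by (simp add: o_def case_prod_unfold cong: if_cong)
qed simp

lemma sum_delta_delta:
  fixes i j :: "'n::finite" and c :: real
  shows "(\<Sum>p\<in>UNIV. \<Sum>q\<in>UNIV. if p = i then if q = j then c else 0 else 0) = c"
proof -
  have "(\<Sum>q\<in>UNIV. if p = i then if q = j then c else 0 else 0) = (if p = i then c else 0)" for p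
    by simp
  then show ?thesis by simp
qed

lemma sum_sum_list: "(\<Sum>s\<in>A. \<Sum>x\<leftarrow>xs. f s x) = (\<Sum>x\<leftarrow>xs. \<Sum>s\<in>A. f s x :: real)"
  by (induction xs) (auto simp: sum.distrib)

lemma sum_list_all_zero: "(\<And>x. x \<in> set xs \<Longrightarrow> f x = 0) \<Longrightarrow> (\<Sum>x\<leftarrow>xs. f x) = (0 :: real)"
  by (induction xs) auto

lemma splits_singleton_left:
  "(\<Sum>(a, b)\<leftarrow>splits xs. (case a of [x] \<Rightarrow> w x | _ \<Rightarrow> 0) * G b) = (\<Sum>(y, ys)\<leftarrow>picks xs. w y * G ys :: real)"
proof (induction xs arbitrary: G)
  case (Cons x xs)
  have "(\<Sum>(a, b)\<leftarrow>splits xs. (case x # a of [x] \<Rightarrow> w x | _ \<Rightarrow> 0) * G b)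
      = (\<Sum>(a, b)\<leftarrow>splits xs. if a = [] then w x * G b else 0)"
    by (intro arg_cong[where f = sum_list] map_cong) (auto split: list.splits)
  also have "\<dots> = w x * G xs" by (rule splits_Nil_left)
  finally show ?case using Cons[of "\<lambda>b. G (x # b)"] by (simp add: o_def case_prod_unfold)
qed simp

lemma splits_length: "(a, b) \<in> set (splits xs) \<Longrightarrow> length a + length b = length xs"
  by (induction xs arbitrary: a b) fastforce+

text \<open>Symbol at frequency l of the operator \<Sum> Q_s \<partial>_x^s, with its coefficients
  differentiated along zs at the constant loop.\<close>

definition bracket_symbol :: "nat \<Rightarrow> real^'n::finite \<Rightarrow> nat \<Rightarrow> (nat \<Rightarrow> 'n \<Rightarrow> 'n \<Rightarrow> 'n jet_series) \<Rightarrow>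
    ('n \<times> real) list \<Rightarrow> real \<Rightarrow> 'n \<Rightarrow> 'n \<Rightarrow> real" where
  "bracket_symbol N u k Q zs l i j = (\<Sum>s\<le>k. l ^ s * polar N u zs (Q s i j))"

text \<open>A constant rather than an abbreviation, so that its values, already simplified by the
  relation between the frequencies, can be supplied as rewrite rules in
  \<open>double_symbol_three\<close> and \<open>double_symbol_four\<close>.\<close>

definition neg_weight :: "('a \<times> real) list \<Rightarrow> real" where
  "neg_weight xs = - weight xs"

context
  fixes U :: "(real^'n::finite) set" and u :: "real^'n"
  assumes U: "open U" and u: "u \<in> U"
begin

lemma polar_one: "polar N u xs 1 = (if xs = [] then 1 else 0)"
proof (cases xs)
  case Nil
  then show ?thesis by (simp add: jcoeff_one)
next
  case (Cons x ys)
  have "jcoeff (1 :: 'n jet_series) m = (\<lambda>u. if m = {#} then 1 else 0)" for m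
    by (rule ext) (simp add: jcoeff_one)
  then have "jcoeff (jet_partial i s 1) m v = 0" for i :: 'n and s m v
    by (cases "s = 0") (simp_all add: jcoeff_jet_partial_pos)
  then have "eq_over U (jet_dir N x 1) 0" by (simp add: eq_over_def jet_dir_def)
  then show ?thesis using Cons polar_cong[OF U u] polar_zero[OF U u] by simp
qed

lemma jets_on_one: "1 \<in> jets_on U {0}"
proof -
  have "jcoeff (1 :: 'n jet_series) m = (\<lambda>u. if m = {#} then 1 else 0)" for m
    by (rule ext) (simp add: jcoeff_one)
  then show ?thesis by (auto simp: jets_on_def smooth_const[OF U])
qed

lemma jets_on_coordinate: "coord_fun (\<lambda>v. v $ j - u $ j) \<in> jets_on U {0}"
  by (auto simp: jets_on_def coord_fun_def intro!: smooth_diff smooth_component smooth_const U)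

lemma polar_coordinate:
  "polar N u xs (coord_fun (\<lambda>v. v $ j - u $ j)) = (case xs of [x] \<Rightarrow> if fst x = j then 1 else 0 | _ \<Rightarrow> 0)"
proof (cases xs)
  case (Cons x ys)
  let ?c = "if fst x = j then 1 else 0 :: real"
  have p: "partial i (\<lambda>v. v $ j - u $ j) v = (if i = j then 1 else 0)" for i :: 'n and v
    by (subst partial_diff) (auto simp: partial_component intro: bounded_linear_imp_differentiable bounded_linear_vec_nth)
  have jp: "jcoeff (jet_partial i s (coord_fun (\<lambda>v. v $ j - u $ j))) m v
      = (if s = 0 \<and> m = {#} \<and> i = j then 1 else 0)" for i s m v
    using p by (cases "s = 0") (auto simp: jcoeff_jet_partial_pos coord_fun_def)
  have "jcoeff (jet_dir N x (coord_fun (\<lambda>v. v $ j - u $ j))) m v = jcoeff (jscale ?c 1) m v" for m v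
  proof -
    have "jcoeff (jet_dir N x (coord_fun (\<lambda>v. v $ j - u $ j))) m v
        = (\<Sum>s\<le>N. if s = 0 then (if m = {#} \<and> fst x = j then 1 else 0) else 0)"
      unfolding jet_dir_def jcoeff_sum jcoeff_jscale jp by (intro sum.cong) auto
    then show ?thesis by (simp add: jcoeff_one)
  qed
  then have "eq_over U (jet_dir N x (coord_fun (\<lambda>v. v $ j - u $ j))) (jscale ?c 1)"
    by (simp add: eq_over_def)
  then have "polar N u xs (coord_fun (\<lambda>v. v $ j - u $ j)) = polar N u ys (jscale ?c 1)"
    using Cons polar_cong[OF U u] by simp
  also have "\<dots> = ?c * polar N u ys 1"
    by (rule polar_jscale[OF U u jets_on_mono[OF jets_on_one]]) simp
  finally show ?thesis using Cons by (auto simp: polar_one split: list.splits)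
qed (simp add: coord_fun_def)

lemma jets_on_even_symbol: "even_symbol j p \<in> jets_on U {..2 * degree p}"
  by (auto simp: jets_on_def even_symbol_def smooth_const[OF U] intro!: sum.neutral)

lemma poly_even:
  fixes p :: "real poly"
  assumes "coeff p 0 = 0"
  shows "poly p (l\<^sup>2) = (\<Sum>n\<in>{1..degree p}. coeff p n * l ^ (2 * n))"
proof -
  have "poly p (l\<^sup>2) = (\<Sum>n\<le>degree p. coeff p n * l ^ (2 * n))"
    by (simp add: poly_altdef power_mult)
  also have "\<dots> = (\<Sum>n\<in>{1..degree p}. coeff p n * l ^ (2 * n))"
    using assms by (intro sum.mono_neutral_right) (auto simp: not_less_eq_eq)
  finally show ?thesis .
qed

lemma polar_even_symbol:
  assumes p: "coeff p 0 = 0" and N: "2 * degree p \<le> N"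
  shows "polar N u xs (even_symbol j p) = (case xs of [x] \<Rightarrow> if fst x = j then poly p ((snd x)\<^sup>2) else 0 | _ \<Rightarrow> 0)"
proof (cases xs)
  case (Cons x ys)
  let ?c = "if fst x = j then poly p ((snd x)\<^sup>2) else 0"
  have V: "jcoeff (even_symbol j p) m = (\<lambda>v. \<Sum>n\<in>{1..degree p}. if m = {#(j, 2 * n)#} then coeff p n else 0)" for m
    by (simp add: even_symbol_def)
  have jp: "jcoeff (jet_partial i s (even_symbol j p)) m v
      = (\<Sum>n\<in>{1..degree p}. if m = {#} \<and> i = j \<and> s = 2 * n then coeff p n else 0)" for i s m v
  proof (cases "s = 0")
    case False
    then show ?thesis by (cases "m = {#} \<and> i = j") (auto simp: jcoeff_jet_partial_pos V)
  qed (auto simp: V intro!: sum.neutral)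
  have "jcoeff (jet_dir N x (even_symbol j p)) m v = jcoeff (jscale ?c 1) m v" for m v
  proof -
    have "jcoeff (jet_dir N x (even_symbol j p)) m v
        = (\<Sum>s\<le>N. \<Sum>n\<in>{1..degree p}. if s = 2 * n then (if m = {#} \<and> fst x = j then snd x ^ s * coeff p n else 0) else 0)"
      unfolding jet_dir_def by (auto simp: jp sum_distrib_left intro!: sum.cong)
    also have "\<dots> = (\<Sum>n\<in>{1..degree p}. \<Sum>s\<le>N. if s = 2 * n then (if m = {#} \<and> fst x = j then snd x ^ s * coeff p n else 0) else 0)"
      by (rule sum.swap)
    also have "\<dots> = (\<Sum>n\<in>{1..degree p}. if m = {#} \<and> fst x = j then snd x ^ (2 * n) * coeff p n else 0)"
      using N by (intro sum.cong refl) (auto simp: sum.delta)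
    also have "\<dots> = jcoeff (jscale ?c 1) m v"
      by (auto simp: poly_even[OF p] jcoeff_one mult.commute)
    finally show ?thesis .
  qed
  then have "eq_over U (jet_dir N x (even_symbol j p)) (jscale ?c 1)" by (simp add: eq_over_def)
  then have "polar N u xs (even_symbol j p) = polar N u ys (jscale ?c 1)"
    using Cons polar_cong[OF U u] by simp
  also have "\<dots> = ?c * polar N u ys 1"
    by (rule polar_jscale[OF U u jets_on_mono[OF jets_on_one]]) simp
  finally show ?thesis using Cons by (auto simp: polar_one split: list.splits)
qed (simp add: even_symbol_def)

lemma jets_on_test_density: "test_density u j p \<in> jets_on U {..2 * degree p}"
  unfolding test_density_def by (rule jets_on_mult[OF U jets_on_coordinate jets_on_even_symbol]) auto

lemma test_density_diff_poly: "test_density u j p \<in> diff_poly U"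
  using jets_onD(1)[OF jets_on_test_density]
  by (auto simp: diff_poly_def test_density_def coord_fun_times even_symbol_def intro!: sum.neutral)

text \<open>The density is quadratic at u, so exactly two directions are absorbed, and one of them
  is the closing direction of \<open>polar_var_deriv\<close>. The two ways of distributing
  frequencies l and -l give p(l^2) each, by evenness.\<close>

lemma polar_test_density:
  assumes p: "coeff p 0 = 0" and N: "2 * degree p < N"
  shows "polar N u xs (var_deriv i (test_density u j p)) =
    response j (even_response p) i xs"
proof -
  let ?c = "coord_fun (\<lambda>v. v $ j - u $ j)" and ?V = "even_symbol j p"
  have m: "polar N u ys (test_density u j p) = (\<Sum>(a, b)\<leftarrow>splits ys. polar N u a ?c * polar N u b ?V)" for ys
    unfolding test_density_def
    by (rule polar_mult[OF U u]) (auto intro: jets_on_mono[OF jets_on_coordinate] jets_on_mono[OF jets_on_even_symbol])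
  note V = polar_even_symbol[OF p less_imp_le[OF N]]
  have 3: "polar N u ys (test_density u j p) = 0" if "length ys \<ge> 3" for ys
  proof -
    have "polar N u a ?c * polar N u b ?V = 0" if "(a, b) \<in> set (splits ys)" for a b
    proof -
      have "length a \<noteq> 1 \<or> length b \<noteq> 1" using splits_length[OF that] \<open>length ys \<ge> 3\<close> by auto
      then show ?thesis by (auto simp: polar_coordinate V split: list.splits)
    qed
    then show ?thesis unfolding m by (intro sum_list_all_zero) auto
  qed
  have "polar N u xs (var_deriv i (test_density u j p)) = polar N u ((i, - weight xs) # xs) (test_density u j p)"
    by (rule polar_var_deriv[OF U u jets_on_test_density N])
  also have "\<dots> = response j (even_response p) i xs"
  proof (cases xs)
    case Nil
    then show ?thesis by (simp add: m polar_coordinate V del: polar.simps)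
  next
    case (Cons x ys)
    then show ?thesis
    proof (cases ys)
      case Nil
      then show ?thesis using Cons by (simp add: m polar_coordinate V del: polar.simps)
    next
      case (Cons y zs)
      then show ?thesis using 3[of "(i, - weight xs) # xs"] \<open>xs = x # ys\<close> by (simp del: polar.simps)
    qed
  qed
  finally show ?thesis .
qed

section \<open>Polarization of single and double brackets of densities\<close>

context
  fixes k :: nat and Q :: "nat \<Rightarrow> 'n \<Rightarrow> 'n \<Rightarrow> 'n jet_series"
  assumes Q: "\<And>s i j. s \<le> k \<Longrightarrow> Q s i j \<in> jets_on U {k - s}"
begin

lemma jets_on_bracket_summand:
  assumes G: "G \<in> jets_on U {..d}"
  shows "(\<Sum>s\<le>k. Q s i j * (Dx ^^ s) (var_deriv j G)) \<in> jets_on U {..d + k}"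
proof (rule jets_on_sum[OF U])
  fix s assume "s \<in> {..k}"
  then show "Q s i j * (Dx ^^ s) (var_deriv j G) \<in> jets_on U {..d + k}"
    by (intro jets_on_mult[OF U Q jets_on_Dx_pow[OF U jets_on_var_deriv[OF U u G]]]) auto
qed

lemma jets_on_functional_bracket:
  assumes F: "F \<in> jets_on U {..d}" and G: "G \<in> jets_on U {..e}"
  shows "functional_bracket k Q F G \<in> jets_on U {..d + e + k}"
  unfolding functional_bracket_def
  by (intro jets_on_sum[OF U] jets_on_mult[OF U jets_on_var_deriv[OF U u F] jets_on_bracket_summand[OF G]]) auto

lemma polar_bracket_summand:
  assumes G: "G \<in> jets_on U {..d}" and N: "d + k \<le> N"
    and pG: "\<And>xs i. polar N u xs (var_deriv i G) = response j w i xs"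
  shows "polar N u xs (\<Sum>s\<le>k. Q s i j' * (Dx ^^ s) (var_deriv j' G)) =
    (\<Sum>(y, ys)\<leftarrow>picks xs. (if j' = j \<and> fst y = j then w (snd y) else 0) * bracket_symbol N u k Q ys (snd y) i j')"
proof -
  have D: "polar N u zs ((Dx ^^ s) (var_deriv j' G))
      = (case zs of [y] \<Rightarrow> (snd y) ^ s * (if j' = j \<and> fst y = j then w (snd y) else 0) | _ \<Rightarrow> 0)" if "s \<le> k" for s zs
    using polar_Dx_pow[OF U u jets_on_var_deriv[OF U u G], of s N zs j'] that N
    by (auto simp: pG split: list.splits)
  have jD: "(Dx ^^ s) (var_deriv j' G) \<in> jets_on U UNIV" for s
    by (rule jets_on_UNIV[OF U jets_on_Dx_pow[OF U jets_on_var_deriv[OF U u G]]])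
  have jQ: "Q s i j' \<in> jets_on U UNIV" if "s \<le> k" for s
    by (rule jets_on_UNIV[OF U Q[OF that]])
  have "polar N u xs (\<Sum>s\<le>k. Q s i j' * (Dx ^^ s) (var_deriv j' G))
      = (\<Sum>s\<le>k. polar N u xs ((Dx ^^ s) (var_deriv j' G) * Q s i j'))"
    using jD jQ by (subst polar_sum[OF U u]) (auto intro!: jets_on_mult[OF U, of _ UNIV _ UNIV] simp: mult.commute)
  also have "\<dots> = (\<Sum>s\<le>k. \<Sum>(y, ys)\<leftarrow>picks xs.
      (snd y ^ s * (if j' = j \<and> fst y = j then w (snd y) else 0)) * polar N u ys (Q s i j'))"
  proof (rule sum.cong[OF refl])
    fix s assume "s \<in> {..k}"
    then have s: "s \<le> k" by simp
    show "polar N u xs ((Dx ^^ s) (var_deriv j' G) * Q s i j') = (\<Sum>(y, ys)\<leftarrow>picks xs.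
      (snd y ^ s * (if j' = j \<and> fst y = j then w (snd y) else 0)) * polar N u ys (Q s i j'))"
      unfolding polar_mult[OF U u jD jQ[OF s]] D[OF s] by (rule splits_singleton_left)
  qed
  also have "\<dots> = (\<Sum>(y, ys)\<leftarrow>picks xs. \<Sum>s\<le>k.
      (snd y ^ s * (if j' = j \<and> fst y = j then w (snd y) else 0)) * polar N u ys (Q s i j'))"
    unfolding case_prod_unfold by (rule sum_sum_list)
  also have "\<dots> = (\<Sum>(y, ys)\<leftarrow>picks xs. (if j' = j \<and> fst y = j then w (snd y) else 0) * bracket_symbol N u k Q ys (snd y) i j')"
    by (simp add: bracket_symbol_def sum_distrib_left mult.assoc mult.left_commute)
  finally show ?thesis .
qed

lemma polar_functional_bracket:
  assumes F: "F \<in> jets_on U {..d}" and G: "G \<in> jets_on U {..e}" and N: "e + k \<le> N"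
    and pF: "\<And>xs p. polar N u xs (var_deriv p F) = response i v p xs"
    and pG: "\<And>xs p. polar N u xs (var_deriv p G) = response j w p xs"
  shows "polar N u xs (functional_bracket k Q F G) =
    pick_pair (bracket_symbol N u k Q) i v j w xs"
proof -
  let ?Y = "\<lambda>p q. \<Sum>s\<le>k. Q s p q * (Dx ^^ s) (var_deriv q G)"
  let ?R = "\<lambda>p q xs. \<Sum>(y, ys)\<leftarrow>picks xs. (if q = j \<and> fst y = j then w (snd y) else 0) * bracket_symbol N u k Q ys (snd y) p q"
  have jF: "var_deriv p F \<in> jets_on U UNIV" for p
    by (rule jets_on_UNIV[OF U jets_on_var_deriv[OF U u F]])
  have jY: "?Y p q \<in> jets_on U UNIV" for p q
    by (rule jets_on_UNIV[OF U jets_on_bracket_summand[OF G]])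
  have 1: "polar N u xs (var_deriv p F * ?Y p q) =
      (\<Sum>(x, ys)\<leftarrow>picks xs. (if p = i \<and> fst x = i then v (snd x) else 0) * ?R p q ys)" for p q
    unfolding polar_mult[OF U u jF jY] pF polar_bracket_summand[OF G N pG] by (rule splits_singleton_left)
  have j2: "var_deriv p F * ?Y p q \<in> jets_on U UNIV" for p q
    by (rule jets_on_mult[OF U jF jY]) auto
  have "polar N u xs (functional_bracket k Q F G) = (\<Sum>p\<in>UNIV. \<Sum>q\<in>UNIV.
      (\<Sum>(x, ys)\<leftarrow>picks xs. (if p = i \<and> fst x = i then v (snd x) else 0) * ?R p q ys))"
    unfolding functional_bracket_def using j2
    by (simp add: polar_sum[OF U u] jets_on_sum[OF U] 1)
  also have "\<dots> = (\<Sum>p\<in>UNIV. \<Sum>q\<in>UNIV. if p = i then if q = j then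
      (\<Sum>(x, ys)\<leftarrow>picks xs. (if i = i \<and> fst x = i then v (snd x) else 0) * ?R i j ys) else 0 else 0)"
  proof (intro sum.cong refl)
    fix p q
    show "(\<Sum>(x, ys)\<leftarrow>picks xs. (if p = i \<and> fst x = i then v (snd x) else 0) * ?R p q ys)
      = (if p = i then if q = j then
      (\<Sum>(x, ys)\<leftarrow>picks xs. (if i = i \<and> fst x = i then v (snd x) else 0) * ?R i j ys) else 0 else 0)"
      by (cases "p = i"; cases "q = j") (simp_all add: case_prod_unfold)
  qed
  also note sum_delta_delta
  finally show ?thesis by simp
qed

text \<open>The variational derivative of the inner bracket is again evaluated by adding a closing
  direction to the directions a allotted to it, so no product rule for \<open>var_deriv\<close>
  enters; the second variations of the densities are hidden in the polarization of B.\<close>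

lemma polar_double_bracket:
  assumes B: "B \<in> jets_on U {..d}" and H: "H \<in> jets_on U {..e}" and N: "d < N" "e + k \<le> N"
    and pH: "\<And>xs p. polar N u xs (var_deriv p H) = response m w p xs"
  shows "polar N u xs (functional_bracket k Q B H) = (\<Sum>p\<in>UNIV. \<Sum>(a, b)\<leftarrow>splits xs.
    polar N u ((p, neg_weight a) # a) B *
    pick_one (bracket_symbol N u k Q) m w p m b)"
proof -
  let ?Y = "\<lambda>p q. \<Sum>s\<le>k. Q s p q * (Dx ^^ s) (var_deriv q H)"
  let ?R = "\<lambda>p q xs. \<Sum>(y, ys)\<leftarrow>picks xs. (if q = m \<and> fst y = m then w (snd y) else 0) * bracket_symbol N u k Q ys (snd y) p q"
  have jF: "var_deriv p B \<in> jets_on U UNIV" for p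
    by (rule jets_on_UNIV[OF U jets_on_var_deriv[OF U u B]])
  have jY: "?Y p q \<in> jets_on U UNIV" for p q
    by (rule jets_on_UNIV[OF U jets_on_bracket_summand[OF H]])
  have 1: "polar N u xs (var_deriv p B * ?Y p q) =
      (\<Sum>(a, b)\<leftarrow>splits xs. polar N u ((p, neg_weight a) # a) B * ?R p q b)" for p q
    unfolding polar_mult[OF U u jF jY] polar_bracket_summand[OF H N(2) pH] polar_var_deriv[OF U u B N(1)]
      neg_weight_def ..
  have j2: "var_deriv p B * ?Y p q \<in> jets_on U UNIV" for p q
    by (rule jets_on_mult[OF U jF jY]) auto
  have "polar N u xs (functional_bracket k Q B H) = (\<Sum>p\<in>UNIV. \<Sum>q\<in>UNIV.
      (\<Sum>(a, b)\<leftarrow>splits xs. polar N u ((p, neg_weight a) # a) B * ?R p q b))"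
    unfolding functional_bracket_def using j2
    by (simp add: polar_sum[OF U u] jets_on_sum[OF U] 1 del: polar.simps)
  also have "\<dots> = (\<Sum>p\<in>UNIV. \<Sum>q\<in>UNIV. if q = m then
      (\<Sum>(a, b)\<leftarrow>splits xs. polar N u ((p, neg_weight a) # a) B * ?R p q b) else 0)"
    by (intro sum.cong refl) (simp add: case_prod_unfold del: polar.simps)
  finally show ?thesis by (simp add: sum.delta del: polar.simps)
qed

end

end

section \<open>Polynomial identities equivalent to the Poisson property\<close>

text \<open>In the notation of the informal statement, \<open>lin_symb k Q r p i j\<close> is \<open>h\<^sub>(\<^sub>r\<^sub>)\<^sub>p\<^sup>i\<^sup>j\<close> for \<open>r < k\<close> and
  \<open>\<partial>\<^sub>p g\<^sup>i\<^sup>j\<close> for \<open>r = k\<close>.\<close>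

definition lin_symb :: "nat \<Rightarrow> (nat \<Rightarrow> 'n \<Rightarrow> 'n \<Rightarrow> 'n jet_series) \<Rightarrow> nat \<Rightarrow> 'n::finite \<Rightarrow> 'n \<Rightarrow> 'n \<Rightarrow> real^'n \<Rightarrow> real" where
  "lin_symb k Q r p i j u = jcoeff (jet_partial p (k - r) (Q r i j)) {#} u"

definition quad_symb :: "nat \<Rightarrow> (nat \<Rightarrow> 'n \<Rightarrow> 'n \<Rightarrow> 'n jet_series) \<Rightarrow> nat \<Rightarrow> nat \<Rightarrow> 'n::finite \<Rightarrow> 'n \<Rightarrow> 'n \<Rightarrow> 'n \<Rightarrow> real^'n \<Rightarrow> real" where
  "quad_symb k Q r t p q i j u = jcoeff (jet_partial q (k - r - t) (jet_partial p t (Q r i j))) {#} u"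

text \<open>Here a is the frequency of the covector the operator acts on, and b that of the loop
  variation in component p. In \<open>quad_form\<close> the variations in p and q have frequencies b
  and c.\<close>

definition lin_form :: "nat \<Rightarrow> (nat \<Rightarrow> 'n \<Rightarrow> 'n \<Rightarrow> 'n jet_series) \<Rightarrow> real^'n \<Rightarrow> 'n::finite \<Rightarrow> 'n \<Rightarrow> 'n \<Rightarrow> real \<Rightarrow> real \<Rightarrow> real" where
  "lin_form k Q u p i j a b = (\<Sum>r\<le>k. lin_symb k Q r p i j u * (a ^ r * b ^ (k - r)))"

definition quad_form :: "nat \<Rightarrow> (nat \<Rightarrow> 'n \<Rightarrow> 'n \<Rightarrow> 'n jet_series) \<Rightarrow> real^'n \<Rightarrow> 'n::finite \<Rightarrow> 'n \<Rightarrow> 'n \<Rightarrow> 'n \<Rightarrow>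
    real \<Rightarrow> real \<Rightarrow> real \<Rightarrow> real" where
  "quad_form k Q u p q i j a b c =
    (\<Sum>r\<le>k. \<Sum>t\<le>k - r. quad_symb k Q r t p q i j u * (a ^ r * (b ^ t * c ^ (k - r - t))))"

definition double_symbol :: "(('n \<times> real) list \<Rightarrow> real \<Rightarrow> 'n \<Rightarrow> 'n \<Rightarrow> real) \<Rightarrow> ('n \<times> real) list \<Rightarrow>
    'n::finite \<Rightarrow> (real \<Rightarrow> real) \<Rightarrow> 'n \<Rightarrow> (real \<Rightarrow> real) \<Rightarrow> 'n \<Rightarrow> (real \<Rightarrow> real) \<Rightarrow> real" where
  "double_symbol K xs i v j w m z = (\<Sum>p\<in>UNIV. \<Sum>(a, b)\<leftarrow>splits xs.
    pick_pair K i v j w ((p, neg_weight a) # a) * pick_one K m z p m b)"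

definition selects :: "(real \<Rightarrow> real) \<Rightarrow> real \<Rightarrow> real set \<Rightarrow> bool" where
  "selects v l Z \<longleftrightarrow> (\<forall>x. v (- x) = v x) \<and> v 0 = 0 \<and> v l = 1 \<and> (\<forall>z\<in>Z. v z = 0)"

text \<open>Only the split giving (i, la) and (j, lb) to the inner bracket survives. If it received
  (i, la) alone, v could accept the closing direction of frequency -la, which would be a second
  variation of the first density, but w would then have to accept la. The three orders of xs let one
  fixed list serve all cyclic permutations of the indices.\<close>

lemma double_symbol_three:
  assumes s: "la + lb + lc = 0"
    and v: "selects v la {lb, lc}" and w: "selects w lb {la, lc}" and z: "selects z lc {la, lb}"
    and xs: "xs \<in> {[(i, la), (j, lb), (m, lc)], [(m, lc), (i, la), (j, lb)], [(j, lb), (m, lc), (i, la)]}"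
  shows "double_symbol K xs i v j w m z = (\<Sum>p\<in>UNIV. K [(p, lc)] lb i j * K [] lc p m)"
proof -
  have nw: "neg_weight [] = 0" "neg_weight [(i, la)] = - la" "neg_weight [(j, lb)] = - lb"
    "neg_weight [(i, la), (j, lb)] = lc" "neg_weight [(j, lb), (i, la)] = lc"
    using s by (auto simp: neg_weight_def)
  have vv: "v 0 = 0" "v la = 1" "v (- la) = 1" "v lb = 0" "v (- lb) = 0" "v lc = 0"
    and ww: "w 0 = 0" "w lb = 1" "w (- lb) = 1" "w la = 0" "w (- la) = 0" "w lc = 0"
    and zz: "z lc = 1" "z la = 0" "z lb = 0"
    using v w z by (auto simp: selects_def)
  from xs show ?thesis
    unfolding double_symbol_def
    by (elim insertE emptyE; hypsubst; intro sum.cong refl) (simp_all add: nw vv ww zz cong: if_cong split del: if_split)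
qed

text \<open>The spare direction d falls on the coefficients of the outer or of the inner bracket,
  which gives the two summands. Closing directions now carry sums of two frequencies as well, so v
  and w must also vanish there.\<close>

lemma double_symbol_four:
  assumes s: "la + lb + lc + ld = 0"
    and v: "selects v la {lb, lc, ld, la + lb, la + ld, lb + ld}"
    and w: "selects w lb {la, lc, ld, la + lb, la + ld, lb + ld}" and z: "selects z lc {la, lb, ld}"
    and xs: "xs \<in> {[(i, la), (j, lb), (m, lc), d], [(m, lc), (i, la), (j, lb), d], [(j, lb), (m, lc), (i, la), d]}"
    and d: "d = (q, ld)"
  shows "double_symbol K xs i v j w m z =
    (\<Sum>p\<in>UNIV. K [(p, - la - lb)] lb i j * K [d] lc p m + K [(p, lc), d] lb i j * K [] lc p m)"
proof -
  have nw: "neg_weight [] = 0" "neg_weight [(i, la)] = - la" "neg_weight [(j, lb)] = - lb" "neg_weight [d] = - ld"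
    "neg_weight [(i, la), (j, lb)] = - la - lb" "neg_weight [(j, lb), (i, la)] = - la - lb"
    "neg_weight [(i, la), d] = - la - ld" "neg_weight [(j, lb), d] = - lb - ld"
    "neg_weight [(i, la), (j, lb), d] = lc" "neg_weight [(j, lb), (i, la), d] = lc"
    using s by (auto simp: neg_weight_def d)
  have e: "v (- x - y) = v (x + y)" "w (- x - y) = w (x + y)" for x y
    using v w unfolding selects_def by (metis minus_add_distrib uminus_add_conv_diff diff_conv_add_uminus)+
  have vv: "v 0 = 0" "v la = 1" "v (- la) = 1" "v lb = 0" "v (- lb) = 0" "v lc = 0" "v ld = 0" "v (- ld) = 0"
      "v (- la - lb) = 0" "v (- la - ld) = 0" "v (- lb - ld) = 0" "v (snd d) = 0"
    and ww: "w 0 = 0" "w lb = 1" "w (- lb) = 1" "w la = 0" "w (- la) = 0" "w lc = 0" "w ld = 0" "w (- ld) = 0"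
      "w (- la - lb) = 0" "w (- la - ld) = 0" "w (- lb - ld) = 0" "w (snd d) = 0"
    and zz: "z lc = 1" "z la = 0" "z lb = 0" "z (snd d) = 0"
    unfolding e using v w z by (auto simp: selects_def d)
  from xs show ?thesis
    unfolding double_symbol_def
    by (elim insertE emptyE; hypsubst; intro sum.cong refl) (simp_all add: nw vv ww zz cong: if_cong split del: if_split)
qed

section \<open>Removal of the genericity assumptions on the frequencies\<close>

lemma eventually_quadratic_neq:
  fixes a b c d :: real
  assumes "b\<^sup>2 \<noteq> d\<^sup>2"
  shows "\<forall>\<^sub>F t in at 0. (a + t * b)\<^sup>2 \<noteq> (c + t * d)\<^sup>2"
proof -
  have bd: "b - d \<noteq> 0" "b + d \<noteq> 0" using assms by (auto simp: power2_eq_iff eq_neg_iff_add_eq_0)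
  let ?B = "{(c - a) / (b - d), - (a + c) / (b + d)}"
  have "t \<in> ?B" if "(a + t * b)\<^sup>2 = (c + t * d)\<^sup>2" for t
    using that bd by (auto simp: power2_eq_iff field_simps)
  moreover have "\<forall>\<^sub>F t in at 0. t \<notin> ?B"
    by (simp add: eventually_conj_iff eventually_neq_at_within)
  ultimately show ?thesis by (auto elim!: eventually_mono)
qed

lemma eventually_affine_square_neq_0:
  fixes a b :: real
  assumes "b \<noteq> 0"
  shows "\<forall>\<^sub>F t in at 0. (a + t * b)\<^sup>2 \<noteq> 0"
  using eventually_quadratic_neq[of b 0 a 0] assms by simp

lemma zero_by_continuity:
  fixes f :: "real \<Rightarrow> real"
  assumes "isCont f 0" "\<forall>\<^sub>F t in at 0. f t = 0"
  shows "f 0 = 0"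
proof (rule tendsto_unique[OF _ isContD[OF assms(1)]])
  show "(f \<longlongrightarrow> 0) (at 0)"
    using assms(2) by (rule tendsto_eventually)
qed simp

text \<open>The conditions concern squares because the selectors are even and do not distinguish a
  frequency from its negative.\<close>

definition generic3 :: "real \<Rightarrow> real \<Rightarrow> real \<Rightarrow> bool" where
  "generic3 a b c \<longleftrightarrow> a\<^sup>2 \<noteq> 0 \<and> b\<^sup>2 \<noteq> 0 \<and> c\<^sup>2 \<noteq> 0 \<and> a\<^sup>2 \<noteq> b\<^sup>2 \<and> a\<^sup>2 \<noteq> c\<^sup>2 \<and> b\<^sup>2 \<noteq> c\<^sup>2"

definition generic4 :: "real \<Rightarrow> real \<Rightarrow> real \<Rightarrow> real \<Rightarrow> bool" where
  "generic4 a b c d \<longleftrightarrow> generic3 a b c \<and> (\<forall>z\<in>{d, a + b, a + c, b + c}. z\<^sup>2 \<noteq> a\<^sup>2 \<and> z\<^sup>2 \<noteq> b\<^sup>2 \<and> z\<^sup>2 \<noteq> c\<^sup>2)"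

text \<open>The frequencies are moved along the direction (1, 3, -4), whose entries have distinct
  nonzero squares. Each forbidden coincidence then excludes at most two parameters, and continuity
  recovers the parameter 0.\<close>

lemma zero_by_genericity3:
  assumes "\<And>a b. generic3 a b (- a - b) \<Longrightarrow> f a b = (0 :: real)"
    and "isCont (\<lambda>t. f (a + t * 1) (b + t * 3)) 0"
  shows "f a b = 0"
proof -
  have "\<forall>\<^sub>F t in at 0. generic3 (a + t * 1) (b + t * 3) (- (a + t * 1) - (b + t * 3))"
  proof -
    have c: "- (a + t * 1) - (b + t * 3) = (- a - b) + t * (- 4)" for t by simp
    show ?thesis unfolding generic3_def c
      by (intro eventually_conj eventually_affine_square_neq_0 eventually_quadratic_neq) auto
  qed
  then have "\<forall>\<^sub>F t in at 0. f (a + t * 1) (b + t * 3) = 0"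
    by (rule eventually_mono) (rule assms(1))
  from zero_by_continuity[OF assms(2) this] show ?thesis by simp
qed

text \<open>The direction is (1, 3, 9, -13), with pair sums 4, 10 and 12; none of these or -13
  agrees in absolute value with 1, 3 or 9.\<close>

lemma zero_by_genericity4:
  assumes "\<And>a b c. generic4 a b c (- a - b - c) \<Longrightarrow> f a b c = (0 :: real)"
    and "isCont (\<lambda>t. f (a + t * 1) (b + t * 3) (c + t * 9)) 0"
  shows "f a b c = 0"
proof -
  let ?a = "\<lambda>t. a + t * 1" and ?b = "\<lambda>t. b + t * 3" and ?c = "\<lambda>t. c + t * 9"
  have "\<forall>\<^sub>F t in at 0. generic4 (?a t) (?b t) (?c t) (- ?a t - ?b t - ?c t)"
  proof -
    have d: "- ?a t - ?b t - ?c t = (- a - b - c) + t * (- 13)"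
      "?a t + ?b t = (a + b) + t * 4" "?a t + ?c t = (a + c) + t * 10" "?b t + ?c t = (b + c) + t * 12" for t
      by simp_all
    show ?thesis unfolding generic4_def generic3_def ball_simps d
      by (intro eventually_conj eventually_affine_square_neq_0 eventually_quadratic_neq) auto
  qed
  then have "\<forall>\<^sub>F t in at 0. f (?a t) (?b t) (?c t) = 0"
    by (rule eventually_mono) (rule assms(1))
  from zero_by_continuity[OF assms(2) this] show ?thesis by simp
qed

lemma frequency_selector_symbol:
  assumes "finite Z" "l\<^sup>2 \<noteq> 0" "\<And>z. z \<in> Z \<Longrightarrow> z\<^sup>2 \<noteq> l\<^sup>2"
  obtains p :: "real poly" where "coeff p 0 = 0" "selects (even_response p) l Z"
proof -
  obtain p :: "real poly" where p: "coeff p 0 = 0" "2 * poly p (l\<^sup>2) = 1" "\<And>z. z \<in> Z \<Longrightarrow> poly p (z\<^sup>2) = 0"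
    using frequency_selector[of Z l] assms by auto
  have "poly p 0 = 0" using p(1) by (simp add: poly_0_coeff_0)
  with p show thesis by (intro that[of p]) (auto simp: selects_def)
qed

section \<open>Skew-symmetry and the Jacobi identity as identities between symbols\<close>

context
  fixes U :: "(real^'n::finite) set" and k :: nat and Q :: "nat \<Rightarrow> 'n \<Rightarrow> 'n \<Rightarrow> 'n jet_series" and u :: "real^'n"
  assumes U: "open U" and u: "u \<in> U"
    and Q: "\<And>s i j. s \<le> k \<Longrightarrow> Q s i j \<in> jets_on U {k - s}"
    and P: "poisson_over U k Q"
begin

lemma polar_single:
  assumes f: "f \<in> jets_on U {d}" and d: "d \<le> N"
  shows "polar N u [(p, l)] f = l ^ d * jcoeff (jet_partial p d f) {#} u"
proof -
  have "jcoeff (jet_partial p s f) {#} u = 0" if "s \<noteq> d" for s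
  proof -
    have "jet_partial p s f \<in> jets_on U {e. e + s = d}"
      by (rule jets_on_jet_partial[OF U f]) auto
    then show ?thesis using jets_onD(2) u that by fastforce
  qed
  then have "(\<Sum>s\<le>N. l ^ s * jcoeff (jet_partial p s f) {#} u)
      = (\<Sum>s\<in>{d}. l ^ s * jcoeff (jet_partial p s f) {#} u)"
    using d by (intro sum.mono_neutral_right) auto
  then show ?thesis
    using polar_jet_dir_sum[OF U u jets_on_UNIV[OF U f], of N p l "[]"] by simp
qed

lemma polar_pair:
  assumes f: "f \<in> jets_on U {d}" and d: "d \<le> N"
  shows "polar N u [(p, l), (q, m)] f
    = (\<Sum>t\<le>d. l ^ t * (m ^ (d - t) * jcoeff (jet_partial q (d - t) (jet_partial p t f)) {#} u))"
proof -
  have 0: "polar N u [(q, m)] (jet_partial p s f) = 0" if "s \<notin> {..d}" for s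
  proof -
    have "jet_partial p s f \<in> jets_on U {}"
      by (rule jets_on_jet_partial[OF U f]) (use that in auto)
    then have "eq_over U (jet_partial p s f) 0"
      using jets_onD(2) by (fastforce simp: eq_over_def)
    then show ?thesis using polar_cong[OF U u] polar_zero[OF U u] by metis
  qed
  have 1: "polar N u [(q, m)] (jet_partial p s f)
      = m ^ (d - s) * jcoeff (jet_partial q (d - s) (jet_partial p s f)) {#} u" if "s \<le> d" for s
    by (rule polar_single[OF jets_on_jet_partial[OF U f]]) (use that d in auto)
  have "polar N u [(p, l), (q, m)] f = (\<Sum>s\<le>N. l ^ s * polar N u [(q, m)] (jet_partial p s f))"
    by (rule polar_jet_dir_sum[OF U u jets_on_UNIV[OF U f]])
  also have "\<dots> = (\<Sum>s\<le>d. l ^ s * polar N u [(q, m)] (jet_partial p s f))"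
    using d 0 by (intro sum.mono_neutral_right) auto
  finally show ?thesis using 1 by simp
qed

lemma bracket_symbol_Nil: "bracket_symbol N u k Q [] l i j = l ^ k * jcoeff (Q k i j) {#} u"
proof -
  have "jcoeff (Q s i j) {#} u = 0" if "s < k" for s
    using jets_onD(2)[OF Q[of s i j], of "{#}" u] that u by auto
  then have "(\<Sum>s\<le>k. l ^ s * jcoeff (Q s i j) {#} u) = (\<Sum>s\<in>{k}. l ^ s * jcoeff (Q s i j) {#} u)"
    by (intro sum.mono_neutral_right) auto
  then show ?thesis by (simp add: bracket_symbol_def)
qed

lemma bracket_symbol_single:
  assumes "k \<le> N"
  shows "bracket_symbol N u k Q [(p, b)] a i j = lin_form k Q u p i j a b"
  unfolding bracket_symbol_def lin_form_def
proof (intro sum.cong refl)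
  fix r assume "r \<in> {..k}"
  then show "a ^ r * polar N u [(p, b)] (Q r i j) = lin_symb k Q r p i j u * (a ^ r * b ^ (k - r))"
    using polar_single[OF Q, of r N p b i j] assms by (simp add: lin_symb_def del: polar.simps)
qed

lemma bracket_symbol_pair:
  assumes "k \<le> N"
  shows "bracket_symbol N u k Q [(p, b), (q, c)] a i j = quad_form k Q u p q i j a b c"
  unfolding bracket_symbol_def quad_form_def
proof (intro sum.cong refl)
  fix r assume "r \<in> {..k}"
  then show "a ^ r * polar N u [(p, b), (q, c)] (Q r i j)
      = (\<Sum>t\<le>k - r. quad_symb k Q r t p q i j u * (a ^ r * (b ^ t * c ^ (k - r - t))))"
    using polar_pair[OF Q, of r N p b q c i j] assms
    by (simp add: quad_symb_def sum_distrib_left mult_ac del: polar.simps)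
qed

lemma test_density_pair_null:
  "null_functional U (functional_bracket k Q (test_density u i p) (test_density u j q) +
    functional_bracket k Q (test_density u j q) (test_density u i p))"
  using P test_density_diff_poly[OF U u] by (simp add: poisson_over_def Let_def)

lemma test_density_triple_null:
  "null_functional U
    (functional_bracket k Q (functional_bracket k Q (test_density u i p) (test_density u j q)) (test_density u m r) +
     functional_bracket k Q (functional_bracket k Q (test_density u j q) (test_density u m r)) (test_density u i p) +
     functional_bracket k Q (functional_bracket k Q (test_density u m r) (test_density u i p)) (test_density u j q))"
  using P test_density_diff_poly[OF U u] by (simp add: poisson_over_def Let_def)

text \<open>The cut-off exceeds by one the degree bound for the bracket of the two densities, as
  \<open>polar_null_functional\<close> requires.\<close>

lemma skew_symbol:
  assumes p: "coeff p 0 = 0" and q: "coeff q 0 = 0" and w: "weight xs = 0"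
    and N: "N = k + 2 * degree p + 2 * degree q + 1"
  shows "pick_pair (bracket_symbol N u k Q) i (even_response p) j (even_response q) xs +
    pick_pair (bracket_symbol N u k Q) j (even_response q) i (even_response p) xs = 0"
proof -
  let ?F = "test_density u i p" and ?G = "test_density u j q"
  let ?b = "functional_bracket k Q"
  note jF = jets_on_test_density[OF U u, of i p] and jG = jets_on_test_density[OF U u, of j q]
  have pF: "polar N u xs (var_deriv p' ?F) = response i (even_response p) p' xs" for xs p'
    by (rule polar_test_density[OF U u p]) (simp add: N)
  have pG: "polar N u xs (var_deriv p' ?G) = response j (even_response q) p' xs" for xs p'
    by (rule polar_test_density[OF U u q]) (simp add: N)
  have 1: "?b ?F ?G \<in> jets_on U {..2 * degree p + 2 * degree q + k}"
    by (rule jets_on_functional_bracket[OF U u Q jF jG])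
  have 2: "?b ?G ?F \<in> jets_on U {..2 * degree p + 2 * degree q + k}"
    by (rule jets_on_mono[OF jets_on_functional_bracket[OF U u Q jG jF]]) auto
  have "polar N u xs (?b ?F ?G + ?b ?G ?F) = 0"
    by (rule polar_null_functional[OF U u test_density_pair_null jets_on_add[OF U 1 2]]) (use w N in auto)
  then have "polar N u xs (?b ?F ?G) + polar N u xs (?b ?G ?F) = 0"
    by (simp add: polar_add[OF U u jets_on_UNIV[OF U 1] jets_on_UNIV[OF U 2]])
  then show ?thesis
    using polar_functional_bracket[OF U u Q jF jG _ pF pG, of xs]
      polar_functional_bracket[OF U u Q jG jF _ pG pF, of xs] N by simp
qed

text \<open>The degree bound of a double bracket is symmetric in the three densities, so a single
  cut-off, one above it, serves all cyclic terms. The fact \<open>pol\<close> treats them uniformly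
  by asking only for the sum of the degrees.\<close>

lemma jacobi_symbol:
  assumes p: "coeff p 0 = 0" and q: "coeff q 0 = 0" and r: "coeff r 0 = 0" and w: "weight xs = 0"
    and N: "N = 2 * k + 2 * degree p + 2 * degree q + 2 * degree r + 1"
  shows "double_symbol (bracket_symbol N u k Q) xs i (even_response p) j (even_response q) m (even_response r)
    + double_symbol (bracket_symbol N u k Q) xs j (even_response q) m (even_response r) i (even_response p)
    + double_symbol (bracket_symbol N u k Q) xs m (even_response r) i (even_response p) j (even_response q) = 0"
proof -
  let ?b = "functional_bracket k Q"
  let ?d = "2 * degree p + 2 * degree q + 2 * degree r + 2 * k"
  have pol: "polar N u xs (?b (?b (test_density u a s) (test_density u b t)) (test_density u c v)) =
      double_symbol (bracket_symbol N u k Q) xs a (even_response s) b (even_response t) c (even_response v)"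
    and jet: "?b (?b (test_density u a s) (test_density u b t)) (test_density u c v) \<in> jets_on U {..?d}"
    if st: "coeff s 0 = 0" "coeff t 0 = 0" "coeff v 0 = 0"
      and D: "degree s + degree t + degree v = degree p + degree q + degree r" for a b c s t v
  proof -
    let ?F = "test_density u a s" and ?G = "test_density u b t" and ?H = "test_density u c v"
    note jF = jets_on_test_density[OF U u, of a s] and jG = jets_on_test_density[OF U u, of b t]
      and jH = jets_on_test_density[OF U u, of c v]
    have DN: "2 * degree s + 2 * degree t + 2 * degree v + 2 * k + 1 = N" using D N by simp
    have pF: "polar N u xs (var_deriv p' ?F) = response a (even_response s) p' xs" for xs p'
      by (rule polar_test_density[OF U u st(1)]) (use DN in simp)
    have pG: "polar N u xs (var_deriv p' ?G) = response b (even_response t) p' xs" for xs p'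
      by (rule polar_test_density[OF U u st(2)]) (use DN in simp)
    have pH: "polar N u xs (var_deriv p' ?H) = response c (even_response v) p' xs" for xs p'
      by (rule polar_test_density[OF U u st(3)]) (use DN in simp)
    note jB = jets_on_functional_bracket[OF U u Q jF jG]
    have N1: "2 * degree s + 2 * degree t + k < N" "2 * degree v + k \<le> N" "2 * degree t + k \<le> N"
      using DN by auto
    show "polar N u xs (?b (?b ?F ?G) ?H) =
      double_symbol (bracket_symbol N u k Q) xs a (even_response s) b (even_response t) c (even_response v)"
    proof -
      have pB: "polar N u ys (?b ?F ?G) = 
          pick_pair (bracket_symbol N u k Q) a (even_response s) b (even_response t) ys" for ys
        by (rule polar_functional_bracket[OF U u Q jF jG N1(3) pF pG])
      show ?thesis
      proof (rule trans[OF polar_double_bracket[OF U u Q jB jH N1(1,2) pH]])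
        show "(\<Sum>p\<in>UNIV. \<Sum>(x, y)\<leftarrow>splits xs. polar N u ((p, neg_weight x) # x) (?b ?F ?G) *
            pick_one (bracket_symbol N u k Q) c (even_response v) p c y) =
          double_symbol (bracket_symbol N u k Q) xs a (even_response s) b (even_response t) c (even_response v)"
          unfolding double_symbol_def pB ..
      qed
    qed
    show "?b (?b ?F ?G) ?H \<in> jets_on U {..?d}"
      by (rule jets_on_mono[OF jets_on_functional_bracket[OF U u Q jB jH]]) (use D in auto)
  qed
  note P1 = pol[OF p q r] and P2 = pol[OF q r p] and P3 = pol[OF r p q]
  note J1 = jet[OF p q r] and J2 = jet[OF q r p] and J3 = jet[OF r p q]
  let ?F = "test_density u i p" and ?G = "test_density u j q" and ?H = "test_density u m r"
  let ?J = "?b (?b ?F ?G) ?H + ?b (?b ?G ?H) ?F + ?b (?b ?H ?F) ?G"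
  have "?J \<in> jets_on U {..?d}"
    by (intro jets_on_add[OF U] J1 J2 J3) auto
  then have "polar N u xs ?J = 0"
    by (rule polar_null_functional[OF U u test_density_triple_null]) (use w N in auto)
  moreover have "polar N u xs ?J = polar N u xs (?b (?b ?F ?G) ?H) + polar N u xs (?b (?b ?G ?H) ?F) + polar N u xs (?b (?b ?H ?F) ?G)"
    using jets_on_UNIV[OF U J1] jets_on_UNIV[OF U J2] jets_on_UNIV[OF U J3]
    by (simp add: polar_add[OF U u] jets_on_add[OF U])
  ultimately show ?thesis using P1 P2 P3 by simp
qed

text \<open>Frequencies -1 and 1 sum to 0 without a loop variation, so only the leading symbol l^k g
  remains; evaluating it at -1 produces the sign. One selector serves both, being even.\<close>

lemma leading_skew: "jcoeff (Q k j i) {#} u = (-1) ^ Suc k * jcoeff (Q k i j) {#} u"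
proof -
  obtain p :: "real poly" where p: "coeff p 0 = 0" and v: "selects (even_response p) 1 {}"
    using frequency_selector_symbol[of "{}" 1] by auto
  have "2 * poly p 1 = 1" using v by (simp add: selects_def)
  then have "jcoeff (Q k i j) {#} u + jcoeff (Q k j i) {#} u * (-1) ^ k = 0"
    using skew_symbol[OF p p _ refl, of "[(i, -1), (j, 1)]" i j]
    by (cases "i = j") (auto simp: bracket_symbol_Nil algebra_simps)
  then show ?thesis by (cases "even k") auto
qed

text \<open>A third direction (q, -a - b), invisible to both selectors, differentiates skew-symmetry
  once along the loop.\<close>

lemma lin_form_skew: "lin_form k Q u q i j b (- a - b) = - lin_form k Q u q j i a (- a - b)"
proof -
  have "lin_form k Q u q i j b (- a - b) + lin_form k Q u q j i a (- a - b) = 0"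
  proof (rule zero_by_genericity3[of "\<lambda>a b. lin_form k Q u q i j b (- a - b) + lin_form k Q u q j i a (- a - b)"])
    fix a b assume g: "generic3 a b (- a - b)"
    let ?c = "- a - b"
    obtain p :: "real poly" where p: "coeff p 0 = 0" and v: "selects (even_response p) a {b, ?c}"
      by (rule frequency_selector_symbol[of "{b, ?c}" a]) (use g in \<open>auto simp: generic3_def\<close>)
    obtain r :: "real poly" where r: "coeff r 0 = 0" and w: "selects (even_response r) b {a, ?c}"
      by (rule frequency_selector_symbol[of "{a, ?c}" b]) (use g in \<open>auto simp: generic3_def\<close>)
    have v': "2 * poly p (a\<^sup>2) = 1" "poly p (b\<^sup>2) = 0" "poly p (?c\<^sup>2) = 0"
      and w': "2 * poly r (b\<^sup>2) = 1" "poly r (a\<^sup>2) = 0" "poly r (?c\<^sup>2) = 0"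
      using v w by (auto simp: selects_def)
    define N where "N = k + 2 * degree p + 2 * degree r + 1"
    have "bracket_symbol N u k Q [(q, ?c)] b i j + bracket_symbol N u k Q [(q, ?c)] a j i = 0"
      using skew_symbol[OF p r _ N_def, of "[(i, a), (j, b), (q, ?c)]" i j] 
      by (simp add: v' w' cong: if_cong split del: if_split)
    then show "lin_form k Q u q i j b ?c + lin_form k Q u q j i a ?c = 0"
      by (simp add: bracket_symbol_single N_def)
  next
    show "isCont (\<lambda>t. lin_form k Q u q i j (b + t * 3) (- (a + t * 1) - (b + t * 3))
        + lin_form k Q u q j i (a + t * 1) (- (a + t * 1) - (b + t * 3))) 0"
      unfolding lin_form_def by (intro continuous_intros)
  qed
  then show ?thesis by simp
qed

text \<open>The Jacobi identity at the constant loop itself: the three covectors absorb all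
  directions, which forces their frequencies to sum to 0. It yields the compatibility of bracket and
  anchor.\<close>

lemma jacobi_linear:
  "(\<Sum>p\<in>UNIV. lin_form k Q u p i j b (- a - b) * ((- a - b) ^ k * jcoeff (Q k p m) {#} u)) +
   (\<Sum>p\<in>UNIV. lin_form k Q u p j m (- a - b) a * (a ^ k * jcoeff (Q k p i) {#} u)) +
   (\<Sum>p\<in>UNIV. lin_form k Q u p m i a b * (b ^ k * jcoeff (Q k p j) {#} u)) = 0"
  (is "?f a b = 0")
proof (rule zero_by_genericity3[of ?f])
  fix a b assume g: "generic3 a b (- a - b)"
  define c where "c = - a - b"
  obtain p :: "real poly" where p: "coeff p 0 = 0" and v: "selects (even_response p) a {b, c}"
    by (rule frequency_selector_symbol[of "{b, c}" a]) (use g in \<open>auto simp: generic3_def simp flip: c_def\<close>)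
  obtain q :: "real poly" where q: "coeff q 0 = 0" and w: "selects (even_response q) b {a, c}"
    by (rule frequency_selector_symbol[of "{a, c}" b]) (use g in \<open>auto simp: generic3_def simp flip: c_def\<close>)
  obtain r :: "real poly" where r: "coeff r 0 = 0" and z: "selects (even_response r) c {a, b}"
    by (rule frequency_selector_symbol[of "{a, b}" c]) (use g in \<open>auto simp: generic3_def simp flip: c_def\<close>)
  define N where "N = 2 * k + 2 * degree p + 2 * degree q + 2 * degree r + 1"
  have s: "a + b + c = 0" "b + c + a = 0" "c + a + b = 0" by (auto simp: c_def)
  have z': "selects (even_response r) c {b, a}" and v': "selects (even_response p) a {c, b}"
    and w': "selects (even_response q) b {c, a}" using v w z by (auto simp: selects_def)
  let ?xs = "[(i, a), (j, b), (m, c)]"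
  have "weight ?xs = 0" using s by simp
  from jacobi_symbol[OF p q r this N_def, of i j m]
  show "?f a b = 0"
    using double_symbol_three[OF s(1) v w z, of ?xs i j m] double_symbol_three[OF s(2) w' z' v, of ?xs j m i]
      double_symbol_three[OF s(3) z v' w', of ?xs m i j]
    by (simp add: bracket_symbol_single bracket_symbol_Nil N_def flip: c_def)
next
  show "isCont (\<lambda>t. ?f (a + t * 1) (b + t * 3)) 0"
    unfolding lin_form_def by (intro continuous_intros)
qed

text \<open>One more direction (q, d) differentiates the Jacobi identity along the loop and leaves
  a, b, c unconstrained. The forms f contain the unknown quadratic coefficients, each time next to a
  k-th power of one frequency.\<close>

lemma jacobi_quadratic:
  defines "g \<equiv> \<lambda>i j. jcoeff (Q k i j) {#} u" and "h \<equiv> lin_form k Q u" and "f \<equiv> quad_form k Q u"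
  shows "(\<Sum>p\<in>UNIV. h p i j b (- a - b) * h q p m c (- a - b - c) + f p q i j b c (- a - b - c) * (c ^ k * g p m)) +
   (\<Sum>p\<in>UNIV. h p j m c (- b - c) * h q p i a (- a - b - c) + f p q j m c a (- a - b - c) * (a ^ k * g p i)) +
   (\<Sum>p\<in>UNIV. h p m i a (- c - a) * h q p j b (- a - b - c) + f p q m i a b (- a - b - c) * (b ^ k * g p j)) = 0"
  (is "?f a b c = 0")
proof (rule zero_by_genericity4[of ?f])
  fix a b c assume g: "generic4 a b c (- a - b - c)"
  define d where "d = - a - b - c"
  \<comment> \<open>Since a + b + c + d = 0, sums involving d have the same squares as sums of two
    of a, b, c; therefore \<open>generic4\<close> lists only the latter.\<close>
  have sq: "(a + d)\<^sup>2 = (b + c)\<^sup>2" "(b + d)\<^sup>2 = (a + c)\<^sup>2" "(c + d)\<^sup>2 = (a + b)\<^sup>2"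
    by (auto simp: d_def power2_eq_iff)
  have g': "a\<^sup>2 \<noteq> 0" "b\<^sup>2 \<noteq> 0" "c\<^sup>2 \<noteq> 0" "a\<^sup>2 \<noteq> b\<^sup>2" "a\<^sup>2 \<noteq> c\<^sup>2" "b\<^sup>2 \<noteq> c\<^sup>2"
    "\<And>z. z \<in> {d, a + b, a + c, b + c} \<Longrightarrow> z\<^sup>2 \<noteq> a\<^sup>2 \<and> z\<^sup>2 \<noteq> b\<^sup>2 \<and> z\<^sup>2 \<noteq> c\<^sup>2"
    using g unfolding generic4_def generic3_def d_def[symmetric] by blast+
  \<comment> \<open>One zero set large enough for every position a density takes in the three cyclic
    terms; \<open>sub\<close> restricts it to what \<open>double_symbol_four\<close> asks
    for.\<close>
  let ?Z = "\<lambda>a b c. {b, c, d, a + b, a + d, b + d, c + d, a + c, b + c}"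
  obtain p :: "real poly" where p: "coeff p 0 = 0" and v: "selects (even_response p) a (?Z a b c)"
    by (rule frequency_selector_symbol[of "?Z a b c" a])
      (use g' in \<open>auto simp: sq add.commute\<close>)
  obtain q' :: "real poly" where q: "coeff q' 0 = 0" and w: "selects (even_response q') b (?Z b c a)"
    by (rule frequency_selector_symbol[of "?Z b c a" b])
      (use g' in \<open>auto simp: sq add.commute\<close>)
  obtain r :: "real poly" where r: "coeff r 0 = 0" and z: "selects (even_response r) c (?Z c a b)"
    by (rule frequency_selector_symbol[of "?Z c a b" c])
      (use g' in \<open>auto simp: sq add.commute\<close>)
  define N where "N = 2 * k + 2 * degree p + 2 * degree q' + 2 * degree r + 1"
  have s: "a + b + c + d = 0" "b + c + a + d = 0" "c + a + b + d = 0" by (auto simp: d_def)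
  have sub: "selects v' l Z" if "selects v' l Z'" "Z \<subseteq> Z'" for v' l Z Z'
    using that by (auto simp: selects_def)
  let ?xs = "[(i, a), (j, b), (m, c), (q, d)]"
  have "weight ?xs = 0" using s by (simp add: add.assoc)
  from jacobi_symbol[OF p q r this N_def, of i j m]
  show "?f a b c = 0"
    using double_symbol_four[OF s(1) sub[OF v] sub[OF w] sub[OF z], of ?xs i j m "(q, d)" q]
      double_symbol_four[OF s(2) sub[OF w] sub[OF z] sub[OF v], of ?xs j m i "(q, d)" q]
      double_symbol_four[OF s(3) sub[OF z] sub[OF v] sub[OF w], of ?xs m i j "(q, d)" q]
    by (simp add: add.commute bracket_symbol_single bracket_symbol_pair bracket_symbol_Nil N_def
        g_def h_def f_def flip: d_def)
next
  show "isCont (\<lambda>t. ?f (a + t * 1) (b + t * 3) (c + t * 9)) 0"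
    unfolding lin_form_def quad_form_def h_def f_def by (intro continuous_intros)
qed

end

section \<open>Extraction of the structure equations\<close>

text \<open>A polynomial in the frequencies vanishes identically iff the corresponding trilinear
  differential operator on polynomials in \<open>x\<close> does. Evaluating the operators on powers of \<open>x\<close>
  isolates the combinations \<open>\<nabla>\<^sup>[\<^sup>s\<^sup>]\<close>.\<close>

abbreviation pd :: "nat \<Rightarrow> real poly \<Rightarrow> real poly" where
  "pd n \<equiv> pderiv ^^ n"

abbreviation list_symbol :: "(real \<times> nat \<times> nat \<times> nat) list \<Rightarrow> real \<Rightarrow> real \<Rightarrow> real \<Rightarrow> real" where
  "list_symbol L a b c \<equiv> (\<Sum>(w, p, q, r)\<leftarrow>L. w * (a ^ p * b ^ q * c ^ r))"

abbreviation list_op :: "(real \<times> nat \<times> nat \<times> nat) list \<Rightarrow> real poly \<Rightarrow> real poly \<Rightarrow> real poly \<Rightarrow> real poly" where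
  "list_op L f g h \<equiv> (\<Sum>(w, p, q, r)\<leftarrow>L. smult w (pd p f * pd q g * pd r h))"

text \<open>The same list of weighted monomials describes the polynomial and the operator.
  Repetitions are allowed, so closure under the operations only requires concatenating and mapping
  lists.\<close>

definition symbol_of :: "(real \<Rightarrow> real \<Rightarrow> real \<Rightarrow> real) \<Rightarrow> (real poly \<Rightarrow> real poly \<Rightarrow> real poly \<Rightarrow> real poly) \<Rightarrow> bool" where
  "symbol_of \<tau> T \<longleftrightarrow> (\<exists>L. (\<forall>a b c. \<tau> a b c = list_symbol L a b c) \<and>
     (\<forall>f g h. T f g h = list_op L f g h))"

lemma pd_add: "pd n (f + g) = pd n f + pd n g"
  by (induction n) (auto simp: pderiv_add)

lemma pd_smult: "pd n (smult c f) = smult c (pd n f)"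
  by (induction n) (auto simp: pderiv_smult)

lemma pd_zero [simp]: "pd n 0 = 0"
  by (induction n) auto

lemma symbol_of_cong:
  "symbol_of \<tau> T \<Longrightarrow> (\<And>a b c. \<tau>' a b c = \<tau> a b c) \<Longrightarrow> (\<And>f g h. T' f g h = T f g h) \<Longrightarrow> symbol_of \<tau>' T'"
  by (simp add: symbol_of_def)

lemma symbol_of_mult: "symbol_of (\<lambda>a b c. 1) (\<lambda>f g h. f * g * h)"
  unfolding symbol_of_def by (intro exI[of _ "[(1, 0, 0, 0)]"]) simp

lemma symbol_of_zero: "symbol_of (\<lambda>a b c. 0) (\<lambda>f g h. 0)"
  unfolding symbol_of_def by (intro exI[of _ "[]"]) simp

lemma symbol_of_add:
  assumes "symbol_of \<tau> T" "symbol_of \<tau>' T'"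
  shows "symbol_of (\<lambda>a b c. \<tau> a b c + \<tau>' a b c) (\<lambda>f g h. T f g h + T' f g h)"
proof -
  from assms obtain L L' where
    "\<forall>a b c. \<tau> a b c = list_symbol L a b c"
    "\<forall>f g h. T f g h = list_op L f g h"
    "\<forall>a b c. \<tau>' a b c = list_symbol L' a b c"
    "\<forall>f g h. T' f g h = list_op L' f g h"
    unfolding symbol_of_def by blast
  then show ?thesis
    unfolding symbol_of_def by (intro exI[of _ "L @ L'"]) simp
qed

lemma symbol_of_sum:
  "(\<And>i. i \<in> A \<Longrightarrow> symbol_of (\<tau> i) (T i)) \<Longrightarrow>
    symbol_of (\<lambda>a b c. \<Sum>i\<in>A. \<tau> i a b c) (\<lambda>f g h. \<Sum>i\<in>A. T i f g h)"
  by (induction A rule: infinite_finite_induct) (auto intro: symbol_of_add symbol_of_zero)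

lemma smult_sum_list: "smult c (\<Sum>x\<leftarrow>xs. f x) = (\<Sum>x\<leftarrow>xs. smult c (f x))"
  by (induction xs) (auto simp: smult_add_right)

lemma symbol_of_scale:
  assumes "symbol_of \<tau> T"
  shows "symbol_of (\<lambda>a b c. e * \<tau> a b c) (\<lambda>f g h. smult e (T f g h))"
proof -
  from assms obtain L where
    "\<forall>a b c. \<tau> a b c = list_symbol L a b c" "\<forall>f g h. T f g h = list_op L f g h"
    unfolding symbol_of_def by blast
  then show ?thesis
    unfolding symbol_of_def
    by (intro exI[of _ "map (\<lambda>(w, p, q, r). (e * w, p, q, r)) L"])
      (simp add: o_def case_prod_unfold sum_list_const_mult[symmetric] smult_sum_list mult.assoc)
qed

lemma symbol_of_first:
  assumes "symbol_of \<tau> T"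
  shows "symbol_of (\<lambda>a b c. a ^ n * \<tau> a b c) (\<lambda>f g h. T (pd n f) g h)"
proof -
  from assms obtain L where
    "\<forall>a b c. \<tau> a b c = list_symbol L a b c" "\<forall>f g h. T f g h = list_op L f g h"
    unfolding symbol_of_def by blast
  then show ?thesis
    unfolding symbol_of_def
    by (intro exI[of _ "map (\<lambda>(w, p, q, r). (w, p + n, q, r)) L"])
      (simp add: o_def case_prod_unfold sum_list_const_mult[symmetric] funpow_add power_add mult_ac)
qed

lemma symbol_of_rotate:
  assumes "symbol_of \<tau> T"
  shows "symbol_of (\<lambda>a b c. \<tau> b c a) (\<lambda>f g h. T g h f)"
proof -
  from assms obtain L where
    "\<forall>a b c. \<tau> a b c = list_symbol L a b c" "\<forall>f g h. T f g h = list_op L f g h"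
    unfolding symbol_of_def by blast
  then show ?thesis
    unfolding symbol_of_def
    by (intro exI[of _ "map (\<lambda>(w, p, q, r). (w, r, p, q)) L"])
      (simp add: o_def case_prod_unfold mult_ac)
qed

lemma symbol_of_swap:
  assumes "symbol_of \<tau> T"
  shows "symbol_of (\<lambda>a b c. \<tau> b a c) (\<lambda>f g h. T g f h)"
proof -
  from assms obtain L where
    "\<forall>a b c. \<tau> a b c = list_symbol L a b c" "\<forall>f g h. T f g h = list_op L f g h"
    unfolding symbol_of_def by blast
  then show ?thesis
    unfolding symbol_of_def
    by (intro exI[of _ "map (\<lambda>(w, p, q, r). (w, q, p, r)) L"])
      (simp add: o_def case_prod_unfold mult_ac)
qed

lemma symbol_of_second:
  assumes "symbol_of \<tau> T"
  shows "symbol_of (\<lambda>a b c. b ^ n * \<tau> a b c) (\<lambda>f g h. T f (pd n g) h)"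
  using symbol_of_swap[OF symbol_of_first[OF symbol_of_swap[OF assms], of n]] .

lemma symbol_of_third:
  assumes "symbol_of \<tau> T"
  shows "symbol_of (\<lambda>a b c. c ^ n * \<tau> a b c) (\<lambda>f g h. T f g (pd n h))"
  using symbol_of_rotate[OF symbol_of_rotate[OF symbol_of_first[OF symbol_of_rotate[OF assms], of n]]] .

text \<open>The Leibniz rule for three factors: differentiating the result has symbol a + b +
  c.\<close>

lemma symbol_of_pderiv:
  assumes "symbol_of \<tau> T"
  shows "symbol_of (\<lambda>a b c. (a + b + c) * \<tau> a b c) (\<lambda>f g h. pderiv (T f g h))"
proof (rule symbol_of_cong[OF symbol_of_add[OF symbol_of_add[OF
        symbol_of_first[OF assms, of 1] symbol_of_second[OF assms, of 1]] symbol_of_third[OF assms, of 1]]])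
  fix f g h
  from assms obtain L where
    T: "\<And>f g h. T f g h = list_op L f g h"
    unfolding symbol_of_def by blast
  have "pderiv (list_op L f g h) =
    (\<Sum>(w, p, q, r)\<leftarrow>L. smult w (pd p (pderiv f) * pd q g * pd r h)) +
    (\<Sum>(w, p, q, r)\<leftarrow>L. smult w (pd p f * pd q (pderiv g) * pd r h)) +
    (\<Sum>(w, p, q, r)\<leftarrow>L. smult w (pd p f * pd q g * pd r (pderiv h)))"
    by (induction L) (auto simp: pderiv_add pderiv_smult pderiv_mult smult_add_right funpow_swap1 algebra_simps)
  then show "pderiv (T f g h) = T (pd 1 f) g h + T f (pd 1 g) h + T f g (pd 1 h)"
    by (simp add: T)
qed (simp add: algebra_simps)

lemma symbol_of_pd:
  assumes "symbol_of \<tau> T"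
  shows "symbol_of (\<lambda>a b c. (a + b + c) ^ n * \<tau> a b c) (\<lambda>f g h. pd n (T f g h))"
proof (induction n)
  case (Suc n)
  show ?case
    by (rule symbol_of_cong[OF symbol_of_pderiv[OF Suc]]) (auto simp: mult_ac)
qed (simp add: assms)

text \<open>The argument h is a spectator, carried along so that bilinear operators fit the
  trilinear format.\<close>

lemma symbol_of_pair: "symbol_of (\<lambda>a b c. (a + b) ^ n * b ^ t) (\<lambda>f g h. pd n (f * pd t g) * h)"
proof (induction n)
  case 0
  show ?case by (rule symbol_of_cong[OF symbol_of_second[OF symbol_of_mult, of t]]) auto
next
  case (Suc n)
  show ?case
  proof (rule symbol_of_cong[OF symbol_of_add[OF symbol_of_first[OF Suc, of 1] symbol_of_second[OF Suc, of 1]]])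
    fix f g h :: "real poly"
    show "pd (Suc n) (f * pd t g) * h = pd n (pd 1 f * pd t g) * h + pd n (f * pd t (pd 1 g)) * h"
      by (simp add: pderiv_mult pd_add funpow_swap1 algebra_simps)
  qed (simp add: algebra_simps)
qed

fun coeff_list :: "(real \<times> nat \<times> nat \<times> nat) list \<Rightarrow> nat \<Rightarrow> nat \<Rightarrow> nat \<Rightarrow> real" where
  "coeff_list [] p q r = 0"
| "coeff_list ((w, p', q', r') # L) p q r = (if p = p' \<and> q = q' \<and> r = r' then w else 0) + coeff_list L p q r"

lemma sum_delta3:
  fixes \<phi> :: "nat \<Rightarrow> nat \<Rightarrow> nat \<Rightarrow> real"
  assumes "p' \<le> M" "q' \<le> M" "r' \<le> M"
  shows "(\<Sum>p\<le>M. \<Sum>q\<le>M. \<Sum>r\<le>M. (if p = p' \<and> q = q' \<and> r = r' then w else 0) * \<phi> p q r) = w * \<phi> p' q' r'"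
proof -
  have "(\<Sum>r\<le>M. (if p = p' \<and> q = q' \<and> r = r' then w else 0) * \<phi> p q r) = (if q = q' then (if p = p' then w * \<phi> p q r' else 0) else 0)" for p q
  proof -
    have "(\<Sum>r\<le>M. (if p = p' \<and> q = q' \<and> r = r' then w else 0) * \<phi> p q r)
        = (\<Sum>r\<le>M. if r = r' then (if p = p' \<and> q = q' then w * \<phi> p q r' else 0) else 0)"
      by (intro sum.cong) auto
    then show ?thesis using assms by (auto simp: sum.delta)
  qed
  then have "(\<Sum>p\<le>M. \<Sum>q\<le>M. \<Sum>r\<le>M. (if p = p' \<and> q = q' \<and> r = r' then w else 0) * \<phi> p q r)
      = (\<Sum>p\<le>M. \<Sum>q\<le>M. if q = q' then (if p = p' then w * \<phi> p q r' else 0) else 0)" by simp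
  also have "\<dots> = (\<Sum>p\<le>M. if p = p' then w * \<phi> p q' r' else 0)"
    using assms by (simp add: sum.delta)
  finally show ?thesis using assms by (simp add: sum.delta)
qed

lemma sum_list_coeff_list:
  fixes \<phi> :: "nat \<Rightarrow> nat \<Rightarrow> nat \<Rightarrow> real"
  assumes "\<forall>(w, p, q, r)\<in>set L. p \<le> M \<and> q \<le> M \<and> r \<le> M"
  shows "(\<Sum>(w, p, q, r)\<leftarrow>L. w * \<phi> p q r) = (\<Sum>p\<le>M. \<Sum>q\<le>M. \<Sum>r\<le>M. coeff_list L p q r * \<phi> p q r)"
  using assms
proof (induction L)
  case (Cons x L)
  obtain w p q r where x: "x = (w, p, q, r)" by (cases x)
  show ?case using Cons sum_delta3[of p M q r w \<phi>]
    by (simp add: x distrib_right sum.distrib)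
qed simp

text \<open>A real polynomial vanishing everywhere has zero coefficients; this is applied to a, b
  and c in turn. After repeated monomials are collected by \<open>coeff_list\<close>, nothing is
  left of the operator.\<close>

lemma symbol_of_eq_zero:
  assumes "symbol_of \<tau> T" "\<And>a b c. \<tau> a b c = 0"
  shows "T f g h = 0"
proof -
  from assms(1) obtain L where
    \<tau>: "\<And>a b c. \<tau> a b c = list_symbol L a b c" and
    T: "\<And>f g h. T f g h = list_op L f g h"
    unfolding symbol_of_def by blast
  \<comment> \<open>A crude common bound: the sum of all exponents dominates each of them.\<close>
  define M where "M = (\<Sum>(w, p, q, r)\<leftarrow>L. p + q + r)"
  have M: "\<forall>(w, p, q, r)\<in>set L. p \<le> M \<and> q \<le> M \<and> r \<le> M"
    unfolding M_def by (induction L) fastforce+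
  have z: "(\<Sum>p\<le>M. (\<Sum>q\<le>M. (\<Sum>r\<le>M. coeff_list L p q r * c ^ r) * b ^ q) * a ^ p) = 0" for a b c
    using \<tau>[of a b c] sum_list_coeff_list[OF M, of "\<lambda>p q r. a ^ p * b ^ q * c ^ r"] assms(2)
    by (simp add: sum_distrib_right sum_distrib_left mult_ac)
  have 1: "(\<Sum>q\<le>M. (\<Sum>r\<le>M. coeff_list L p q r * c ^ r) * b ^ q) = 0" if "p \<le> M" for p b c
    using z[of c b] that polyfun_eq_0[of "\<lambda>p. \<Sum>q\<le>M. (\<Sum>r\<le>M. coeff_list L p q r * c ^ r) * b ^ q" M] by blast
  have 2: "(\<Sum>r\<le>M. coeff_list L p q r * c ^ r) = 0" if "p \<le> M" "q \<le> M" for p q c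
    using 1[OF that(1), of c] that polyfun_eq_0[of "\<lambda>q. \<Sum>r\<le>M. coeff_list L p q r * c ^ r" M] by blast
  have 3: "coeff_list L p q r = 0" if "p \<le> M" "q \<le> M" "r \<le> M" for p q r
    using 2[OF that(1,2)] that polyfun_eq_0[of "\<lambda>r. coeff_list L p q r" M] by blast
  show ?thesis
  proof (rule poly_eqI)
    fix n
    have "coeff (list_op L f g h) n
        = (\<Sum>(w, p, q, r)\<leftarrow>L. w * coeff (pd p f * pd q g * pd r h) n)"
      by (induction L) auto
    then show "coeff (T f g h) n = coeff 0 n"
      using sum_list_coeff_list[OF M, of "\<lambda>p q r. coeff (pd p f * pd q g * pd r h) n"] 3 by (simp add: T)
  qed
qed

text \<open>Varying the integral of f \<Sum> c_t u^{p,k-t} \<partial>^t g with respect to u^p and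
  integrating by parts gives this covector: the bracket of two one-forms along constant loops. In
  \<open>qop\<close> a second variation of the loop stays in place, as the argument h.\<close>

definition hop :: "nat \<Rightarrow> (nat \<Rightarrow> real) \<Rightarrow> real poly \<Rightarrow> real poly \<Rightarrow> real poly" where
  "hop k c f g = (\<Sum>t\<le>k. smult ((-1) ^ (k - t) * c t) (pd (k - t) (f * pd t g)))"

definition qop :: "nat \<Rightarrow> (nat \<Rightarrow> nat \<Rightarrow> real) \<Rightarrow> real poly \<Rightarrow> real poly \<Rightarrow> real poly \<Rightarrow> real poly" where
  "qop k d f g h = (\<Sum>r\<le>k. \<Sum>t\<le>k - r. smult ((-1) ^ (k - r - t) * d r t) (pd (k - r - t) (f * pd r g * pd t h)))"

lemma symbol_of_hop:
  "symbol_of (\<lambda>a b c. \<Sum>t\<le>k. e t * (b ^ t * (- a - b) ^ (k - t))) (\<lambda>f g h. hop k e f g * h)"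
proof (rule symbol_of_cong[OF symbol_of_sum[of "{..k}", OF symbol_of_scale[OF symbol_of_pair]]])
  fix a b c :: real
  have "(- a - b) ^ n = (-1) ^ n * (a + b) ^ n" for n
    by (metis minus_add_distrib power_minus uminus_add_conv_diff add.commute diff_minus_eq_add minus_diff_eq)
  then show "(\<Sum>t\<le>k. e t * (b ^ t * (- a - b) ^ (k - t))) =
      (\<Sum>t\<le>k. ((-1) ^ (k - t) * e t) * ((a + b) ^ (k - t) * b ^ t))"
    by (simp add: mult_ac)
qed (simp add: hop_def sum_distrib_right)

lemma symbol_of_hop_hop:
  "symbol_of (\<lambda>a b c. (\<Sum>t\<le>k. e t * (b ^ t * (- a - b) ^ (k - t))) * (\<Sum>t\<le>k. e' t * (c ^ t * (- a - b - c) ^ (k - t))))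
    (\<lambda>f g h. hop k e' (hop k e f g) h)"
proof -
  have S: "symbol_of (\<lambda>a b c. (a + b + c) ^ (k - t) * (c ^ t * (\<Sum>t\<le>k. e t * (b ^ t * (- a - b) ^ (k - t)))))
      (\<lambda>f g h. pd (k - t) (hop k e f g * pd t h))" for t
    by (rule symbol_of_pd[OF symbol_of_third[OF symbol_of_hop]])
  show ?thesis
  proof (rule symbol_of_cong[OF symbol_of_sum[of "{..k}", OF symbol_of_scale[OF S]]])
    fix a b c :: real
    have "(- a - b - c) ^ n = (-1) ^ n * (a + b + c) ^ n" for n
      using power_minus[of "a + b + c" n] by (simp add: algebra_simps)
    then show "(\<Sum>t\<le>k. e t * (b ^ t * (- a - b) ^ (k - t))) * (\<Sum>t\<le>k. e' t * (c ^ t * (- a - b - c) ^ (k - t))) =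
      (\<Sum>t\<le>k. ((-1) ^ (k - t) * e' t) * ((a + b + c) ^ (k - t) * (c ^ t * (\<Sum>t\<le>k. e t * (b ^ t * (- a - b) ^ (k - t))))))"
      by (simp add: sum_distrib_left[of "\<Sum>t\<le>k. e t * (b ^ t * (- a - b) ^ (k - t))"] mult_ac)
  qed (simp add: hop_def)
qed

lemma symbol_of_qop:
  "symbol_of (\<lambda>a b c. (\<Sum>r\<le>k. \<Sum>t\<le>k - r. d r t * (b ^ r * (c ^ t * (- a - b - c) ^ (k - r - t)))) * (c ^ k * w))
    (\<lambda>f g h. smult w (qop k d f g (pd k h)))"
proof -
  have S: "symbol_of (\<lambda>a b c. (a + b + c) ^ n * (c ^ (t + k) * (b ^ r * 1)))
      (\<lambda>f g h. pd n (f * pd r g * pd (t + k) h))" for n t r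
    by (rule symbol_of_pd[OF symbol_of_third[OF symbol_of_second[OF symbol_of_mult]]])
  show ?thesis
  proof (rule symbol_of_cong[OF symbol_of_scale[of _ _ w, OF symbol_of_sum[of "{..k}",
            OF symbol_of_sum[of "{..k - r}" for r, OF symbol_of_scale[OF S]]]]])
    fix a b c :: real
    have "(- a - b - c) ^ n = (-1) ^ n * (a + b + c) ^ n" for n
      using power_minus[of "a + b + c" n] by (simp add: algebra_simps)
    then show "(\<Sum>r\<le>k. \<Sum>t\<le>k - r. d r t * (b ^ r * (c ^ t * (- a - b - c) ^ (k - r - t)))) * (c ^ k * w) =
      w * (\<Sum>r\<le>k. \<Sum>t\<le>k - r. ((-1) ^ (k - r - t) * d r t) * ((a + b + c) ^ (k - r - t) * (c ^ (t + k) * (b ^ r * 1))))"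
      by (simp add: sum_distrib_left sum_distrib_right power_add mult_ac)
  qed (simp add: qop_def funpow_add)
qed

text \<open>Divided powers x^n/n!: differentiation is a pure shift, and their products are the
  source of the binomial coefficients in \<open>comb_coeff\<close>.\<close>

definition dpow :: "nat \<Rightarrow> real poly" where
  "dpow n = monom (1 / fact n) n"

lemma pderiv_dpow: "pderiv (dpow (Suc n)) = dpow n"
  by (simp add: dpow_def pderiv_monom del: of_nat_Suc)

lemma pd_dpow: "pd t (dpow n) = (if t \<le> n then dpow (n - t) else 0)"
proof (induction t)
  case (Suc t)
  have "pderiv (dpow 0) = 0" by (simp add: dpow_def pderiv_monom)
  moreover have "dpow (n - t) = dpow (Suc (n - Suc t))" if "Suc t \<le> n"
    using that by (simp add: Suc_diff_Suc)
  ultimately show ?case using Suc pderiv_dpow by (cases "Suc t \<le> n"; cases "t = n") auto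
qed simp

lemma dpow_mult: "dpow m * dpow n = smult (real (m + n choose m)) (dpow (m + n))"
  by (simp add: dpow_def mult_monom smult_monom binomial_fact field_simps)

lemma dpow_0: "dpow 0 = 1"
  by (simp add: dpow_def)

text \<open>The factor by which x^k acts on x^s, read off in \<open>hop_dpow\<close>;
  \<open>coact_coeff\<close> belongs to the opposite order of the arguments.\<close>

definition act_coeff :: "nat \<Rightarrow> nat \<Rightarrow> (nat \<Rightarrow> real) \<Rightarrow> real" where
  "act_coeff k s c = (\<Sum>t\<le>s. (-1) ^ (k - t) * real (k + s - t choose k) * c t)"

abbreviation frame_coeff :: "nat \<Rightarrow> nat \<Rightarrow> (nat \<Rightarrow> 'n \<Rightarrow> 'n \<Rightarrow> 'n jet_series) \<Rightarrow> 'n::finite \<Rightarrow> 'n \<Rightarrow> 'n \<Rightarrow> real^'n \<Rightarrow> real" where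
  "frame_coeff k s Q p i j u \<equiv> act_coeff k s (\<lambda>t. lin_symb k Q t p i j u)"

definition coact_coeff :: "nat \<Rightarrow> nat \<Rightarrow> (nat \<Rightarrow> real) \<Rightarrow> real" where
  "coact_coeff k s c = (\<Sum>t\<le>k. (-1) ^ (k - t) * real (k + s - t choose s) * c t)"

lemma smult_sum_left: "smult (\<Sum>a\<in>A. f a) p = (\<Sum>a\<in>A. smult (f a) p)"
  by (induction A rule: infinite_finite_induct) (auto simp: smult_add_left)

text \<open>Terms with t > s contain \<partial>^t (x^s) = 0. The others multiply x^k/k! by
  x^(s-t)/(s-t)! and return to degree s by k - t derivatives, leaving one binomial
  coefficient.\<close>

lemma hop_dpow:
  assumes "s \<le> k"
  shows "hop k c (dpow k) (dpow s) = smult (act_coeff k s c) (dpow s)"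
proof -
  have "hop k c (dpow k) (dpow s) = (\<Sum>t\<le>s. smult ((-1) ^ (k - t) * c t) (pd (k - t) (dpow k * dpow (s - t))))"
    unfolding hop_def using assms by (intro sum.mono_neutral_cong_right) (auto simp: pd_dpow)
  also have "\<dots> = (\<Sum>t\<le>s. smult ((-1) ^ (k - t) * real (k + s - t choose k) * c t) (dpow s))"
    using assms by (intro sum.cong refl) (auto simp: dpow_mult pd_smult pd_dpow mult_ac)
  finally show ?thesis by (simp add: act_coeff_def smult_sum_left)
qed

lemma hop_dpow':
  "hop k c (dpow s) (dpow k) = smult (coact_coeff k s c) (dpow s)"
proof -
  have "hop k c (dpow s) (dpow k) = (\<Sum>t\<le>k. smult ((-1) ^ (k - t) * real (k + s - t choose s) * c t) (dpow s))"
    unfolding hop_def by (intro sum.cong refl) (auto simp: dpow_mult pd_smult pd_dpow mult_ac add.commute)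
  then show ?thesis by (simp add: coact_coeff_def smult_sum_left)
qed

lemma smult_sum_right: "smult c (\<Sum>a\<in>A. f a) = (\<Sum>a\<in>A. smult c (f a))"
  by (induction A rule: infinite_finite_induct) (auto simp: smult_add_right)

lemma hop_smult_left: "hop k c (smult x f) g = smult x (hop k c f g)"
  by (simp add: hop_def pd_smult smult_sum_right mult_ac)

lemma hop_minus_left: "hop k c (- f) g = - hop k c f g"
  using hop_smult_left[of k c "-1" f g] by simp

lemma qop_zero [simp]: "qop k d f g 0 = 0"
  by (simp add: qop_def)

text \<open>A constant third argument retains only t = 0: this is what eliminates the unknown
  quadratic coefficients.\<close>

lemma qop_one: "qop k d f g 1 = hop k (\<lambda>r. d r 0) f g"
proof -
  have pd1: "pd t 1 = (if t = 0 then 1 else 0)" for t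
    using pd_dpow[of t 0] by (auto simp: dpow_0)
  have "(\<Sum>t\<le>k - r. smult ((-1) ^ (k - r - t) * d r t) (pd (k - r - t) (f * pd r g * pd t 1)))
      = (\<Sum>t\<in>{0}. smult ((-1) ^ (k - r - t) * d r t) (pd (k - r - t) (f * pd r g * pd t 1)))" for r
    by (intro sum.mono_neutral_right) (auto simp: pd1)
  then show ?thesis by (simp add: qop_def hop_def)
qed

section \<open>The structure equations: compatibility with the anchor, and the action of degree k on
  degree s\<close>

context
  fixes U :: "(real^'n::finite) set" and k :: nat and Q :: "nat \<Rightarrow> 'n \<Rightarrow> 'n \<Rightarrow> 'n jet_series"
  assumes U: "open U"
    and Q: "\<And>s i j. s \<le> k \<Longrightarrow> Q s i j \<in> jets_on U {k - s}"
    and P: "poisson_over U k Q"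
begin

lemma smooth_lin_symb: "r \<le> k \<Longrightarrow> smooth_fun_on U (lin_symb k Q r p i j)"
  unfolding lin_symb_def[abs_def]
  by (rule jets_onD(1)[OF jets_on_jet_partial_UNIV[OF U jets_on_UNIV[OF U Q]]])

lemma hop_skew:
  assumes u: "u \<in> U"
  shows "hop k (\<lambda>t. lin_symb k Q t q i j u) f g = - hop k (\<lambda>t. lin_symb k Q t q j i u) g f"
proof -
  let ?h = "\<lambda>i j t. lin_symb k Q t q i j u"
  note S = symbol_of_add[OF symbol_of_hop[where k = k and e = "?h i j"]
      symbol_of_swap[OF symbol_of_hop[where k = k and e = "?h j i"]]]
  have "hop k (?h i j) f g * 1 + hop k (?h j i) g f * 1 = 0"
  proof (rule symbol_of_eq_zero[OF S])
    fix a b c :: real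
    have ba: "- b - a = - a - b" by simp
    show "(\<Sum>t\<le>k. ?h i j t * (b ^ t * (- a - b) ^ (k - t))) + (\<Sum>t\<le>k. ?h j i t * (a ^ t * (- b - a) ^ (k - t))) = 0"
      unfolding ba using lin_form_skew[OF U u Q P, of q i j b a]
      by (simp add: lin_form_def)
  qed
  then show ?thesis by (simp add: eq_neg_iff_add_eq_0)
qed

text \<open>Obtained by comparing the coefficients of x^s in \<open>hop_skew\<close> for x^s and
  x^k. It converts sums over all t \<le> k into sums over t \<le> s, so that only the combination
  belonging to s appears.\<close>

lemma coact_coeff_eq:
  assumes u: "u \<in> U" and s: "s \<le> k"
  shows "coact_coeff k s (\<lambda>t. lin_symb k Q t q i j u) = - frame_coeff k s Q q j i u"
proof -
  have "smult (coact_coeff k s (\<lambda>t. lin_symb k Q t q i j u)) (dpow s)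
      = smult (- frame_coeff k s Q q j i u) (dpow s)"
    using hop_skew[OF u, of q i j "dpow s" "dpow k"] by (simp add: hop_dpow' hop_dpow[OF s])
  then have "coeff (smult (coact_coeff k s (\<lambda>t. lin_symb k Q t q i j u)) (dpow s)) s
      = coeff (smult (- frame_coeff k s Q q j i u) (dpow s)) s" by simp
  then have "(coact_coeff k s (\<lambda>t. lin_symb k Q t q i j u) + frame_coeff k s Q q j i u) / fact s = 0"
    by (simp add: dpow_def add_divide_distrib)
  then show ?thesis by (simp add: eq_neg_iff_add_eq_0)
qed

lemma quad_symb_0:
  assumes u: "u \<in> U" and r: "r \<le> k"
  shows "quad_symb k Q r 0 p q i j u = partial p (lin_symb k Q r q i j) u"
  using jet_partial_commute[OF U Q[OF r], of q "k - r" p 0 i j] u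
  by (simp add: quad_symb_def lin_symb_def[abs_def] eq_over_def)

text \<open>\<open>jacobi_linear\<close> evaluated on x^k and x^k, the third slot being filled by 1.
  It says that the frame fields g^{pi} \<partial>_p close under the Lie bracket, with structure
  functions given by \<open>frame_coeff k k\<close>.\<close>

lemma anchor_identity:
  assumes u: "u \<in> U"
  shows "(\<Sum>p\<in>UNIV. (-1) ^ k * frame_coeff k k Q p i j u * jcoeff (Q k p m) {#} u)
    - (\<Sum>p\<in>UNIV. lin_symb k Q k p m j u * jcoeff (Q k p i) {#} u)
    + (\<Sum>p\<in>UNIV. lin_symb k Q k p m i u * jcoeff (Q k p j) {#} u) = 0"
proof -
  let ?h = "\<lambda>p i j t. lin_symb k Q t p i j u" and ?g = "\<lambda>i j. jcoeff (Q k i j) {#} u"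
  have S1: "symbol_of (\<lambda>a b c. (-1) ^ k * ?g p m * ((-1) ^ (k - t) * ?h p i j t) * ((a + b) ^ (k + (k - t)) * b ^ t))
      (\<lambda>f g h. smult ((-1) ^ k * ?g p m * ((-1) ^ (k - t) * ?h p i j t)) (pd (k + (k - t)) (f * pd t g) * h))" for p t
    by (rule symbol_of_scale[OF symbol_of_pair])
  have S2: "symbol_of (\<lambda>a b c. (- ?g p i * ?h p m j t) * (b ^ t * (a ^ (2 * k - t) * 1)))
      (\<lambda>f g h. smult (- ?g p i * ?h p m j t) (pd (2 * k - t) f * pd t g * h))" for p t
    by (rule symbol_of_scale[OF symbol_of_second[OF symbol_of_first[OF symbol_of_mult]]])
  have S3: "symbol_of (\<lambda>a b c. (?g p j * ?h p m i t) * (b ^ (2 * k - t) * (a ^ t * 1)))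
      (\<lambda>f g h. smult (?g p j * ?h p m i t) (pd t f * pd (2 * k - t) g * h))" for p t
    by (rule symbol_of_scale[OF symbol_of_second[OF symbol_of_first[OF symbol_of_mult]]])
  note sum2 = symbol_of_sum[of UNIV, OF symbol_of_sum[of "{..k}"]]
  note S = symbol_of_add[OF symbol_of_add[OF sum2[OF S1] sum2[OF S2]] sum2[OF S3]]
  have "(\<Sum>p\<in>UNIV. \<Sum>t\<le>k. smult ((-1) ^ k * ?g p m * ((-1) ^ (k - t) * ?h p i j t)) (pd (k + (k - t)) (dpow k * pd t (dpow k)) * 1))
    + (\<Sum>p\<in>UNIV. \<Sum>t\<le>k. smult (- ?g p i * ?h p m j t) (pd (2 * k - t) (dpow k) * pd t (dpow k) * 1))
    + (\<Sum>p\<in>UNIV. \<Sum>t\<le>k. smult (?g p j * ?h p m i t) (pd t (dpow k) * pd (2 * k - t) (dpow k) * 1)) = 0"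
    (is "?X + ?Y + ?Z = 0")
  proof (rule symbol_of_eq_zero[OF S])
    fix a b c :: real
    have neg: "(- a - b) ^ n = (-1) ^ n * (a + b) ^ n" for n
      using power_minus[of "a + b" n] by (simp add: algebra_simps)
    \<comment> \<open>Skew-symmetry trades the argument -a - b for b, so that this term becomes an
      operator acting separately on the two factors.\<close>
    have sw: "lin_form k Q u p j m (- a - b) a = - lin_form k Q u p m j b a" for p
      using lin_form_skew[OF U u Q P, of p j m "- a - b" b] by simp
    have X: "(\<Sum>t\<le>k. (-1) ^ k * ?g p m * ((-1) ^ (k - t) * ?h p i j t) * ((a + b) ^ (k + (k - t)) * b ^ t))
        = lin_form k Q u p i j b (- a - b) * ((- a - b) ^ k * ?g p m)" for p
      unfolding lin_form_def sum_distrib_right neg power_add by (simp only: mult_ac)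
    have Y: "(\<Sum>t\<le>k. (- ?g p i * ?h p m j t) * (b ^ t * (a ^ (2 * k - t) * 1)))
        = lin_form k Q u p j m (- a - b) a * (a ^ k * ?g p i)" for p
    proof -
      have "(- ?g p i * ?h p m j t) * (b ^ t * (a ^ (2 * k - t) * 1))
          = (?h p m j t * (b ^ t * a ^ (k - t))) * (- (a ^ k * ?g p i))" if "t \<le> k" for t
      proof -
        have "2 * k - t = k + (k - t)" using that by auto
        then show ?thesis by (simp only: power_add) simp
      qed
      then have "(\<Sum>t\<le>k. (- ?g p i * ?h p m j t) * (b ^ t * (a ^ (2 * k - t) * 1)))
          = lin_form k Q u p m j b a * (- (a ^ k * ?g p i))"
        unfolding lin_form_def sum_distrib_right by (intro sum.cong) auto
      then show ?thesis unfolding sw by simp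
    qed
    have Z: "(\<Sum>t\<le>k. (?g p j * ?h p m i t) * (b ^ (2 * k - t) * (a ^ t * 1)))
        = lin_form k Q u p m i a b * (b ^ k * ?g p j)" for p
      unfolding lin_form_def sum_distrib_right
    proof (intro sum.cong refl)
      fix t assume "t \<in> {..k}"
      then have "2 * k - t = k + (k - t)" by auto
      then show "(?g p j * ?h p m i t) * (b ^ (2 * k - t) * (a ^ t * 1))
          = (?h p m i t * (a ^ t * b ^ (k - t))) * (b ^ k * ?g p j)"
        by (simp add: power_add mult_ac)
    qed
    show "(\<Sum>p\<in>UNIV. \<Sum>t\<le>k. (-1) ^ k * ?g p m * ((-1) ^ (k - t) * ?h p i j t) * ((a + b) ^ (k + (k - t)) * b ^ t))
      + (\<Sum>p\<in>UNIV. \<Sum>t\<le>k. (- ?g p i * ?h p m j t) * (b ^ t * (a ^ (2 * k - t) * 1)))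
      + (\<Sum>p\<in>UNIV. \<Sum>t\<le>k. (?g p j * ?h p m i t) * (b ^ (2 * k - t) * (a ^ t * 1))) = 0"
      unfolding X Y Z by (rule jacobi_linear[OF U u Q P])
  qed
  moreover have "?X = (\<Sum>p\<in>UNIV. [:(-1) ^ k * act_coeff k k (?h p i j) * ?g p m:])"
  proof (intro sum.cong refl)
    fix p
    have "(\<Sum>t\<le>k. smult ((-1) ^ k * ?g p m * ((-1) ^ (k - t) * ?h p i j t)) (pd (k + (k - t)) (dpow k * pd t (dpow k)) * 1))
        = smult ((-1) ^ k * ?g p m) (pd k (hop k (?h p i j) (dpow k) (dpow k)))"
    proof -
      have "pd n (sum F A) = (\<Sum>a\<in>A. pd n (F a))" for n A and F :: "nat \<Rightarrow> real poly"
        by (induction A rule: infinite_finite_induct) (auto simp: pd_add)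
      moreover have "pd (k + (k - t)) x = pd k (pd (k - t) x)" for t x
        by (simp only: funpow_add o_apply)
      ultimately show ?thesis by (simp only: hop_def smult_sum_right pd_smult smult_smult mult_1_right)
    qed
    also have "\<dots> = [:(-1) ^ k * act_coeff k k (?h p i j) * ?g p m:]"
      by (simp add: hop_dpow pd_smult pd_dpow dpow_0 mult_ac)
    finally show "(\<Sum>t\<le>k. smult ((-1) ^ k * ?g p m * ((-1) ^ (k - t) * ?h p i j t)) (pd (k + (k - t)) (dpow k * pd t (dpow k)) * 1))
        = [:(-1) ^ k * act_coeff k k (?h p i j) * ?g p m:]" .
  qed
  moreover have "?Y = (\<Sum>p\<in>UNIV. [:- (?h p m j k * ?g p i):])"
  proof (intro sum.cong refl)
    fix p
    \<comment> \<open>For t < k the order 2k - t exceeds the degree k of \<open>dpow k\<close>. The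
      remaining t = k carries the derivative of the leading coefficient.\<close>
    have "(\<Sum>t\<le>k. smult (- ?g p i * ?h p m j t) (pd (2 * k - t) (dpow k) * pd t (dpow k) * 1))
        = (\<Sum>t\<in>{k}. smult (- ?g p i * ?h p m j t) (pd (2 * k - t) (dpow k) * pd t (dpow k) * 1))"
      by (intro sum.mono_neutral_right) (auto simp: pd_dpow)
    then show "(\<Sum>t\<le>k. smult (- ?g p i * ?h p m j t) (pd (2 * k - t) (dpow k) * pd t (dpow k) * 1))
        = [:- (?h p m j k * ?g p i):]" by (simp add: pd_dpow dpow_0 mult_ac)
  qed
  moreover have "?Z = (\<Sum>p\<in>UNIV. [:?h p m i k * ?g p j:])"
  proof (intro sum.cong refl)
    fix p
    have "(\<Sum>t\<le>k. smult (?g p j * ?h p m i t) (pd t (dpow k) * pd (2 * k - t) (dpow k) * 1))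
        = (\<Sum>t\<in>{k}. smult (?g p j * ?h p m i t) (pd t (dpow k) * pd (2 * k - t) (dpow k) * 1))"
      by (intro sum.mono_neutral_right) (auto simp: pd_dpow)
    then show "(\<Sum>t\<le>k. smult (?g p j * ?h p m i t) (pd t (dpow k) * pd (2 * k - t) (dpow k) * 1))
        = [:?h p m i k * ?g p j:]" by (simp add: pd_dpow dpow_0 mult_ac)
  qed
  ultimately have "coeff ((\<Sum>p\<in>UNIV. [:(-1) ^ k * act_coeff k k (?h p i j) * ?g p m:])
      + (\<Sum>p\<in>UNIV. [:- (?h p m j k * ?g p i):]) + (\<Sum>p\<in>UNIV. [:?h p m i k * ?g p j:])) 0 = 0" by simp
  then show ?thesis by (simp add: coeff_sum sum_negf)
qed

text \<open>The operator form of \<open>jacobi_quadratic\<close> evaluated on x^k, x^k, x^s. All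
  three cyclic terms are multiples of x^s, and comparing coefficients expresses that degree k acts
  on degree s as a Lie algebroid.\<close>

lemma action_identity:
  assumes u: "u \<in> U" and s: "s < k"
  defines "A \<equiv> \<lambda>p i j. frame_coeff k s Q p i j u"
    and "B \<equiv> \<lambda>p i j. frame_coeff k k Q p i j u"
    and "dA \<equiv> \<lambda>q p i j. partial q (\<lambda>u. frame_coeff k s Q p i j u) u"
    and "g \<equiv> \<lambda>i j. jcoeff (Q k i j) {#} u"
  shows "(\<Sum>p\<in>UNIV. B p i j * A q p m) + (\<Sum>p\<in>UNIV. g p i * dA p q j m - A p j m * A q i p)
    + (\<Sum>p\<in>UNIV. A p i m * A q j p - g p j * dA p q i m) = 0"
proof -
  let ?h = "\<lambda>p i j t. lin_symb k Q t p i j u"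
  let ?d = "\<lambda>p q i j r t. quad_symb k Q r t p q i j u"
  let ?T = "\<lambda>q p i j m f g' h. hop k (?h q p m) (hop k (?h p i j) f g') h + smult (g p m) (qop k (?d p q i j) f g' (pd k h))"
  let ?S = "\<lambda>q p i j m a b c. (\<Sum>t\<le>k. ?h p i j t * (b ^ t * (- a - b) ^ (k - t))) * (\<Sum>t\<le>k. ?h q p m t * (c ^ t * (- a - b - c) ^ (k - t)))
     + (\<Sum>r\<le>k. \<Sum>t\<le>k - r. ?d p q i j r t * (b ^ r * (c ^ t * (- a - b - c) ^ (k - r - t)))) * (c ^ k * g p m)"
  have S: "symbol_of (\<lambda>a b c. \<Sum>p\<in>UNIV. ?S q p i j m a b c) (\<lambda>f g' h. \<Sum>p\<in>UNIV. ?T q p i j m f g' h)" for i j m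
    by (rule symbol_of_sum[OF symbol_of_add[OF symbol_of_hop_hop symbol_of_qop]])
  note S123 = symbol_of_add[OF symbol_of_add[OF S[of i j m] symbol_of_rotate[OF S[of j m i]]]
      symbol_of_rotate[OF symbol_of_rotate[OF S[of m i j]]]]
  have "(\<Sum>p\<in>UNIV. ?T q p i j m (dpow k) (dpow k) (dpow s)) + (\<Sum>p\<in>UNIV. ?T q p j m i (dpow k) (dpow s) (dpow k))
      + (\<Sum>p\<in>UNIV. ?T q p m i j (dpow s) (dpow k) (dpow k)) = 0"
  proof (rule symbol_of_eq_zero[OF S123])
    fix a b c :: real
    have *: "- b - c - a = - a - b - c" "- c - a - b = - a - b - c" by auto
    show "(\<Sum>p\<in>UNIV. ?S q p i j m a b c) + (\<Sum>p\<in>UNIV. ?S q p j m i b c a) + (\<Sum>p\<in>UNIV. ?S q p m i j c a b) = 0"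
      using jacobi_quadratic[OF U u Q P, of i j b a q m c]
      unfolding lin_form_def quad_form_def g_def * .
  qed
  \<comment> \<open>Here s < k matters: \<partial>^k (x^s) = 0 removes the quadratic coefficients,
    just as the anchor vanishes in degree s.\<close>
  moreover have "?T q p i j m (dpow k) (dpow k) (dpow s) = smult (B p i j * A q p m) (dpow s)" for p
    using s by (simp add: hop_dpow hop_smult_left pd_dpow A_def B_def mult.commute)
  moreover have dl: "lin_symb k Q t p i j differentiable (at u)" if "t \<le> k" for t p i j
    by (rule smooth_differentiable[OF smooth_lin_symb[OF that] u])
  \<comment> \<open>In the two other cyclic terms \<partial>^k (dpow k) = 1, and the surviving
    quadratic coefficients are u-derivatives of linear ones by \<open>quad_symb_0\<close>.\<close>
  have q1: "qop k (?d p q i j) f g' 1 = hop k (\<lambda>r. partial p (lin_symb k Q r q i j) u) f g'" for p i j f g'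
    unfolding qop_one hop_def by (intro sum.cong refl) (simp add: quad_symb_0[OF u])
  have dA: "act_coeff k s (\<lambda>t. partial p (lin_symb k Q t q i j) u) = dA p q i j" for p i j
  proof -
    have "dA p q i j = (\<Sum>t\<le>s. partial p (\<lambda>u. (-1) ^ (k - t) * real (k + s - t choose k) * lin_symb k Q t q i j u) u)"
      unfolding dA_def act_coeff_def
      by (rule partial_sum) (use dl s in \<open>auto intro!: differentiable_mult\<close>)
    also have "\<dots> = act_coeff k s (\<lambda>t. partial p (lin_symb k Q t q i j) u)"
      unfolding act_coeff_def using dl s by (intro sum.cong refl partial_cmult) auto
    finally show ?thesis ..
  qed
  \<comment> \<open>The relation \<open>coact_coeff_eq\<close> holds on all of U, so it may be
    differentiated at u.\<close>
  have dC: "coact_coeff k s (\<lambda>t. partial p (lin_symb k Q t q i j) u) = - dA p q j i" for p i j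
  proof -
    have "coact_coeff k s (\<lambda>t. partial p (lin_symb k Q t q i j) u)
        = (\<Sum>t\<le>k. partial p (\<lambda>u. (-1) ^ (k - t) * real (k + s - t choose s) * lin_symb k Q t q i j u) u)"
      unfolding coact_coeff_def using dl by (intro sum.cong refl partial_cmult[symmetric]) auto
    also have "\<dots> = partial p (\<lambda>u. coact_coeff k s (\<lambda>t. lin_symb k Q t q i j u)) u"
      unfolding coact_coeff_def by (rule partial_sum[symmetric]) (use dl in \<open>auto intro!: differentiable_mult\<close>)
    also have "\<dots> = partial p (\<lambda>u. (-1) * frame_coeff k s Q q j i u) u"
      by (rule partial_cong[OF U u]) (use coact_coeff_eq s in auto)
    also have "\<dots> = - dA p q j i"
      unfolding dA_def
      by (subst partial_cmult) (use dl s in \<open>auto simp: act_coeff_def intro!: differentiable_sum differentiable_mult\<close>)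
    finally show ?thesis .
  qed
  have "?T q p j m i (dpow k) (dpow s) (dpow k) = smult (g p i * dA p q j m - A p j m * A q i p) (dpow s)" for p
    using s coact_coeff_eq[OF u, of s q p i]
    by (simp add: hop_dpow hop_dpow' hop_smult_left hop_minus_left pd_dpow dpow_0 q1 dA A_def
        smult_diff_left mult.commute flip: smult_add_left)
  moreover have "?T q p m i j (dpow s) (dpow k) (dpow k) = smult (A p i m * A q j p - g p j * dA p q i m) (dpow s)" for p
    using s coact_coeff_eq[OF u, of s q p j] coact_coeff_eq[OF u, of s p m i]
    by (simp add: hop_dpow' hop_smult_left hop_minus_left pd_dpow dpow_0 q1 dC A_def
        smult_diff_left mult.commute flip: smult_add_left)
  ultimately have "coeff ((\<Sum>p\<in>UNIV. smult (B p i j * A q p m) (dpow s)) + (\<Sum>p\<in>UNIV. smult (g p i * dA p q j m - A p j m * A q i p) (dpow s))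
      + (\<Sum>p\<in>UNIV. smult (A p i m * A q j p - g p j * dA p q i m) (dpow s))) s = 0" by simp
  then have "((\<Sum>p\<in>UNIV. B p i j * A q p m) + (\<Sum>p\<in>UNIV. g p i * dA p q j m - A p j m * A q i p)
    + (\<Sum>p\<in>UNIV. A p i m * A q j p - g p j * dA p q i m)) / fact s = 0"
    by (simp add: coeff_sum dpow_def sum_divide_distrib add_divide_distrib)
  then show ?thesis by simp
qed

end

section \<open>Curvature\<close>

text \<open>Component l of R(\<partial>_i, \<partial>_j) \<partial>_m.\<close>

definition riemann :: "'n::finite christoffel \<Rightarrow> 'n \<Rightarrow> 'n \<Rightarrow> 'n \<Rightarrow> 'n \<Rightarrow> real^'n \<Rightarrow> real" where
  "riemann \<Gamma> i j m l u = partial i (\<Gamma> j m l) u - partial j (\<Gamma> i m l) u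
    + (\<Sum>p\<in>UNIV. \<Gamma> i p l u * \<Gamma> j m p u - \<Gamma> j p l u * \<Gamma> i m p u)"

lemma cov_deriv_component: "cov_deriv \<Gamma> X Y u $ l = (\<Sum>i\<in>UNIV. X u $ i * partial i (\<lambda>v. Y v $ l) u) +
     (\<Sum>i\<in>UNIV. \<Sum>j\<in>UNIV. \<Gamma> i j l u * X u $ i * Y u $ j)"
  by (simp add: cov_deriv_def)

text \<open>Tensoriality of the curvature: all derivatives of X, Y and Z cancel, the derivatives of
  X and Y against the Lie bracket term.\<close>

lemma curvature_cov_deriv:
  fixes \<Gamma> :: "'n::finite christoffel"
  assumes U: "open U" and u: "u \<in> U" and \<Gamma>: "\<And>i j l. smooth_fun_on U (\<Gamma> i j l)"
    and X: "smooth_map_on U X" and Y: "smooth_map_on U Y" and Z: "smooth_map_on U Z"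
  shows "curvature (cov_deriv \<Gamma>) X Y Z u $ l =
    (\<Sum>i\<in>UNIV. \<Sum>j\<in>UNIV. \<Sum>m\<in>UNIV. riemann \<Gamma> i j m l u * X u $ i * Y u $ j * Z u $ m)"
proof -
  define x y z where "x = (\<lambda>i. X u $ i)" and "y = (\<lambda>i. Y u $ i)" and "z = (\<lambda>i. Z u $ i)"
  define dx dy dz where "dx = (\<lambda>i j. partial i (\<lambda>v. X v $ j) u)"
    and "dy = (\<lambda>i j. partial i (\<lambda>v. Y v $ j) u)" and "dz = (\<lambda>i j. partial i (\<lambda>v. Z v $ j) u)"
  define ddz where "ddz = (\<lambda>i j l. partial i (partial j (\<lambda>v. Z v $ l)) u)"
  define G where "G = (\<lambda>i j l. \<Gamma> i j l u)"
  define dG where "dG = (\<lambda>i j m l. partial i (\<Gamma> j m l) u)"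
  have d: "\<Gamma> i j l differentiable (at u)" for i j l using \<Gamma> u by (rule smooth_differentiable)
  have sZ: "smooth_fun_on U (\<lambda>v. Z v $ l)" for l using Z by (simp add: smooth_map_on_def)
  have ddz: "ddz i j l = ddz j i l" for i j l
    unfolding ddz_def by (rule smooth_partial_commute[OF U sZ u])
  \<comment> \<open>Stated for arbitrary V and W so as to serve both orders of differentiation; the
    sums are sorted by which derivatives they contain.\<close>
  have main: "cov_deriv \<Gamma> V (cov_deriv \<Gamma> W Z) u $ l =
      (\<Sum>i\<in>UNIV. \<Sum>j\<in>UNIV. V u $ i * partial i (\<lambda>v. W v $ j) u * dz j l)
    + (\<Sum>i\<in>UNIV. \<Sum>j\<in>UNIV. V u $ i * W u $ j * ddz i j l)
    + (\<Sum>i\<in>UNIV. \<Sum>j\<in>UNIV. \<Sum>m\<in>UNIV. dG i j m l * V u $ i * W u $ j * z m)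
    + (\<Sum>i\<in>UNIV. \<Sum>j\<in>UNIV. \<Sum>m\<in>UNIV. V u $ i * partial i (\<lambda>v. W v $ j) u * z m * G j m l)
    + (\<Sum>i\<in>UNIV. \<Sum>j\<in>UNIV. \<Sum>m\<in>UNIV. V u $ i * W u $ j * dz i m * G j m l)
    + (\<Sum>i\<in>UNIV. \<Sum>j\<in>UNIV. \<Sum>m\<in>UNIV. V u $ i * W u $ j * dz j m * G i m l)
    + (\<Sum>i\<in>UNIV. \<Sum>j\<in>UNIV. \<Sum>m\<in>UNIV. (\<Sum>p\<in>UNIV. G i p l * G j m p) * V u $ i * W u $ j * z m)"
    if V: "smooth_map_on U V" and W: "smooth_map_on U W" for V W l
  proof -
    have dW: "(\<lambda>v. W v $ l) differentiable (at u)" and dZ: "(\<lambda>v. Z v $ l) differentiable (at u)"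
      and dZ': "partial j (\<lambda>v. Z v $ l) differentiable (at u)" for l j
      using W Z u by (auto simp: smooth_map_on_def intro!: smooth_differentiable smooth_partial)
    have "partial i (\<lambda>v. cov_deriv \<Gamma> W Z v $ l) u =
        (\<Sum>j\<in>UNIV. partial i (\<lambda>v. W v $ j) u * dz j l) + (\<Sum>j\<in>UNIV. W u $ j * ddz i j l)
        + (\<Sum>j\<in>UNIV. \<Sum>m\<in>UNIV. dG i j m l * W u $ j * z m)
        + (\<Sum>j\<in>UNIV. \<Sum>m\<in>UNIV. partial i (\<lambda>v. W v $ j) u * z m * G j m l)
        + (\<Sum>j\<in>UNIV. \<Sum>m\<in>UNIV. W u $ j * dz i m * G j m l)" for i
    proof -
      have "partial i (\<lambda>v. \<Sum>j\<in>UNIV. W v $ j * partial j (\<lambda>v. Z v $ l) v) u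
          = (\<Sum>j\<in>UNIV. W u $ j * ddz i j l + partial i (\<lambda>v. W v $ j) u * dz j l)"
        by (subst partial_sum) (auto simp: partial_mult dW dZ' ddz_def dz_def)
      moreover have "partial i (\<lambda>v. \<Sum>j\<in>UNIV. \<Sum>m\<in>UNIV. \<Gamma> j m l v * W v $ j * Z v $ m) u
          = (\<Sum>j\<in>UNIV. \<Sum>m\<in>UNIV. dG i j m l * W u $ j * z m + partial i (\<lambda>v. W v $ j) u * z m * G j m l
            + W u $ j * dz i m * G j m l)"
        by (subst partial_sum, (auto intro!: differentiable_sum differentiable_mult d dW dZ)[1],
            subst partial_sum, (auto intro!: differentiable_mult d dW dZ)[1])
          (simp add: partial_mult d dW dZ differentiable_mult dG_def z_def dz_def G_def algebra_simps)
      ultimately show ?thesis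
        unfolding cov_deriv_component
        by (subst partial_add)
          (auto intro!: differentiable_sum differentiable_mult d dW dZ dZ' simp: sum.distrib algebra_simps)
    qed
    moreover have "(\<Sum>i\<in>UNIV. \<Sum>p\<in>UNIV. \<Gamma> i p l u * V u $ i * cov_deriv \<Gamma> W Z u $ p) =
        (\<Sum>i\<in>UNIV. \<Sum>j\<in>UNIV. \<Sum>m\<in>UNIV. V u $ i * W u $ j * dz j m * G i m l)
        + (\<Sum>i\<in>UNIV. \<Sum>j\<in>UNIV. \<Sum>m\<in>UNIV. (\<Sum>p\<in>UNIV. G i p l * G j m p) * V u $ i * W u $ j * z m)"
    proof -
      have "(\<Sum>p\<in>UNIV. \<Gamma> i p l u * V u $ i * cov_deriv \<Gamma> W Z u $ p) =
          (\<Sum>j\<in>UNIV. \<Sum>m\<in>UNIV. V u $ i * W u $ j * dz j m * G i m l)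
          + (\<Sum>j\<in>UNIV. \<Sum>m\<in>UNIV. (\<Sum>p\<in>UNIV. G i p l * G j m p) * V u $ i * W u $ j * z m)" for i
      proof -
        have "(\<Sum>p\<in>UNIV. \<Gamma> i p l u * V u $ i * cov_deriv \<Gamma> W Z u $ p) =
            (\<Sum>p\<in>UNIV. \<Sum>j\<in>UNIV. V u $ i * W u $ j * dz j p * G i p l)
            + (\<Sum>p\<in>UNIV. \<Sum>j\<in>UNIV. \<Sum>m\<in>UNIV. G i p l * G j m p * V u $ i * W u $ j * z m)"
          unfolding cov_deriv_component
          by (simp add: distrib_left sum_distrib_left sum.distrib G_def z_def dz_def mult_ac)
        moreover have "(\<Sum>p\<in>UNIV. \<Sum>j\<in>UNIV. V u $ i * W u $ j * dz j p * G i p l)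
            = (\<Sum>j\<in>UNIV. \<Sum>p\<in>UNIV. V u $ i * W u $ j * dz j p * G i p l)"
          by (rule sum.swap)
        moreover have "(\<Sum>p\<in>UNIV. \<Sum>j\<in>UNIV. \<Sum>m\<in>UNIV. G i p l * G j m p * V u $ i * W u $ j * z m)
            = (\<Sum>j\<in>UNIV. \<Sum>m\<in>UNIV. \<Sum>p\<in>UNIV. G i p l * G j m p * V u $ i * W u $ j * z m)"
          by (subst sum.swap, rule sum.cong[OF refl], rule sum.swap)
        ultimately show ?thesis by (simp add: sum_distrib_right)
      qed
      then show ?thesis by (simp add: sum.distrib)
    qed
    ultimately show ?thesis
      by (simp add: cov_deriv_component[of \<Gamma> V] distrib_left sum_distrib_left sum.distrib mult_ac)
  qed
  have b: "cov_deriv \<Gamma> (lie_bracket X Y) Z u $ l =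
      (\<Sum>i\<in>UNIV. \<Sum>j\<in>UNIV. x i * dy i j * dz j l) - (\<Sum>i\<in>UNIV. \<Sum>j\<in>UNIV. y i * dx i j * dz j l)
    + (\<Sum>i\<in>UNIV. \<Sum>j\<in>UNIV. \<Sum>m\<in>UNIV. x i * dy i j * z m * G j m l)
    - (\<Sum>i\<in>UNIV. \<Sum>j\<in>UNIV. \<Sum>m\<in>UNIV. y i * dx i j * z m * G j m l)"
  proof -
    have lb: "lie_bracket X Y u $ j = (\<Sum>i\<in>UNIV. x i * dy i j - y i * dx i j)" for j
      by (simp add: lie_bracket_def x_def y_def dx_def dy_def)
    have "(\<Sum>j\<in>UNIV. lie_bracket X Y u $ j * dz j l)
        = (\<Sum>i\<in>UNIV. \<Sum>j\<in>UNIV. x i * dy i j * dz j l) - (\<Sum>i\<in>UNIV. \<Sum>j\<in>UNIV. y i * dx i j * dz j l)"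
    proof -
      have "(\<Sum>j\<in>UNIV. lie_bracket X Y u $ j * dz j l)
          = (\<Sum>j\<in>UNIV. \<Sum>i\<in>UNIV. x i * dy i j * dz j l - y i * dx i j * dz j l)"
        by (simp add: lb sum_distrib_right left_diff_distrib)
      also have "\<dots> = (\<Sum>i\<in>UNIV. \<Sum>j\<in>UNIV. x i * dy i j * dz j l - y i * dx i j * dz j l)"
        by (rule sum.swap)
      finally show ?thesis by (simp add: sum_subtractf)
    qed
    moreover have "(\<Sum>j\<in>UNIV. \<Sum>m\<in>UNIV. \<Gamma> j m l u * lie_bracket X Y u $ j * Z u $ m)
        = (\<Sum>i\<in>UNIV. \<Sum>j\<in>UNIV. \<Sum>m\<in>UNIV. x i * dy i j * z m * G j m l)
        - (\<Sum>i\<in>UNIV. \<Sum>j\<in>UNIV. \<Sum>m\<in>UNIV. y i * dx i j * z m * G j m l)"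
    proof -
      have "(\<Sum>j\<in>UNIV. \<Sum>m\<in>UNIV. \<Gamma> j m l u * lie_bracket X Y u $ j * Z u $ m)
          = (\<Sum>j\<in>UNIV. \<Sum>m\<in>UNIV. \<Sum>i\<in>UNIV. x i * dy i j * z m * G j m l - y i * dx i j * z m * G j m l)"
        by (simp add: lb sum_distrib_left sum_distrib_right algebra_simps G_def z_def)
      also have "\<dots> = (\<Sum>j\<in>UNIV. \<Sum>i\<in>UNIV. \<Sum>m\<in>UNIV. x i * dy i j * z m * G j m l - y i * dx i j * z m * G j m l)"
        by (rule sum.cong[OF refl], rule sum.swap)
      also have "\<dots> = (\<Sum>i\<in>UNIV. \<Sum>j\<in>UNIV. \<Sum>m\<in>UNIV. x i * dy i j * z m * G j m l - y i * dx i j * z m * G j m l)"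
        by (rule sum.swap)
      finally show ?thesis by (simp add: sum_subtractf)
    qed
    ultimately show ?thesis by (simp add: cov_deriv_component dz_def)
  qed
  \<comment> \<open>These exchanges of the names i and j bring the expansion for the order Y, X to
    the indexing of the order X, Y; the first also uses symmetry of the second derivatives of
    Z.\<close>
  have s1: "(\<Sum>i\<in>UNIV. \<Sum>j\<in>UNIV. y i * x j * ddz i j l) = (\<Sum>i\<in>UNIV. \<Sum>j\<in>UNIV. x i * y j * ddz i j l)"
    by (subst sum.swap) (intro sum.cong refl, subst ddz, simp)
  have s2: "(\<Sum>i\<in>UNIV. \<Sum>j\<in>UNIV. \<Sum>m\<in>UNIV. y i * x j * dz i m * G j m l)
      = (\<Sum>i\<in>UNIV. \<Sum>j\<in>UNIV. \<Sum>m\<in>UNIV. x i * y j * dz j m * G i m l)"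
    by (subst sum.swap) (simp add: mult_ac)
  have s3: "(\<Sum>i\<in>UNIV. \<Sum>j\<in>UNIV. \<Sum>m\<in>UNIV. y i * x j * dz j m * G i m l)
      = (\<Sum>i\<in>UNIV. \<Sum>j\<in>UNIV. \<Sum>m\<in>UNIV. x i * y j * dz i m * G j m l)"
    by (subst sum.swap) (simp add: mult_ac)
  have s4: "(\<Sum>i\<in>UNIV. \<Sum>j\<in>UNIV. \<Sum>m\<in>UNIV. dG i j m l * y i * x j * z m)
      = (\<Sum>i\<in>UNIV. \<Sum>j\<in>UNIV. \<Sum>m\<in>UNIV. dG j i m l * x i * y j * z m)"
    by (subst sum.swap) (simp add: mult_ac)
  have s5: "(\<Sum>i\<in>UNIV. \<Sum>j\<in>UNIV. \<Sum>m\<in>UNIV. (\<Sum>p\<in>UNIV. G i p l * G j m p) * y i * x j * z m)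
      = (\<Sum>i\<in>UNIV. \<Sum>j\<in>UNIV. \<Sum>m\<in>UNIV. (\<Sum>p\<in>UNIV. G j p l * G i m p) * x i * y j * z m)"
    by (subst sum.swap) (simp add: mult_ac)
  have "curvature (cov_deriv \<Gamma>) X Y Z u $ l =
      (\<Sum>i\<in>UNIV. \<Sum>j\<in>UNIV. \<Sum>m\<in>UNIV. dG i j m l * x i * y j * z m)
    - (\<Sum>i\<in>UNIV. \<Sum>j\<in>UNIV. \<Sum>m\<in>UNIV. dG j i m l * x i * y j * z m)
    + (\<Sum>i\<in>UNIV. \<Sum>j\<in>UNIV. \<Sum>m\<in>UNIV. (\<Sum>p\<in>UNIV. G i p l * G j m p) * x i * y j * z m)
    - (\<Sum>i\<in>UNIV. \<Sum>j\<in>UNIV. \<Sum>m\<in>UNIV. (\<Sum>p\<in>UNIV. G j p l * G i m p) * x i * y j * z m)"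
    unfolding curvature_def vector_minus_component main[OF X Y] main[OF Y X] b
    using s1 s2 s3 s4 s5 by (simp add: x_def y_def dx_def dy_def)
  also have "\<dots> = (\<Sum>i\<in>UNIV. \<Sum>j\<in>UNIV. \<Sum>m\<in>UNIV. (dG i j m l - dG j i m l
      + (\<Sum>p\<in>UNIV. G i p l * G j m p - G j p l * G i m p)) * x i * y j * z m)"
    by (simp add: sum.distrib sum_subtractf left_diff_distrib distrib_right)
  finally show ?thesis
    by (simp add: riemann_def dG_def G_def x_def y_def z_def)
qed

text \<open>Cramer's rule exhibits the entries of the inverse as quotients of determinants, from
  which their smoothness follows.\<close>

lemma matrix_inv_component:
  fixes A :: "real^'n::finite^'n"
  assumes "invertible A"
  shows "matrix_inv A $ i $ j = det (\<chi> a b. if b = i then axis j 1 $ a else A $ a $ b) * inverse (det A)"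
proof -
  have "A ** matrix_inv A = mat 1"
    using assms by (simp add: invertible_def matrix_inv_def) (metis (mono_tags, lifting) someI_ex)
  then have "(A ** matrix_inv A) *v axis j 1 = axis j 1" by simp
  then have "A *v (matrix_inv A *v axis j 1) = axis j 1"
    by (simp add: matrix_vector_mul_assoc)
  then have "matrix_inv A *v axis j 1 = (\<chi> k. det (\<chi> a b. if b = k then axis j 1 $ a else A $ a $ b) / det A)"
    using cramer[of A] assms invertible_det_nz by blast
  moreover have "(matrix_inv A *v axis j 1) $ i = matrix_inv A $ i $ j"
    by (simp add: matrix_vector_mult_basis column_def)
  ultimately show ?thesis by (simp add: divide_inverse)
qed

lemma smooth_det:
  assumes "open U" "\<And>a b. smooth_fun_on U (\<lambda>u. M u $ a $ b)"
  shows "smooth_fun_on U (\<lambda>u. det (M u))"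
  unfolding det_def using assms by (intro smooth_sum smooth_mult smooth_prod smooth_const) auto

lemma smooth_matrix_inv:
  fixes M :: "real^'n::finite \<Rightarrow> real^'n^'n"
  assumes U: "open U" and M: "\<And>a b. smooth_fun_on U (\<lambda>u. M u $ a $ b)"
    and inv: "\<And>u. u \<in> U \<Longrightarrow> invertible (M u)"
  shows "smooth_fun_on U (\<lambda>u. matrix_inv (M u) $ i $ j)"
proof -
  let ?N = "\<lambda>u. \<chi> a b. if b = i then axis j 1 $ a else M u $ a $ b"
  have "smooth_fun_on U (\<lambda>u. ?N u $ a $ b)" for a b
    using M by (cases "b = i") (auto intro: smooth_const[OF U])
  then have "smooth_fun_on U (\<lambda>u. det (?N u) * inverse (det (M u)))"
    using inv M by (intro smooth_mult[OF U] smooth_inverse[OF U] smooth_det[OF U]) (auto simp: invertible_det_nz)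
  then show ?thesis
    by (subst smooth_cong[OF U]) (auto simp: matrix_inv_component inv)
qed

lemma matrix_inv_cancel:
  fixes A :: "real^'n::finite^'n"
  assumes "invertible A"
  shows "(\<Sum>r\<in>UNIV. A $ i $ r * matrix_inv A $ r $ j) = (if i = j then 1 else 0)"
    and "(\<Sum>r\<in>UNIV. matrix_inv A $ i $ r * A $ r $ j) = (if i = j then 1 else 0)"
proof -
  have "A ** matrix_inv A = mat 1 \<and> matrix_inv A ** A = mat 1"
    using assms unfolding invertible_def matrix_inv_def by (rule someI_ex)
  then have "(A ** matrix_inv A) $ i $ j = (if i = j then 1 else 0)"
    "(matrix_inv A ** A) $ i $ j = (if i = j then 1 else 0)" by (auto simp: mat_def)
  then show "(\<Sum>r\<in>UNIV. A $ i $ r * matrix_inv A $ r $ j) = (if i = j then 1 else 0)"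
    "(\<Sum>r\<in>UNIV. matrix_inv A $ i $ r * A $ r $ j) = (if i = j then 1 else 0)"
    by (simp_all add: matrix_matrix_mult_def)
qed

text \<open>The vector fields \<open>X\<^sub>i = g\<^sup>p\<^sup>i \<partial>\<^sub>p\<close> form a frame, and \<open>A\<close> consists of the connection forms
  evaluated on it; the two structure identities say that the curvature vanishes on this frame.\<close>

lemma riemann_zero_from_frame:
  fixes g :: "'n::finite \<Rightarrow> 'n \<Rightarrow> real^'n \<Rightarrow> real" and ginv :: "'n \<Rightarrow> 'n \<Rightarrow> real" and B :: "'n \<Rightarrow> 'n \<Rightarrow> 'n \<Rightarrow> real"
  assumes U: "open U" and u: "u \<in> U"
    and g: "\<And>i j. g i j differentiable (at u)" and \<Gamma>: "\<And>i j l. \<Gamma> i j l differentiable (at u)"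
    and A: "\<And>v q i m. v \<in> U \<Longrightarrow> A q i m v = (\<Sum>r\<in>UNIV. g r i v * \<Gamma> r q m v)"
    and inv: "\<And>i j. (\<Sum>r\<in>UNIV. g i r u * ginv r j) = (if i = j then 1 else 0)"
    and anchor: "\<And>i j r. (\<Sum>p\<in>UNIV. B p i j * g r p u) + (\<Sum>p\<in>UNIV. g p i u * partial p (g r j) u)
      - (\<Sum>p\<in>UNIV. g p j u * partial p (g r i) u) = 0"
    and action: "\<And>i j q m. (\<Sum>p\<in>UNIV. B p i j * A q p m u) + (\<Sum>p\<in>UNIV. g p i u * partial p (A q j m) u - A p j m u * A q i p u)
      + (\<Sum>p\<in>UNIV. A p i m u * A q j p u - g p j u * partial p (A q i m) u) = 0"
  shows "riemann \<Gamma> a b q m u = 0"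
proof -
  have dA: "partial p (A q j m) u = (\<Sum>r\<in>UNIV. g r j u * partial p (\<Gamma> r q m) u + partial p (g r j) u * \<Gamma> r q m u)" for p q j m
  proof -
    have "partial p (A q j m) u = partial p (\<lambda>v. \<Sum>r\<in>UNIV. g r j v * \<Gamma> r q m v) u"
      by (rule partial_cong[OF U u]) (rule A)
    then show ?thesis using g \<Gamma> by (simp add: partial_sum partial_mult)
  qed
  have gd: "(\<Sum>p\<in>UNIV. g p i u * partial p (A q j m) u)
      = (\<Sum>p\<in>UNIV. \<Sum>r\<in>UNIV. g p i u * g r j u * partial p (\<Gamma> r q m) u)
        + (\<Sum>r\<in>UNIV. (\<Sum>p\<in>UNIV. g p i u * partial p (g r j) u) * \<Gamma> r q m u)" for i j q m
  proof -
    have "(\<Sum>p\<in>UNIV. g p i u * partial p (A q j m) u)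
        = (\<Sum>p\<in>UNIV. \<Sum>r\<in>UNIV. g p i u * g r j u * partial p (\<Gamma> r q m) u)
        + (\<Sum>p\<in>UNIV. \<Sum>r\<in>UNIV. g p i u * partial p (g r j) u * \<Gamma> r q m u)"
      by (simp add: dA sum_distrib_left distrib_left sum.distrib mult.assoc)
    moreover have "(\<Sum>p\<in>UNIV. \<Sum>r\<in>UNIV. g p i u * partial p (g r j) u * \<Gamma> r q m u)
        = (\<Sum>r\<in>UNIV. \<Sum>p\<in>UNIV. g p i u * partial p (g r j) u * \<Gamma> r q m u)"
      by (rule sum.swap)
    ultimately show ?thesis by (simp add: sum_distrib_right)
  qed
  have gd': "(\<Sum>p\<in>UNIV. g p j u * partial p (A q i m) u)
      = (\<Sum>p\<in>UNIV. \<Sum>r\<in>UNIV. g p i u * g r j u * partial r (\<Gamma> p q m) u)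
        + (\<Sum>r\<in>UNIV. (\<Sum>p\<in>UNIV. g p j u * partial p (g r i) u) * \<Gamma> r q m u)" for i j q m
  proof -
    have "(\<Sum>p\<in>UNIV. \<Sum>r\<in>UNIV. g p j u * g r i u * partial p (\<Gamma> r q m) u)
        = (\<Sum>p\<in>UNIV. \<Sum>r\<in>UNIV. g p i u * g r j u * partial r (\<Gamma> p q m) u)"
      by (subst sum.swap) (simp add: mult_ac)
    then show ?thesis using gd[where i = j and j = i] by simp
  qed
  have BA: "(\<Sum>p\<in>UNIV. B p i j * A q p m u) = (\<Sum>r\<in>UNIV. (\<Sum>p\<in>UNIV. B p i j * g r p u) * \<Gamma> r q m u)" for i j q m
  proof -
    have "(\<Sum>p\<in>UNIV. B p i j * A q p m u) = (\<Sum>p\<in>UNIV. \<Sum>r\<in>UNIV. B p i j * g r p u * \<Gamma> r q m u)"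
      by (simp add: A[OF u] sum_distrib_left mult.assoc)
    also have "\<dots> = (\<Sum>r\<in>UNIV. \<Sum>p\<in>UNIV. B p i j * g r p u * \<Gamma> r q m u)" by (rule sum.swap)
    finally show ?thesis by (simp add: sum_distrib_right)
  qed
  have AA: "(\<Sum>p\<in>UNIV. A p i m u * A q j p u)
      = (\<Sum>a\<in>UNIV. \<Sum>b\<in>UNIV. g a i u * g b j u * (\<Sum>p\<in>UNIV. \<Gamma> a p m u * \<Gamma> b q p u))" for i j q m
  proof -
    have "(\<Sum>p\<in>UNIV. A p i m u * A q j p u)
        = (\<Sum>p\<in>UNIV. \<Sum>a\<in>UNIV. \<Sum>b\<in>UNIV. g a i u * g b j u * (\<Gamma> a p m u * \<Gamma> b q p u))"
      by (simp add: A[OF u] sum_product mult_ac)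
    also have "\<dots> = (\<Sum>a\<in>UNIV. \<Sum>b\<in>UNIV. \<Sum>p\<in>UNIV. g a i u * g b j u * (\<Gamma> a p m u * \<Gamma> b q p u))"
      by (subst sum.swap, rule sum.cong[OF refl], rule sum.swap)
    finally show ?thesis by (simp add: sum_distrib_left)
  qed
  have AA': "(\<Sum>p\<in>UNIV. A p j m u * A q i p u)
      = (\<Sum>a\<in>UNIV. \<Sum>b\<in>UNIV. g a i u * g b j u * (\<Sum>p\<in>UNIV. \<Gamma> b p m u * \<Gamma> a q p u))" for i j q m
    unfolding AA by (subst sum.swap) (simp add: mult_ac)
  have R: "(\<Sum>a\<in>UNIV. \<Sum>b\<in>UNIV. g a i u * g b j u * riemann \<Gamma> a b q m u) = 0" for i j
  proof -
    \<comment> \<open>The anchor identity contracted with the Christoffel symbols accounts for every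
      term containing a derivative of g.\<close>
    have E: "(\<Sum>r\<in>UNIV. (\<Sum>p\<in>UNIV. B p i j * g r p u) * \<Gamma> r q m u)
        + (\<Sum>r\<in>UNIV. (\<Sum>p\<in>UNIV. g p i u * partial p (g r j) u) * \<Gamma> r q m u)
        - (\<Sum>r\<in>UNIV. (\<Sum>p\<in>UNIV. g p j u * partial p (g r i) u) * \<Gamma> r q m u) = 0"
    proof -
      have "(\<Sum>r\<in>UNIV. ((\<Sum>p\<in>UNIV. B p i j * g r p u) + (\<Sum>p\<in>UNIV. g p i u * partial p (g r j) u)
          - (\<Sum>p\<in>UNIV. g p j u * partial p (g r i) u)) * \<Gamma> r q m u) = 0"
        unfolding anchor by simp
      then show ?thesis by (simp only: distrib_right left_diff_distrib sum.distrib sum_subtractf)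
    qed
    have "(\<Sum>a\<in>UNIV. \<Sum>b\<in>UNIV. g a i u * g b j u * riemann \<Gamma> a b q m u) =
        (\<Sum>a\<in>UNIV. \<Sum>b\<in>UNIV. g a i u * g b j u * partial a (\<Gamma> b q m) u)
      - (\<Sum>a\<in>UNIV. \<Sum>b\<in>UNIV. g a i u * g b j u * partial b (\<Gamma> a q m) u)
      + (\<Sum>a\<in>UNIV. \<Sum>b\<in>UNIV. g a i u * g b j u * (\<Sum>p\<in>UNIV. \<Gamma> a p m u * \<Gamma> b q p u))
      - (\<Sum>a\<in>UNIV. \<Sum>b\<in>UNIV. g a i u * g b j u * (\<Sum>p\<in>UNIV. \<Gamma> b p m u * \<Gamma> a q p u))"
      by (simp add: riemann_def sum_subtractf distrib_left right_diff_distrib sum.distrib)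
    also have "\<dots> = 0"
      using action[of i j q m, unfolded sum_subtractf] E BA[where i = i and j = j and q = q and m = m]
        gd[where i = i and j = j and q = q and m = m] gd'[where i = i and j = j and q = q and m = m]
        AA[where i = i and j = j and q = q and m = m] AA'[where i = i and j = j and q = q and m = m]
      by linarith
    finally show ?thesis .
  qed
  \<comment> \<open>Nondegeneracy of g removes a contracted frame index; it is applied once for each
    of the two directions.\<close>
  have kill: "v a = 0" if "\<And>i. (\<Sum>p\<in>UNIV. g p i u * v p) = 0" for v :: "'n \<Rightarrow> real" and a
  proof -
    have "0 = (\<Sum>i\<in>UNIV. (\<Sum>p\<in>UNIV. g p i u * v p) * ginv i a)" using that by simp
    also have "\<dots> = (\<Sum>i\<in>UNIV. \<Sum>p\<in>UNIV. v p * (g p i u * ginv i a))"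
      unfolding sum_distrib_right by (simp add: mult_ac)
    also have "\<dots> = (\<Sum>p\<in>UNIV. \<Sum>i\<in>UNIV. v p * (g p i u * ginv i a))" by (rule sum.swap)
    also have "\<dots> = (\<Sum>p\<in>UNIV. v p * (if p = a then 1 else 0))"
      by (simp add: inv flip: sum_distrib_left)
    also have "\<dots> = v a" by (simp add: if_distrib sum.delta cong: if_cong)
    finally show ?thesis by simp
  qed
  have "(\<Sum>b\<in>UNIV. g b j u * riemann \<Gamma> a b q m u) = 0" for a j
    by (rule kill) (use R in \<open>simp add: sum_distrib_left mult_ac\<close>)
  then show ?thesis by (rule kill)
qed

section \<open>Transformation of the Christoffel symbols\<close>

text \<open>The coefficient of x^s in (1 - x)^a (1 - x)^(-k-1). The case a = k normalizes the
  coefficients of the combined connections; general a is what the induction by Pascal's rule runs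
  over.\<close>

lemma sum_alternating_binomial:
  assumes "a \<le> k"
  shows "(\<Sum>t\<le>s. (-1) ^ t * real (a choose t) * real (k + s - t choose k)) = real (k - a + s choose s)"
  using assms
proof (induction a arbitrary: s)
  case 0
  have "(\<Sum>t\<le>s. (-1) ^ t * real (0 choose t) * real (k + s - t choose k)) = (\<Sum>t\<in>{0}. (-1) ^ t * real (0 choose t) * real (k + s - t choose k))"
    by (intro sum.mono_neutral_right) auto
  then show ?case using binomial_symmetric[of k "k + s"] by simp
next
  case (Suc a)
  define r where "r = k - Suc a"
  have ka: "k - a = Suc r" "k - Suc a = r" using Suc.prems by (auto simp: r_def)
  show ?case
  proof (cases s)
    case (Suc s')
    have "(\<Sum>t\<le>s. (-1) ^ t * real (Suc a choose t) * real (k + s - t choose k)) =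
        real (k + s choose k) + (\<Sum>t\<le>s'. (-1) ^ Suc t * real (Suc a choose Suc t) * real (k + s' - t choose k))"
      unfolding Suc sum.atMost_Suc_shift[of _ s'] by simp
    also have "\<dots> = real (k + s choose k) + (\<Sum>t\<le>s'. (-1) ^ Suc t * real (a choose Suc t) * real (k + s' - t choose k))
        - (\<Sum>t\<le>s'. (-1) ^ t * real (a choose t) * real (k + s' - t choose k))"
    proof -
      have "(\<Sum>t\<le>s'. (-1) ^ Suc t * real (Suc a choose Suc t) * real (k + s' - t choose k))
          = (\<Sum>t\<le>s'. (-1) ^ Suc t * real (a choose Suc t) * real (k + s' - t choose k)
              - (-1) ^ t * real (a choose t) * real (k + s' - t choose k))"
        by (intro sum.cong refl) (simp add: algebra_simps)
      then show ?thesis by (simp only: sum_subtractf)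
    qed
    also have "real (k + s choose k) + (\<Sum>t\<le>s'. (-1) ^ Suc t * real (a choose Suc t) * real (k + s' - t choose k))
        = (\<Sum>t\<le>s. (-1) ^ t * real (a choose t) * real (k + s - t choose k))"
      unfolding Suc sum.atMost_Suc_shift[of _ s'] by simp
    finally show ?thesis
      using Suc.IH[of s] Suc.IH[of s'] Suc.prems by (simp add: ka Suc)
  qed simp
qed

lemma sum_comb_coeff: "(\<Sum>t\<le>s. comb_coeff k s t) = 1"
proof -
  have "(\<Sum>t\<le>s. comb_coeff k s t) = (\<Sum>t\<le>s. (-1) ^ t * real (k choose t) * real (k + s - t choose k))"
    by (simp add: comb_coeff_def mult_ac)
  then show ?thesis using sum_alternating_binomial[of k k s] by simp
qed

section \<open>Linear parts of products, total derivatives and pullbacks\<close>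

lemma jcoeff_mult_single:
  "jcoeff (f * g) {#x#} u = jcoeff f {#} u * jcoeff g {#x#} u + jcoeff f {#x#} u * jcoeff g {#} u"
proof -
  have "msplits {#x#} = {({#}, {#x#}), ({#x#}, {#})}"
    by (auto simp: msplits_def union_is_single)
  then show ?thesis by (simp add: jcoeff_mult)
qed

lemma jcoeff_Dx_empty [simp]: "jcoeff (Dx f) {#} u = 0"
  by (simp add: jcoeff_Dx)

lemma jcoeff_Dx_single: "jcoeff (Dx f) {#(l, Suc s)#} u = jcoeff (jet_partial l s f) {#} u"
proof -
  have "{(i, s'). (i, Suc s') \<in># {#(l, Suc s)#}} = {(l, s)}" by auto
  then show ?thesis by (simp add: jcoeff_Dx)
qed

lemma jcoeff_Dx_pow_coord_empty: "n > 0 \<Longrightarrow> jcoeff ((Dx ^^ n) f) {#} u = 0"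
  by (cases n) auto

text \<open>The highest jet variable enters \<partial>_x^n f linearly, with the first derivative of
  f as coefficient.\<close>

lemma jcoeff_Dx_pow_coord_single:
  "n > 0 \<Longrightarrow> jcoeff ((Dx ^^ n) (coord_fun f)) {#(l, n)#} u = partial l f u"
proof (induction n)
  case (Suc n)
  show ?case
  proof (cases "n = 0")
    case True
    then show ?thesis by (simp add: jcoeff_Dx_single) (simp add: coord_fun_def)
  next
    case False
    then show ?thesis using Suc by (simp add: jcoeff_Dx_single jcoeff_jet_partial_pos)
  qed
qed simp

lemma size_le_sdeg: "(\<And>i. (i, 0) \<notin># p) \<Longrightarrow> size p \<le> sdeg p"
proof (induction p)
  case (add x p)
  have "snd x > 0" using add.prems by (metis gr0I prod.collapse union_single_eq_member)
  moreover have "size p \<le> sdeg p" using add by auto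
  ultimately show ?case by simp
qed simp

lemma mem_le_sdeg: "x \<in># p \<Longrightarrow> snd x \<le> sdeg p"
  by (metis insert_DiffM le_add1 sdeg_add_mset)

text \<open>When all variables have positive order, the degree bounds both the number of factors and
  their orders. Since a sum over an infinite set is 0 by convention, this finiteness is what gives
  \<open>jet_pullback\<close> its meaning.\<close>

lemma finite_positive_jets: "finite {p :: ('n::finite \<times> nat) multiset. sdeg p = d \<and> (\<forall>i. (i, 0) \<notin># p)}"
proof -
  have "{p :: ('n \<times> nat) multiset. sdeg p = d \<and> (\<forall>i. (i, 0) \<notin># p)}
      \<subseteq> mset ` {xs. set xs \<subseteq> UNIV \<times> {..d} \<and> length xs \<le> d}"
  proof
    fix p :: "('n \<times> nat) multiset" assume p: "p \<in> {p. sdeg p = d \<and> (\<forall>i. (i, 0) \<notin># p)}"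
    obtain xs where xs: "p = mset xs" by (metis ex_mset)
    have "size p \<le> d" using size_le_sdeg[of p] p by auto
    moreover have "set xs \<subseteq> UNIV \<times> {..d}" using mem_le_sdeg[of _ p] p xs by fastforce
    ultimately show "p \<in> mset ` {xs. set xs \<subseteq> UNIV \<times> {..d} \<and> length xs \<le> d}" using xs by auto
  qed
  then show ?thesis
    by (rule finite_subset) (intro finite_imageI finite_lists_length_le, simp)
qed

lemma jcoeff_jet_pullback_empty:
  fixes \<tau> :: "real^'n::finite \<Rightarrow> real^'n"
  shows "jcoeff (jet_pullback \<tau> f) {#} u = jcoeff f {#} (\<tau> u)"
proof -
  have "{p :: ('n::finite \<times> nat) multiset. sdeg p = 0 \<and> (\<forall>i. (i, 0) \<notin># p)} = {{#}}"
  proof (intro subset_antisym subsetI)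
    fix p :: "('n \<times> nat) multiset" assume "p \<in> {p. sdeg p = 0 \<and> (\<forall>i. (i, 0) \<notin># p)}"
    then show "p \<in> {{#}}" using size_le_sdeg[of p] by simp
  qed simp
  then show ?thesis by (simp add: jet_pullback_def jcoeff_one)
qed

text \<open>Each \<partial>_x^s \<tau>^i with s > 0 has no constant term, so a monomial with two or
  more factors contributes nothing linear.\<close>

lemma jcoeff_jet_pullback_single:
  assumes "n > 0"
  shows "jcoeff (jet_pullback \<tau> f) {#(l, n)#} u
    = (\<Sum>b\<in>UNIV. jcoeff f {#(b, n)#} (\<tau> u) * partial l (\<lambda>v. \<tau> v $ b) u)"
proof -
  let ?D = "\<lambda>(i, s). (Dx ^^ s) (coord_fun (\<lambda>v. \<tau> v $ i))"
  let ?S = "{p :: ('a \<times> nat) multiset. sdeg p = n \<and> (\<forall>i. (i, 0) \<notin># p)}"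
  let ?t = "\<lambda>p. jcoeff f p (\<tau> u) * jcoeff (\<Prod>x\<in>#p. ?D x) {#(l, n)#} u"
  have "jcoeff (jet_pullback \<tau> f) {#(l, n)#} u = sum ?t ?S"
    by (simp add: jet_pullback_def)
  also have "\<dots> = sum ?t ((\<lambda>b. {#(b, n)#}) ` UNIV)"
  proof (rule sum.mono_neutral_right[OF finite_positive_jets])
    show "(\<lambda>b. {#(b, n)#}) ` UNIV \<subseteq> ?S" using assms by auto
    show "\<forall>p\<in>?S - (\<lambda>b. {#(b, n)#}) ` UNIV. ?t p = 0"
    proof
      fix p assume p: "p \<in> ?S - (\<lambda>b. {#(b, n)#}) ` UNIV"
      have "p \<noteq> {#}" using p assms by auto
      then obtain x q where xq: "p = add_mset x q" by (metis multiset_cases)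
      have "q \<noteq> {#}"
      proof
        assume "q = {#}"
        then have "p = {#(fst x, n)#}" using p xq by (cases x) auto
        then show False using p by blast
      qed
      then obtain y r where yr: "q = add_mset y r" by (metis multiset_cases)
      have "snd x > 0" "snd y > 0"
        using p xq yr by (cases x, cases y, auto intro: gr0I)+
      then have "jcoeff (?D x) {#} u = 0" "jcoeff (?D y) {#} u = 0"
        by (auto simp: case_prod_unfold jcoeff_Dx_pow_coord_empty)
      then show "?t p = 0"
        by (simp add: xq yr jcoeff_mult_single jcoeff_mult_empty)
    qed
  qed
  also have "\<dots> = (\<Sum>b\<in>UNIV. ?t {#(b, n)#})"
    by (subst sum.reindex) (auto simp: inj_on_def)
  also have "\<dots> = (\<Sum>b\<in>UNIV. jcoeff f {#(b, n)#} (\<tau> u) * partial l (\<lambda>v. \<tau> v $ b) u)"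
    using assms by (simp add: jcoeff_Dx_pow_coord_single)
  finally show ?thesis .
qed

abbreviation jacobian :: "('m, 'n::finite) chart \<Rightarrow> ('m, 'n) chart \<Rightarrow> 'n \<Rightarrow> 'n \<Rightarrow> real^'n \<Rightarrow> real" where
  "jacobian c d a p u \<equiv> partial p (\<lambda>v. transition c d v $ a) u"

context
  fixes A :: "('m, 'n::finite) chart set" and k :: nat and P :: "('m, 'n) bracket_coeffs" and c d :: "('m, 'n) chart"
  assumes hb: "homogeneous_bracket A k P" and c: "c \<in> A" and d: "d \<in> A"
begin

lemma bracket_coeffs_jets_on: "s \<le> k \<Longrightarrow> P c s i j \<in> jets_on (chart_image c) {k - s}"
  using hb c diff_poly_deg_jets_on unfolding homogeneous_bracket_def by blast

lemma bracket_transformation: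
  assumes u: "u \<in> overlap c d" and s: "s \<le> k"
  shows "jcoeff (jet_pullback (transition c d) (P d s i j)) m u =
    (\<Sum>i'\<in>UNIV. \<Sum>j'\<in>UNIV. \<Sum>t\<le>k - s. real ((s + t) choose s) * (jacobian c d i i' u *
      jcoeff (P c (s + t) i' j' * (Dx ^^ t) (coord_fun (partial j' (\<lambda>v. transition c d v $ j)))) m u))"
proof -
  have of_nat: "jcoeff (of_nat n * f) m u = real n * jcoeff f m u" for n and f :: "'n jet_series"
  proof (induction n)
    case (Suc n)
    then show ?case by (simp add: distrib_right)
  qed simp
  have "eq_over (overlap c d) (jet_pullback (transition c d) (P d s i j))
          (\<Sum>i'\<in>UNIV. \<Sum>j'\<in>UNIV. \<Sum>t\<le>k - s. of_nat ((s + t) choose s) *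
             coord_fun (partial i' (\<lambda>v. transition c d v $ i)) * P c (s + t) i' j' *
             (Dx ^^ t) (coord_fun (partial j' (\<lambda>v. transition c d v $ j))))"
    using hb c d s unfolding homogeneous_bracket_def Let_def by blast
  then show ?thesis using u by (simp add: eq_over_def mult.assoc of_nat coord_fun_times)
qed

lemma overlap_subset: "overlap c d \<subseteq> chart_image c"
  by (auto simp: overlap_def chart_image_def)

lemma lead_transformation:
  assumes u: "u \<in> overlap c d"
  shows "lead_matrix k P d (transition c d u) $ i $ j =
    (\<Sum>i'\<in>UNIV. \<Sum>j'\<in>UNIV. jacobian c d i i' u * lead_matrix k P c u $ i' $ j' *
      jacobian c d j j' u)"
  using bracket_transformation[OF u, of k i j "{#}"]
  by (simp add: jcoeff_jet_pullback_empty lead_matrix_def jcoeff_mult_empty coord_fun_def mult.assoc)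

lemma lin_transformation:
  assumes u: "u \<in> overlap c d" and s: "s < k"
  shows "(\<Sum>b\<in>UNIV. lin_coeff k P s d i j b (transition c d u) * jacobian c d b l u) =
    (\<Sum>i'\<in>UNIV. \<Sum>j'\<in>UNIV. jacobian c d i i' u *
      (lin_coeff k P s c i' j' l u * jacobian c d j j' u +
       real (k choose s) * (lead_matrix k P c u $ i' $ j' * partial l (partial j' (\<lambda>v. transition c d v $ j)) u)))"
proof -
  let ?D = "\<lambda>j' t. (Dx ^^ t) (coord_fun (partial j' (\<lambda>v. transition c d v $ j)))"
  let ?m = "{#(l, k - s)#}"
  have uc: "u \<in> chart_image c" using u overlap_subset by blast
  have "(\<Sum>t\<le>k - s. real ((s + t) choose s) * (jacobian c d i i' u * jcoeff (P c (s + t) i' j' * ?D j' t) ?m u))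
      = jacobian c d i i' u *
      (lin_coeff k P s c i' j' l u * jacobian c d j j' u +
       real (k choose s) * (lead_matrix k P c u $ i' $ j' * partial l (partial j' (\<lambda>v. transition c d v $ j)) u))" for i' j'
  proof -
    let ?f = "\<lambda>t. real ((s + t) choose s) * (jacobian c d i i' u * jcoeff (P c (s + t) i' j' * ?D j' t) ?m u)"
    \<comment> \<open>For intermediate t both factors have positive degree, so their product has no
      linear part.\<close>
    have z: "?f t = 0" if "t \<in> {..k - s} - {0, k - s}" for t
    proof -
      have "jcoeff (P c (s + t) i' j') {#} u = 0"
        using jets_onD(2)[OF bracket_coeffs_jets_on[of "s + t" i' j'], of "{#}" u] that uc s by auto
      moreover have "jcoeff (?D j' t) {#} u = 0"
        using that by (auto intro!: jcoeff_Dx_pow_coord_empty)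
      ultimately show ?thesis by (simp add: jcoeff_mult_single)
    qed
    have "sum ?f {..k - s} = sum ?f {0, k - s}"
      using z by (intro sum.mono_neutral_right) auto
    also have "\<dots> = ?f 0 + ?f (k - s)" using s by simp
    also have "?f 0 = jacobian c d i i' u * (lin_coeff k P s c i' j' l u * jacobian c d j j' u)"
      by (simp add: jcoeff_mult_single coord_fun_def lin_coeff_def)
    also have "?f (k - s) = jacobian c d i i' u *
        (real (k choose s) * (lead_matrix k P c u $ i' $ j' * partial l (partial j' (\<lambda>v. transition c d v $ j)) u))"
      using s by (simp add: jcoeff_mult_single jcoeff_Dx_pow_coord_empty jcoeff_Dx_pow_coord_single lead_matrix_def)
    finally show ?thesis by (simp add: distrib_left)
  qed
  then have "jcoeff (jet_pullback (transition c d) (P d s i j)) ?m u = (\<Sum>i'\<in>UNIV. \<Sum>j'\<in>UNIV. jacobian c d i i' u *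
      (lin_coeff k P s c i' j' l u * jacobian c d j j' u +
       real (k choose s) * (lead_matrix k P c u $ i' $ j' * partial l (partial j' (\<lambda>v. transition c d v $ j)) u)))"
    using bracket_transformation[OF u less_imp_le[OF s], of i j ?m] by simp
  then show ?thesis using s by (simp add: jcoeff_jet_pullback_single lin_coeff_def)
qed

end

text \<open>Invertibility of J is read off from det G' \<noteq> 0, so the inverse transition map
  does not have to be differentiated.\<close>

lemma inverse_congruence:
  fixes G G' J :: "real^'n::finite^'n"
  assumes G: "invertible G" and G': "invertible G'" and eq: "G' = J ** G ** transpose J"
  shows "transpose J ** matrix_inv G' ** J = matrix_inv G"
proof -
  have inv: "M ** matrix_inv M = mat 1" "matrix_inv M ** M = mat 1" if "invertible M" for M :: "real^'n^'n"
    using that unfolding invertible_def matrix_inv_def by (metis (mono_tags, lifting) someI_ex)+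
  have "det J \<noteq> 0"
    using G' unfolding eq invertible_det_nz by (auto simp: det_mul)
  then have J: "invertible (transpose J)" by (simp add: invertible_det_nz)
  have "transpose J ** matrix_inv G' ** J ** G ** transpose J = transpose J ** (matrix_inv G' ** G')"
    by (simp add: eq matrix_mul_assoc)
  then have "(transpose J ** matrix_inv G' ** J ** G) ** transpose J ** matrix_inv (transpose J)
      = transpose J ** matrix_inv (transpose J)"
    by (simp add: inv(2)[OF G'])
  then have "transpose J ** matrix_inv G' ** J ** G = mat 1"
    by (simp add: inv(1)[OF J] flip: matrix_mul_assoc)
  then have "transpose J ** matrix_inv G' ** J ** (G ** matrix_inv G) = matrix_inv G"
    by (simp add: matrix_mul_assoc)
  then show ?thesis by (simp add: inv(1)[OF G])
qed

lemma open_overlap: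
  assumes M: "smooth_manifold M A" and c: "c \<in> A" and d: "d \<in> A"
  shows "open (overlap c d)"
proof -
  have h: "homeomorphic_map (subtopology M (fst c)) (top_of_set (chart_image c)) (snd c)"
    and o: "openin M (fst c)" "openin M (fst d)" "open (chart_image c)"
    using M c d by (auto simp: smooth_manifold_def)
  have "openin (subtopology M (fst c)) (fst c \<inter> fst d)"
    using o by (metis Int_commute openin_subtopology_Int)
  then have "openin (top_of_set (chart_image c)) (overlap c d)"
    using homeomorphic_imp_open_map[OF h] by (simp add: open_map_def overlap_def)
  then show ?thesis using o(3) openin_open_trans by blast
qed

lemma transition_chart_image:
  assumes M: "smooth_manifold M A" and c: "c \<in> A" and u: "u \<in> overlap c d"
  shows "transition c d u \<in> chart_image d"
proof -
  have h: "homeomorphic_map (subtopology M (fst c)) (top_of_set (chart_image c)) (snd c)"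
    and o: "openin M (fst c)"
    using M c by (auto simp: smooth_manifold_def)
  have inj: "inj_on (snd c) (fst c)"
    using homeomorphic_imp_injective_map[OF h] openin_subset[OF o] by (simp add: Int_absorb1)
  obtain x where x: "x \<in> fst c" "x \<in> fst d" "u = snd c x" using u by (auto simp: overlap_def)
  then have "transition c d u = snd d x" by (simp add: transition_def inv_into_f_f[OF inj])
  then show ?thesis using x by (simp add: chart_image_def)
qed

text \<open>The inhomogeneous term of \<open>lin_transformation\<close> carries the factor binom(k,
  s) and one factor g. The normalization of \<open>std_christoffel\<close> cancels the former and
  the inverse matrix the latter, leaving the second derivative of the transition map with
  coefficient -1 for every s.\<close>

lemma std_christoffel_transformation:
  assumes M: "smooth_manifold M A" and hb: "homogeneous_bracket A k P" and nd: "nondegenerate A k P"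
    and c: "c \<in> A" and d: "d \<in> A" and u: "u \<in> overlap c d" and s: "s < k"
  shows "(\<Sum>a\<in>UNIV. \<Sum>b\<in>UNIV. std_christoffel k P s d a b l (transition c d u) *
      jacobian c d a i u * jacobian c d b j u) =
    (\<Sum>p\<in>UNIV. jacobian c d l p u * std_christoffel k P s c i j p u)
      - partial i (partial j (\<lambda>v. transition c d v $ l)) u"
proof -
  define J where "J = (\<lambda>a p. jacobian c d a p u)"
  define dJ where "dJ = (\<lambda>i j. partial i (partial j (\<lambda>v. transition c d v $ l)) u)"
  define G where "G = lead_matrix k P c u"
  define G' where "G' = lead_matrix k P d (transition c d u)"
  define h where "h = (\<lambda>p q j. lin_coeff k P s c p q j u)"
  define h' where "h' = (\<lambda>p b. lin_coeff k P s d p l b (transition c d u))"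
  define C where "C = real (k choose s)"
  have C: "C \<noteq> 0" using s by (simp add: C_def)
  have uc: "u \<in> chart_image c" using u by (auto simp: overlap_def chart_image_def)
  have sm: "smooth_fun_on (overlap c d) (\<lambda>v. transition c d v $ l)"
    using M c d by (auto simp: smooth_manifold_def smooth_map_on_def)
  have dJ_sym: "dJ j i = dJ i j"
    unfolding dJ_def by (rule smooth_partial_commute[OF open_overlap[OF M c d] sm u])
  have invG: "invertible G" using nd c uc by (simp add: nondegenerate_def G_def)
  have invG': "invertible G'"
    using nd d transition_chart_image[OF M c u] by (simp add: nondegenerate_def G'_def)
  have "G' = (\<chi> a p. J a p) ** G ** transpose (\<chi> a p. J a p)"
  proof -
    have "G' $ a $ b = (\<Sum>q\<in>UNIV. (\<Sum>p\<in>UNIV. J a p * G $ p $ q) * J b q)" for a b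
    proof -
      have "G' $ a $ b = (\<Sum>p\<in>UNIV. \<Sum>q\<in>UNIV. J a p * G $ p $ q * J b q)"
        using lead_transformation[OF hb c d u, of a b] by (simp add: G'_def G_def J_def)
      also have "\<dots> = (\<Sum>q\<in>UNIV. \<Sum>p\<in>UNIV. J a p * G $ p $ q * J b q)" by (rule sum.swap)
      finally show ?thesis by (simp add: sum_distrib_right)
    qed
    then show ?thesis by (simp add: vec_eq_iff matrix_matrix_mult_def transpose_def)
  qed
  note ic = inverse_congruence[OF invG invG' this]
  have key: "(\<Sum>a\<in>UNIV. \<Sum>i'\<in>UNIV. J a i * matrix_inv G' $ a $ i' * J i' p) = matrix_inv G $ i $ p" for p
  proof -
    have "matrix_inv G $ i $ p = (\<Sum>i'\<in>UNIV. (\<Sum>a\<in>UNIV. J a i * matrix_inv G' $ a $ i') * J i' p)"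
      unfolding ic[symmetric] by (simp add: matrix_matrix_mult_def transpose_def)
    also have "\<dots> = (\<Sum>a\<in>UNIV. \<Sum>i'\<in>UNIV. J a i * matrix_inv G' $ a $ i' * J i' p)"
      unfolding sum_distrib_right by (rule sum.swap)
    finally show ?thesis ..
  qed
  have lin: "(\<Sum>b\<in>UNIV. h' i' b * J b j) = (\<Sum>p\<in>UNIV. J i' p * (\<Sum>q\<in>UNIV. h p q j * J l q + C * (G $ p $ q * dJ j q)))" for i'
    using lin_transformation[OF hb c d u s, of i' l j]
    by (simp add: h'_def h_def J_def G_def dJ_def C_def sum_distrib_left)
  have "(\<Sum>a\<in>UNIV. \<Sum>b\<in>UNIV. std_christoffel k P s d a b l (transition c d u) * J a i * J b j)
      = - (1 / C) * (\<Sum>a\<in>UNIV. \<Sum>b\<in>UNIV. \<Sum>i'\<in>UNIV. J a i * matrix_inv G' $ a $ i' * (h' i' b * J b j))"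
    by (simp add: std_christoffel_def G'_def h'_def C_def sum_distrib_left sum_distrib_right sum_negf mult_ac)
  also have "(\<Sum>a\<in>UNIV. \<Sum>b\<in>UNIV. \<Sum>i'\<in>UNIV. J a i * matrix_inv G' $ a $ i' * (h' i' b * J b j))
      = (\<Sum>a\<in>UNIV. \<Sum>i'\<in>UNIV. J a i * matrix_inv G' $ a $ i' * (\<Sum>b\<in>UNIV. h' i' b * J b j))"
    unfolding sum_distrib_left by (rule sum.cong[OF refl], rule sum.swap)
  also have "\<dots> = (\<Sum>a\<in>UNIV. \<Sum>i'\<in>UNIV. \<Sum>p\<in>UNIV. J a i * matrix_inv G' $ a $ i' * J i' p *
      (\<Sum>q\<in>UNIV. h p q j * J l q + C * (G $ p $ q * dJ j q)))"
    unfolding lin sum_distrib_left[of "J a i * matrix_inv G' $ a $ i'" for a i'] by (simp add: mult.assoc)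
  also have "\<dots> = (\<Sum>p\<in>UNIV. \<Sum>a\<in>UNIV. \<Sum>i'\<in>UNIV. J a i * matrix_inv G' $ a $ i' * J i' p *
      (\<Sum>q\<in>UNIV. h p q j * J l q + C * (G $ p $ q * dJ j q)))"
    by (rule trans[OF _ sum.swap], rule sum.cong[OF refl], rule sum.swap)
  also have "\<dots> = (\<Sum>p\<in>UNIV. matrix_inv G $ i $ p * (\<Sum>q\<in>UNIV. h p q j * J l q + C * (G $ p $ q * dJ j q)))"
    unfolding key[symmetric] sum_distrib_right ..
  also have "\<dots> = (\<Sum>p\<in>UNIV. \<Sum>q\<in>UNIV. matrix_inv G $ i $ p * h p q j * J l q)
      + C * (\<Sum>p\<in>UNIV. \<Sum>q\<in>UNIV. matrix_inv G $ i $ p * G $ p $ q * dJ j q)"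
    by (simp add: sum_distrib_left distrib_left sum.distrib mult_ac)
  also have "(\<Sum>p\<in>UNIV. \<Sum>q\<in>UNIV. matrix_inv G $ i $ p * G $ p $ q * dJ j q) = dJ i j"
  proof -
    have "(\<Sum>p\<in>UNIV. \<Sum>q\<in>UNIV. matrix_inv G $ i $ p * G $ p $ q * dJ j q)
        = (\<Sum>q\<in>UNIV. \<Sum>p\<in>UNIV. matrix_inv G $ i $ p * G $ p $ q * dJ j q)" by (rule sum.swap)
    also have "\<dots> = (\<Sum>q\<in>UNIV. (if i = q then 1 else 0) * dJ j q)"
      unfolding matrix_inv_cancel(2)[OF invG, symmetric] sum_distrib_right ..
    also have "\<dots> = dJ j i" by (simp add: if_distrib[of "\<lambda>x. x * _"] sum.delta' cong: if_cong)
    finally show ?thesis by (simp add: dJ_sym)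
  qed
  also have "(\<Sum>p\<in>UNIV. \<Sum>q\<in>UNIV. matrix_inv G $ i $ p * h p q j * J l q)
      = (\<Sum>q\<in>UNIV. \<Sum>p\<in>UNIV. matrix_inv G $ i $ p * h p q j * J l q)" by (rule sum.swap)
  also have "- (1 / C) * ((\<Sum>q\<in>UNIV. \<Sum>p\<in>UNIV. matrix_inv G $ i $ p * h p q j * J l q) + C * dJ i j)
      = (\<Sum>q\<in>UNIV. J l q * std_christoffel k P s c i j q u) - dJ i j"
    using C by (simp add: std_christoffel_def G_def h_def C_def[symmetric] sum_distrib_left distrib_left
        sum_negf mult_ac)
  finally show ?thesis unfolding J_def dJ_def .
qed

section \<open>Flatness\<close>

definition comb_christoffel :: "nat \<Rightarrow> ('m, 'n::finite) bracket_coeffs \<Rightarrow> nat \<Rightarrow> ('m, 'n) chart \<Rightarrow> 'n christoffel" where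
  "comb_christoffel k P s c i j l u = (\<Sum>t\<le>s. comb_coeff k s t * std_christoffel k P t c i j l u)"

text \<open>The coefficients sum to 1, so the derivative term common to all the connections occurs
  exactly once.\<close>

lemma comb_connection_eq: "comb_connection k P s c X Y u = cov_deriv (comb_christoffel k P s c) X Y u"
proof -
  have "comb_connection k P s c X Y u $ l = cov_deriv (comb_christoffel k P s c) X Y u $ l" for l
  proof -
    define D where "D = (\<Sum>i\<in>UNIV. X u $ i * partial i (\<lambda>v. Y v $ l) u)"
    have cd: "cov_deriv \<Gamma> X Y u $ l = D + (\<Sum>i\<in>UNIV. \<Sum>j\<in>UNIV. \<Gamma> i j l u * X u $ i * Y u $ j)" for \<Gamma>
      by (simp add: cov_deriv_component D_def)
    have "comb_connection k P s c X Y u $ l = (\<Sum>t\<le>s. comb_coeff k s t) * D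
        + (\<Sum>t\<le>s. \<Sum>i\<in>UNIV. \<Sum>j\<in>UNIV. comb_coeff k s t * std_christoffel k P t c i j l u * X u $ i * Y u $ j)"
      by (simp add: comb_connection_def std_connection_def cd distrib_left sum.distrib
          sum_distrib_left sum_distrib_right mult.assoc)
    also have "(\<Sum>t\<le>s. \<Sum>i\<in>UNIV. \<Sum>j\<in>UNIV. comb_coeff k s t * std_christoffel k P t c i j l u * X u $ i * Y u $ j)
        = (\<Sum>i\<in>UNIV. \<Sum>j\<in>UNIV. \<Sum>t\<le>s. comb_coeff k s t * std_christoffel k P t c i j l u * X u $ i * Y u $ j)"
      by (subst sum.swap, rule sum.cong[OF refl], rule sum.swap)
    finally show ?thesis
      by (simp add: cd comb_christoffel_def sum_distrib_right sum_comb_coeff)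
  qed
  then show ?thesis by (simp add: vec_eq_iff)
qed

lemma comb_christoffel_transformation:
  assumes M: "smooth_manifold M A" and hb: "homogeneous_bracket A k P" and nd: "nondegenerate A k P"
    and c: "c \<in> A" and d: "d \<in> A" and u: "u \<in> overlap c d" and s: "s < k"
  shows "(\<Sum>a\<in>UNIV. \<Sum>b\<in>UNIV. comb_christoffel k P s d a b l (transition c d u) *
      jacobian c d a i u * jacobian c d b j u) =
    (\<Sum>p\<in>UNIV. jacobian c d l p u * comb_christoffel k P s c i j p u)
      - partial i (partial j (\<lambda>v. transition c d v $ l)) u"
proof -
  let ?J = "\<lambda>a p. jacobian c d a p u" and ?d = "partial i (partial j (\<lambda>v. transition c d v $ l)) u"
  have "(\<Sum>a\<in>UNIV. \<Sum>b\<in>UNIV. comb_christoffel k P s d a b l (transition c d u) * ?J a i * ?J b j)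
      = (\<Sum>a\<in>UNIV. \<Sum>b\<in>UNIV. \<Sum>t\<le>s. comb_coeff k s t * (std_christoffel k P t d a b l (transition c d u) * ?J a i * ?J b j))"
    by (simp add: comb_christoffel_def sum_distrib_right mult.assoc)
  also have "\<dots> = (\<Sum>t\<le>s. \<Sum>a\<in>UNIV. \<Sum>b\<in>UNIV. comb_coeff k s t * (std_christoffel k P t d a b l (transition c d u) * ?J a i * ?J b j))"
    by (rule trans[OF _ sum.swap], rule sum.cong[OF refl], rule sum.swap)
  also have "\<dots> = (\<Sum>t\<le>s. comb_coeff k s t * ((\<Sum>p\<in>UNIV. ?J l p * std_christoffel k P t c i j p u) - ?d))"
    using std_christoffel_transformation[OF M hb nd c d u] s
    by (simp add: sum_distrib_left[symmetric])
  also have "\<dots> = (\<Sum>t\<le>s. \<Sum>p\<in>UNIV. ?J l p * (comb_coeff k s t * std_christoffel k P t c i j p u)) - (\<Sum>t\<le>s. comb_coeff k s t) * ?d"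
    by (simp add: right_diff_distrib sum_subtractf sum_distrib_left sum_distrib_right mult.left_commute)
  also have "(\<Sum>t\<le>s. \<Sum>p\<in>UNIV. ?J l p * (comb_coeff k s t * std_christoffel k P t c i j p u))
      = (\<Sum>p\<in>UNIV. \<Sum>t\<le>s. ?J l p * (comb_coeff k s t * std_christoffel k P t c i j p u))" by (rule sum.swap)
  finally show ?thesis by (simp add: comb_christoffel_def sum_distrib_left sum_comb_coeff)
qed

section \<open>Vanishing curvature of the combined connections in one chart\<close>

context
  fixes A :: "('m, 'n::finite) chart set" and k s :: nat and P :: "('m, 'n) bracket_coeffs" and c :: "('m, 'n) chart"
  assumes U: "open (chart_image c)" and hp: "homogeneous_poisson_bracket A k P" and nd: "nondegenerate A k P"
    and c: "c \<in> A" and s: "s < k"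
begin

lemma chart_jets_on: "r \<le> k \<Longrightarrow> P c r i j \<in> jets_on (chart_image c) {k - r}"
  using hp c by (auto simp: homogeneous_poisson_bracket_def intro: bracket_coeffs_jets_on)

lemma chart_poisson: "poisson_over (chart_image c) k (P c)"
  using hp c by (simp add: homogeneous_poisson_bracket_def)

lemma lin_coeff_eq_lin_symb: "t < k \<Longrightarrow> lin_coeff k P t c i j l u = lin_symb k (P c) t l i j u"
  by (simp add: lin_coeff_def lin_symb_def jcoeff_jet_partial_pos)

lemma invertible_lead: "u \<in> chart_image c \<Longrightarrow> invertible (lead_matrix k P c u)"
  using nd c by (simp add: nondegenerate_def)

text \<open>The factor binom(k, t) in \<open>comb_coeff\<close> cancels the normalization of the
  standard connection, and what remains of the coefficient is, up to (-1)^k, the one produced by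
  \<open>hop_dpow\<close>.\<close>

lemma comb_christoffel_act_coeff:
  "comb_christoffel k P s c i j l u = - ((-1) ^ k * (\<Sum>i'\<in>UNIV. matrix_inv (lead_matrix k P c u) $ i $ i' *
    frame_coeff k s (P c) j i' l u))"
proof -
  have "comb_coeff k s t * std_christoffel k P t c i j l u = - ((-1) ^ k * (\<Sum>i'\<in>UNIV. matrix_inv (lead_matrix k P c u) $ i $ i' *
      ((-1) ^ (k - t) * real (k + s - t choose k) * lin_symb k (P c) t j i' l u)))" if "t \<le> s" for t
  proof -
    have tk: "t < k" using that s by simp
    have "(-1 :: real) ^ t = (-1) ^ k * (-1) ^ (k - t)"
    proof -
      have "(-1 :: real) ^ k = (-1) ^ t * (-1) ^ (k - t)"
        using tk by (metis le_add_diff_inverse less_imp_le power_add)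
      then show ?thesis by (simp add: mult.assoc flip: power_mult_distrib)
    qed
    moreover have "real (k choose t) \<noteq> 0" using tk by simp
    ultimately show ?thesis
      by (simp add: comb_coeff_def std_christoffel_def lin_coeff_eq_lin_symb[OF tk] sum_distrib_left sum_negf mult_ac)
  qed
  then have "comb_christoffel k P s c i j l u = (\<Sum>t\<le>s. - ((-1) ^ k * (\<Sum>i'\<in>UNIV. matrix_inv (lead_matrix k P c u) $ i $ i' *
      ((-1) ^ (k - t) * real (k + s - t choose k) * lin_symb k (P c) t j i' l u))))"
    by (simp add: comb_christoffel_def)
  also have "\<dots> = - ((-1) ^ k * (\<Sum>t\<le>s. \<Sum>i'\<in>UNIV. matrix_inv (lead_matrix k P c u) $ i $ i' *
      ((-1) ^ (k - t) * real (k + s - t choose k) * lin_symb k (P c) t j i' l u)))"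
    by (simp add: sum_negf sum_distrib_left)
  also have "(\<Sum>t\<le>s. \<Sum>i'\<in>UNIV. matrix_inv (lead_matrix k P c u) $ i $ i' *
      ((-1) ^ (k - t) * real (k + s - t choose k) * lin_symb k (P c) t j i' l u))
    = (\<Sum>i'\<in>UNIV. \<Sum>t\<le>s. matrix_inv (lead_matrix k P c u) $ i $ i' *
      ((-1) ^ (k - t) * real (k + s - t choose k) * lin_symb k (P c) t j i' l u))" by (rule sum.swap)
  finally show ?thesis by (simp add: act_coeff_def sum_distrib_left)
qed

lemma smooth_lead: "smooth_fun_on (chart_image c) (jcoeff (P c k i j) {#})"
  by (rule jets_onD(1)[OF chart_jets_on]) simp

lemma smooth_comb_christoffel: "smooth_fun_on (chart_image c) (comb_christoffel k P s c i j l)"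
proof -
  have "smooth_fun_on (chart_image c) (\<lambda>u. matrix_inv (lead_matrix k P c u) $ i $ i')" for i'
  proof (rule smooth_matrix_inv[OF U])
    show "smooth_fun_on (chart_image c) (\<lambda>u. lead_matrix k P c u $ a $ b)" for a b
      using smooth_lead by (simp add: lead_matrix_def)
  qed (rule invertible_lead)
  moreover have "smooth_fun_on (chart_image c) (\<lambda>u. frame_coeff k s (P c) j i' l u)" for i'
    unfolding act_coeff_def using s
    by (intro smooth_sum[OF U] smooth_mult[OF U] smooth_const[OF U] smooth_lin_symb[OF U chart_jets_on chart_poisson]) auto
  ultimately show ?thesis
    unfolding comb_christoffel_act_coeff[abs_def]
    by (intro smooth_uminus[OF U] smooth_mult[OF U] smooth_const[OF U] smooth_sum[OF U])
qed

text \<open>\<open>frame_coeff k s\<close> is both the matrix of the action of x^k on x^s and the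
  contraction of the combined Christoffel symbols with the frame, so the structure equations turn
  into vanishing curvature on that frame.\<close>

lemma riemann_comb_christoffel:
  assumes u: "u \<in> chart_image c"
  shows "riemann (comb_christoffel k P s c) a b q m u = 0"
proof (rule riemann_zero_from_frame[OF U u,
      where g = "\<lambda>i j. jcoeff (P c k i j) {#}" and ginv = "\<lambda>i j. matrix_inv (lead_matrix k P c u) $ i $ j"
        and A = "\<lambda>q i m v. frame_coeff k s (P c) q i m v"
        and B = "\<lambda>q i m. frame_coeff k k (P c) q i m u"])
  note Q = chart_jets_on and Po = chart_poisson
  have skew: "jcoeff (P c k j i) {#} v = (-1) ^ Suc k * jcoeff (P c k i j) {#} v" if "v \<in> chart_image c" for i j v
    by (rule leading_skew[OF U that Q Po])
  have lin_k: "lin_symb k (P c) k p i j u = partial p (jcoeff (P c k i j) {#}) u" for p i j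
    by (simp add: lin_symb_def)
  have dg: "jcoeff (P c k i j) {#} differentiable (at u)" for i j
    using smooth_lead u by (rule smooth_differentiable)
  show "jcoeff (P c k i j) {#} differentiable (at u)" for i j by (rule dg)
  show "comb_christoffel k P s c i j l differentiable (at u)" for i j l
    using smooth_comb_christoffel u by (rule smooth_differentiable)
  show "(\<Sum>r\<in>UNIV. jcoeff (P c k i r) {#} u * matrix_inv (lead_matrix k P c u) $ r $ j) = (if i = j then 1 else 0)" for i j
    using matrix_inv_cancel(1)[OF invertible_lead[OF u], of i j] by (simp add: lead_matrix_def)
  show "frame_coeff k s (P c) q i m v = (\<Sum>r\<in>UNIV. jcoeff (P c k r i) {#} v * comb_christoffel k P s c r q m v)"
    if v: "v \<in> chart_image c" for v q i m
  proof -
    let ?a = "\<lambda>i'. frame_coeff k s (P c) q i' m v"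
    let ?G = "lead_matrix k P c v"
    have "(\<Sum>r\<in>UNIV. jcoeff (P c k r i) {#} v * comb_christoffel k P s c r q m v)
        = (\<Sum>r\<in>UNIV. \<Sum>i'\<in>UNIV. ?G $ i $ r * matrix_inv ?G $ r $ i' * ?a i')"
    proof (rule sum.cong[OF refl])
      fix r
      \<comment> \<open>The sign from transposing g compensates the one in
        \<open>comb_christoffel_act_coeff\<close>, so the contraction of g with its inverse comes
        out with sign +1.\<close>
      have sg: "((-1) ^ Suc k * x) * (- ((-1) ^ k * y)) = x * y" for x y :: real
        by (cases "even k") auto
      have Gr: "jcoeff (P c k i r) {#} v = ?G $ i $ r" by (simp add: lead_matrix_def)
      show "jcoeff (P c k r i) {#} v * comb_christoffel k P s c r q m v = (\<Sum>i'\<in>UNIV. ?G $ i $ r * matrix_inv ?G $ r $ i' * ?a i')"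
        unfolding comb_christoffel_act_coeff skew[OF v, of r i] sg Gr by (simp add: sum_distrib_left mult.assoc)
    qed
    also have "\<dots> = (\<Sum>i'\<in>UNIV. \<Sum>r\<in>UNIV. ?G $ i $ r * matrix_inv ?G $ r $ i' * ?a i')" by (rule sum.swap)
    also have "\<dots> = (\<Sum>i'\<in>UNIV. (if i = i' then 1 else 0) * ?a i')"
      unfolding matrix_inv_cancel(1)[OF invertible_lead[OF v], symmetric] sum_distrib_right ..
    also have "\<dots> = ?a i" by (simp add: if_distrib[of "\<lambda>x. x * _"] sum.delta' cong: if_cong)
    finally show ?thesis ..
  qed
  show "(\<Sum>p\<in>UNIV. frame_coeff k k (P c) p i j u * jcoeff (P c k r p) {#} u)
      + (\<Sum>p\<in>UNIV. jcoeff (P c k p i) {#} u * partial p (jcoeff (P c k r j) {#}) u)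
      - (\<Sum>p\<in>UNIV. jcoeff (P c k p j) {#} u * partial p (jcoeff (P c k r i) {#}) u) = 0" for i j r
  proof -
    \<comment> \<open>Here transposing g turns the sign (-1)^k of \<open>anchor_identity\<close>
      into an overall minus, as the frame g^{pi} \<partial>_p requires.\<close>
    have sg: "(-1) ^ k * x * ((-1) ^ Suc k * y) = - (x * y)" for x y :: real
      by (cases "even k") auto
    have "(\<Sum>p\<in>UNIV. (-1) ^ k * frame_coeff k k (P c) p i j u * jcoeff (P c k p r) {#} u)
        = - (\<Sum>p\<in>UNIV. frame_coeff k k (P c) p i j u * jcoeff (P c k r p) {#} u)"
      unfolding sum_negf[symmetric]
    proof (intro sum.cong refl)
      fix p
      show "(-1) ^ k * frame_coeff k k (P c) p i j u * jcoeff (P c k p r) {#} u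
          = - (frame_coeff k k (P c) p i j u * jcoeff (P c k r p) {#} u)"
        unfolding skew[OF u, of p r] by (rule sg)
    qed
    then show ?thesis
      using anchor_identity[OF U Q Po u, of i j r] by (simp add: lin_k mult.commute)
  qed
  show "(\<Sum>p\<in>UNIV. frame_coeff k k (P c) p i j u * frame_coeff k s (P c) q p m u)
      + (\<Sum>p\<in>UNIV. jcoeff (P c k p i) {#} u * partial p (\<lambda>v. frame_coeff k s (P c) q j m v) u
          - frame_coeff k s (P c) p j m u * frame_coeff k s (P c) q i p u)
      + (\<Sum>p\<in>UNIV. frame_coeff k s (P c) p i m u * frame_coeff k s (P c) q j p u
          - jcoeff (P c k p j) {#} u * partial p (\<lambda>v. frame_coeff k s (P c) q i m v) u) = 0" for i j q m
    by (rule action_identity[OF U Q Po u s])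
qed

end

theorem mainTheorem1:
  fixes M :: "'m topology"
    and A :: "('m, 'n::finite) chart set"
    and k :: nat
    and P :: "('m, 'n) bracket_coeffs"
  assumes "1 \<le> k"
    and "smooth_manifold M A"
    and "homogeneous_poisson_bracket A k P"
    and "nondegenerate A k P"
  shows "\<forall>s<k. flat_connection A (comb_connection k P s)"
proof (intro allI impI)
  fix s assume s: "s < k"
  note M = assms(2) and hp = assms(3) and nd = assms(4)
  have hb: "homogeneous_bracket A k P" using hp by (simp add: homogeneous_poisson_bracket_def)
  have U: "open (chart_image c)" if "c \<in> A" for c using M that by (simp add: smooth_manifold_def)
  have eq: "comb_connection k P s c = cov_deriv (comb_christoffel k P s c)" for c
    by (intro ext) (rule comb_connection_eq)
  have "christoffel_family A (comb_christoffel k P s)"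
    unfolding christoffel_family_def Let_def
    using smooth_comb_christoffel[OF U hp nd _ s] comb_christoffel_transformation[OF M hb nd _ _ _ s] by blast
  then have "is_connection A (comb_connection k P s)"
    unfolding is_connection_def eq by blast
  moreover have "curvature (comb_connection k P s c) X Y Z u = 0"
    if "c \<in> A" "smooth_map_on (chart_image c) X" "smooth_map_on (chart_image c) Y"
      "smooth_map_on (chart_image c) Z" "u \<in> chart_image c" for c X Y Z u
  proof -
    have "curvature (cov_deriv (comb_christoffel k P s c)) X Y Z u $ l = 0" for l
      using curvature_cov_deriv[OF U[OF that(1)] that(5) smooth_comb_christoffel[OF U[OF that(1)] hp nd that(1) s] that(2-4)]
        riemann_comb_christoffel[OF U[OF that(1)] hp nd that(1) s that(5)]
      by simp
    then show ?thesis by (simp add: eq vec_eq_iff)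
  qed
  ultimately show "flat_connection A (comb_connection k P s)"
    by (simp add: flat_connection_def)
qed

end
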